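(* Let $T$ be a (connected) abelian Lie group with Lie algebra $\mathfrak t$, acting nontrivially by triholomorphic isometries on a connected hyper-Kähler manifold $M$ with zero first Betti number. Let $\phi:M\to(\mathfrak t\otimes\mathrm{Im}\,\mathbb H)^*$ be the hyper-Kähler moment map. If the action has a fixed point, then $\phi$ is horizontally weakly conformal, with respect to some Euclidean metric on $\mathfrak t$, if and only if $\dim T=1$.
   Context: Let $(g,J_1,J_2,J_3)$ be the hyper-Kähler structure of $M$ ($J_1J_2=J_3=-J_2J_1$), and for $q=(q^1,q^2,q^3)\in S^2\subseteq\mathrm{Im}\,\mathbb H=\mathbb R^3$ put $J_q=\sum_j q^jJ_j$, with Kähler form $\omega_q(X,Y)=g(J_qX,Y)$. An isometry is triholomorphic if it is holomorphic with respect to $J_1,J_2,J_3$. The hyper-Kähler moment map $\phi:M\to(\mathfrak t\otimes\mathrm{Im}\,\mathbb H)^*$ is characterised by the following: for any $v\in\mathfrak t$ and unit $q\in\mathrm{Im}\,\mathbb H$, the function $x\mapsto\phi(x)(v\otimes q)$ is the Hamiltonian, with respect to $\omega_q$, of the fundamental vector field $V$ on $M$ corresponding to $v$ (i.e. its differential is $\omega_q(V,\cdot)$, up to a global sign convention). A smooth map $\phi:(M,g)\to(N,h)$ between Riemannian manifolds is horizontally weakly conformal if at each $x\in M$ either $d\phi_x=0$, or $d\phi_x$ restricted to $(\ker d\phi_x)^\perp$ is a conformal linear isomorphism onto $T_{\phi(x)}N$. "With respect to some Euclidean metric on $\mathfrak t$" means that $(\mathfrak t\otimes\mathrm{Im}\,\mathbb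 H)^*$ carries the Euclidean metric induced by the one on $\mathfrak t$ and the canonical one on $\mathrm{Im}\,\mathbb H$. An action is nontrivial if it has at least one orbit that is not a fixed point. *)

theory Defs
  imports
    "HOL-Analysis.Analysis"
    "HOL-Homology.Homology"
    "HOL-Library.Function_Algebras"
    "HOL-Library.Extended_Nat"
begin

text \<open>Tangent vectors and elements of dual spaces are functions below; they are added and scaled
  pointwise.\<close>

instantiation "fun" :: (type, real_vector) real_vector
begin

definition scaleR_fun_def: "r *\<^sub>R f = (\<lambda>x. r *\<^sub>R f x)"

instance
  by standard (auto simp: scaleR_fun_def plus_fun_def fun_eq_iff scaleR_add_right scaleR_add_left)

end

definition linear_map_on :: "'v::real_vector set \<Rightarrow> ('v \<Rightarrow> 'w::real_vector) \<Rightarrow> bool" where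
  "linear_map_on V f \<longleftrightarrow>
     (\<forall>u\<in>V. \<forall>v\<in>V. f (u + v) = f u + f v) \<and> (\<forall>r. \<forall>v\<in>V. f (r *\<^sub>R v) = r *\<^sub>R f v)"

definition inner_product_on :: "'v::real_vector set \<Rightarrow> ('v \<Rightarrow> 'v \<Rightarrow> real) \<Rightarrow> bool" where
  "inner_product_on V h \<longleftrightarrow>
     (\<forall>u\<in>V. linear_map_on V (h u)) \<and>
     (\<forall>u\<in>V. \<forall>v\<in>V. h u v = h v u) \<and>
     (\<forall>u\<in>V. u \<noteq> 0 \<longrightarrow> 0 < h u u)"

definition orthonormal_basis ::
  "'v::real_vector set \<Rightarrow> ('v \<Rightarrow> 'v \<Rightarrow> real) \<Rightarrow> 'v set \<Rightarrow> bool" where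
  "orthonormal_basis V h E \<longleftrightarrow>
     finite E \<and> E \<subseteq> V \<and> span E = V \<and> (\<forall>e\<in>E. \<forall>f\<in>E. h e f = (if e = f then 1 else 0))"


section \<open>Smooth maps between open subsets of Euclidean spaces\<close>

primrec times_continuously_differentiable_on ::
  "nat \<Rightarrow> 'e::euclidean_space set \<Rightarrow> ('e \<Rightarrow> 'f::euclidean_space) \<Rightarrow> bool" where
  "times_continuously_differentiable_on 0 S f \<longleftrightarrow> continuous_on S f"
| "times_continuously_differentiable_on (Suc n) S f \<longleftrightarrow>
     (\<forall>x\<in>S. f differentiable (at x)) \<and>
     (\<forall>v. times_continuously_differentiable_on n S (\<lambda>x. frechet_derivative f (at x) v))"

text \<open>Only used for open \<open>S\<close>.\<close>

definition smooth_on ::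
  "'e::euclidean_space set \<Rightarrow> ('e \<Rightarrow> 'f::euclidean_space) \<Rightarrow> bool" where
  "smooth_on S f \<longleftrightarrow> (\<forall>n. times_continuously_differentiable_on n S f)"


section \<open>Smooth manifolds\<close>

text \<open>
  The underlying space of a manifold is a type; its charts take values in the Euclidean space
  \<open>'e\<close>, so that \<open>DIM('e)\<close> is the dimension of the manifold. A chart is given by its
  domain and a map, whose values off the domain are irrelevant. Dimension \<open>0\<close> is not covered:
  a manifold of dimension \<open>0\<close> carries no nontrivial action of a connected Lie group, and a
  connected Lie group of dimension \<open>0\<close> is trivial and hence has no nontrivial action.
\<close>

type_synonym ('a, 'e) chart = "'a set \<times> ('a \<Rightarrow> 'e)"

abbreviation chart_inv :: "('a, 'e) chart \<Rightarrow> 'e \<Rightarrow> 'a" where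
  "chart_inv c \<equiv> inv_into (fst c) (snd c)"

abbreviation chart_image :: "('a, 'e) chart \<Rightarrow> 'e set" where
  "chart_image c \<equiv> snd c ` fst c"

definition is_chart :: "('a::topological_space, 'e::euclidean_space) chart \<Rightarrow> bool" where
  "is_chart c \<longleftrightarrow> open (fst c) \<and> open (chart_image c) \<and>
     homeomorphism (fst c) (chart_image c) (snd c) (chart_inv c)"

definition compatible_charts ::
  "('a::topological_space, 'e::euclidean_space) chart \<Rightarrow> ('a, 'e) chart \<Rightarrow> bool" where
  "compatible_charts c d \<longleftrightarrow>
     smooth_on (snd c ` (fst c \<inter> fst d)) (snd d \<circ> chart_inv c) \<and>
     smooth_on (snd d ` (fst c \<inter> fst d)) (snd c \<circ> chart_inv d)"

definition smooth_atlas :: "('a::topological_space, 'e::euclidean_space) chart set \<Rightarrow> bool" where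
  "smooth_atlas A \<longleftrightarrow>
     (\<forall>c\<in>A. is_chart c) \<and> (\<Union>c\<in>A. fst c) = UNIV \<and> (\<forall>c\<in>A. \<forall>d\<in>A. compatible_charts c d)"

definition smooth_structure ::
  "('a::{t2_space, second_countable_topology}, 'e::euclidean_space) chart set \<Rightarrow> bool" where
  "smooth_structure A \<longleftrightarrow> smooth_atlas A \<and>
     (\<forall>c. is_chart c \<and> (\<forall>d\<in>A. compatible_charts c d) \<longrightarrow> c \<in> A)"

definition product_atlas ::
  "('a::topological_space, 'e::euclidean_space) chart set \<Rightarrow>
   ('b::topological_space, 'f::euclidean_space) chart set \<Rightarrow> ('a \<times> 'b, 'e \<times> 'f) chart set" where
  "product_atlas A B = {(fst c \<times> fst d, map_prod (snd c) (snd d)) | c d. c \<in> A \<and> d \<in> B}"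

definition smooth_map ::
  "('a::topological_space, 'e::euclidean_space) chart set \<Rightarrow>
   ('b::topological_space, 'f::euclidean_space) chart set \<Rightarrow> ('a \<Rightarrow> 'b) \<Rightarrow> bool" where
  "smooth_map A B f \<longleftrightarrow> continuous_on UNIV f \<and>
     (\<forall>c\<in>A. \<forall>d\<in>B. smooth_on (snd c ` (fst c \<inter> f -` fst d)) (snd d \<circ> f \<circ> chart_inv c))"

definition smooth_function ::
  "('a::topological_space, 'e::euclidean_space) chart set \<Rightarrow> ('a \<Rightarrow> real) \<Rightarrow> bool" where
  "smooth_function A f \<longleftrightarrow> (\<forall>c\<in>A. smooth_on (chart_image c) (f \<circ> chart_inv c))"


section \<open>Tangent vectors and derivatives\<close>

text \<open>
  A tangent vector at \<open>x\<close> is a family of coordinate vectors, one for each chart around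
  \<open>x\<close>, related by the derivatives of the transition maps. At all other indices the family is
  \<open>0\<close>, so that \<open>tangent_space A x\<close> is a subspace of the space of all families.
\<close>

type_synonym ('a, 'e) tvec = "('a, 'e) chart \<Rightarrow> 'e"

definition tangent_space ::
  "('a::topological_space, 'e::euclidean_space) chart set \<Rightarrow> 'a \<Rightarrow> ('a, 'e) tvec set" where
  "tangent_space A x = {v.
     (\<forall>c\<in>A. \<forall>d\<in>A. x \<in> fst c \<and> x \<in> fst d \<longrightarrow>
        v d = frechet_derivative (snd d \<circ> chart_inv c) (at (snd c x)) (v c)) \<and>
     (\<forall>c. c \<notin> A \<or> x \<notin> fst c \<longrightarrow> v c = 0)}"

text \<open>The tangent vector at \<open>x\<close> with coordinates \<open>u\<close> in the chart \<open>c\<close>.\<close>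

definition coord_vec ::
  "('a::topological_space, 'e::euclidean_space) chart set \<Rightarrow> ('a, 'e) chart \<Rightarrow> 'a \<Rightarrow> 'e \<Rightarrow>
   ('a, 'e) tvec" where
  "coord_vec A c x u = (\<lambda>d. if d \<in> A \<and> x \<in> fst d
     then frechet_derivative (snd d \<circ> chart_inv c) (at (snd c x)) u else 0)"

definition chart_at :: "('a, 'e) chart set \<Rightarrow> 'a \<Rightarrow> ('a, 'e) chart" where
  "chart_at A x = (SOME c. c \<in> A \<and> x \<in> fst c)"

text \<open>By the chain rule the next two definitions do not depend on the chart chosen at \<open>x\<close>.\<close>

definition tangent_map ::
  "('a::topological_space, 'e::euclidean_space) chart set \<Rightarrow>
   ('b::topological_space, 'f::euclidean_space) chart set \<Rightarrow> ('a \<Rightarrow> 'b) \<Rightarrow> 'a \<Rightarrow>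
   ('a, 'e) tvec \<Rightarrow> ('b, 'f) tvec" where
  "tangent_map A B f x v = (let c = chart_at A x in
     (\<lambda>d. if d \<in> B \<and> f x \<in> fst d
       then frechet_derivative (snd d \<circ> f \<circ> chart_inv c) (at (snd c x)) (v c) else 0))"

definition function_differential ::
  "('a::topological_space, 'e::euclidean_space) chart set \<Rightarrow> ('a \<Rightarrow> real) \<Rightarrow> 'a \<Rightarrow>
   ('a, 'e) tvec \<Rightarrow> real" where
  "function_differential A f x v = (let c = chart_at A x in
     frechet_derivative (f \<circ> chart_inv c) (at (snd c x)) (v c))"


section \<open>Hyper-Kaehler manifolds\<close>

type_synonym ('a, 'e) tensor2 = "'a \<Rightarrow> ('a, 'e) tvec \<Rightarrow> ('a, 'e) tvec \<Rightarrow> real"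
type_synonym ('a, 'e) endo = "'a \<Rightarrow> ('a, 'e) tvec \<Rightarrow> ('a, 'e) tvec"

definition tensor2_in_chart ::
  "('a::topological_space, 'e::euclidean_space) chart set \<Rightarrow> ('a, 'e) tensor2 \<Rightarrow>
   ('a, 'e) chart \<Rightarrow> 'e \<Rightarrow> 'e \<Rightarrow> 'e \<Rightarrow> real" where
  "tensor2_in_chart A h c u w =
     (\<lambda>y. h (chart_inv c y) (coord_vec A c (chart_inv c y) u) (coord_vec A c (chart_inv c y) w))"

definition riemannian_metric ::
  "('a::topological_space, 'e::euclidean_space) chart set \<Rightarrow> ('a, 'e) tensor2 \<Rightarrow> bool" where
  "riemannian_metric A g \<longleftrightarrow>
     (\<forall>x. inner_product_on (tangent_space A x) (g x)) \<and>
     (\<forall>c\<in>A. \<forall>u w. smooth_on (chart_image c) (tensor2_in_chart A g c u w))"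

definition almost_complex_structure ::
  "('a::topological_space, 'e::euclidean_space) chart set \<Rightarrow> ('a, 'e) endo \<Rightarrow> bool" where
  "almost_complex_structure A I \<longleftrightarrow>
     (\<forall>x. linear_map_on (tangent_space A x) (I x) \<and>
        (\<forall>v\<in>tangent_space A x. I x v \<in> tangent_space A x \<and> I x (I x v) = - v)) \<and>
     (\<forall>c\<in>A. \<forall>u. smooth_on (chart_image c)
        (\<lambda>y. I (chart_inv c y) (coord_vec A c (chart_inv c y) u) c))"

text \<open>
  Integrability is the existence of holomorphic charts: around each point there is a chart of the
  (maximal) atlas in which \<open>I\<close> is a constant linear complex structure \<open>K\<close> on the model
  space. Identifying the latter with complex coordinate space linearly turns \<open>K\<close> into
  multiplication by the imaginary unit.
\<close>

definition complex_structure ::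
  "('a::{t2_space, second_countable_topology}, 'e::euclidean_space) chart set \<Rightarrow>
   ('a, 'e) endo \<Rightarrow> bool" where
  "complex_structure A I \<longleftrightarrow> almost_complex_structure A I \<and>
     (\<forall>x. \<exists>c\<in>A. x \<in> fst c \<and>
        (\<exists>K. linear K \<and> (\<forall>y\<in>fst c. \<forall>v\<in>tangent_space A y. I y v c = K (v c))))"

definition kaehler_form ::
  "('a, 'e) tensor2 \<Rightarrow> ('a, 'e) endo \<Rightarrow> ('a, 'e) tensor2" where
  "kaehler_form g I = (\<lambda>x v w. g x (I x v) w)"

text \<open>The exterior derivative, evaluated on constant coordinate vector fields.\<close>

definition closed_2form ::
  "('a::topological_space, 'e::euclidean_space) chart set \<Rightarrow> ('a, 'e) tensor2 \<Rightarrow> bool" where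
  "closed_2form A \<omega> \<longleftrightarrow> (\<forall>c\<in>A. \<forall>y\<in>chart_image c. \<forall>u v w.
     frechet_derivative (tensor2_in_chart A \<omega> c v w) (at y) u +
     frechet_derivative (tensor2_in_chart A \<omega> c w u) (at y) v +
     frechet_derivative (tensor2_in_chart A \<omega> c u v) (at y) w = 0)"

definition kaehler_structure ::
  "('a::{t2_space, second_countable_topology}, 'e::euclidean_space) chart set \<Rightarrow>
   ('a, 'e) tensor2 \<Rightarrow> ('a, 'e) endo \<Rightarrow> bool" where
  "kaehler_structure A g I \<longleftrightarrow>
     riemannian_metric A g \<and> complex_structure A I \<and>
     (\<forall>x. \<forall>v\<in>tangent_space A x. \<forall>w\<in>tangent_space A x. g x (I x v) (I x w) = g x v w) \<and>
     closed_2form A (kaehler_form g I)"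

text \<open>The index type \<open>3\<close> has the elements \<open>1\<close>, \<open>2\<close>, \<open>3\<close>; it also
  indexes the coordinates of \<open>real^3\<close>, which stands for the imaginary quaternions.\<close>

definition hyperkaehler_structure ::
  "('a::{t2_space, second_countable_topology}, 'e::euclidean_space) chart set \<Rightarrow>
   ('a, 'e) tensor2 \<Rightarrow> (3 \<Rightarrow> ('a, 'e) endo) \<Rightarrow> bool" where
  "hyperkaehler_structure A g J \<longleftrightarrow>
     smooth_structure A \<and> (\<forall>j. kaehler_structure A g (J j)) \<and>
     (\<forall>x. \<forall>v\<in>tangent_space A x.
        J 1 x (J 2 x v) = J 3 x v \<and> J 2 x (J 1 x v) = - J 3 x v)"

definition J_q :: "(3 \<Rightarrow> ('a, 'e::real_vector) endo) \<Rightarrow> real^3 \<Rightarrow> ('a, 'e) endo" where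
  "J_q J q = (\<lambda>x v. \<Sum>j\<in>UNIV. (q $ j) *\<^sub>R J j x v)"

definition riemannian_isometry ::
  "('a::topological_space, 'e::euclidean_space) chart set \<Rightarrow> ('a, 'e) tensor2 \<Rightarrow>
   ('a \<Rightarrow> 'a) \<Rightarrow> bool" where
  "riemannian_isometry A g f \<longleftrightarrow>
     bij f \<and> smooth_map A A f \<and> smooth_map A A (inv_into UNIV f) \<and>
     (\<forall>x. \<forall>v\<in>tangent_space A x. \<forall>w\<in>tangent_space A x.
        g (f x) (tangent_map A A f x v) (tangent_map A A f x w) = g x v w)"

definition holomorphic_map ::
  "('a::topological_space, 'e::euclidean_space) chart set \<Rightarrow> ('a, 'e) endo \<Rightarrow>
   ('a \<Rightarrow> 'a) \<Rightarrow> bool" where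
  "holomorphic_map A I f \<longleftrightarrow> smooth_map A A f \<and>
     (\<forall>x. \<forall>v\<in>tangent_space A x.
        tangent_map A A f x (I x v) = I (f x) (tangent_map A A f x v))"


section \<open>Betti numbers\<close>

definition int_independent :: "('c, 'd) monoid_scheme \<Rightarrow> 'c set \<Rightarrow> bool" where
  "int_independent G S \<longleftrightarrow>
     (\<forall>n :: 'c \<Rightarrow> int. finprod G (\<lambda>s. s [^]\<^bsub>G\<^esub> n s) S = \<one>\<^bsub>G\<^esub> \<longrightarrow> (\<forall>s\<in>S. n s = 0))"

text \<open>The rank of the integral singular homology group in degree \<open>p\<close>, possibly infinite.\<close>

definition betti_number :: "int \<Rightarrow> 'a topology \<Rightarrow> enat" where
  "betti_number p X = (SUP S\<in>{S. finite S \<and> S \<subseteq> carrier (homology_group p X) \<and>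
     int_independent (homology_group p X) S}. enat (card S))"


section \<open>Actions of abelian Lie groups\<close>

text \<open>The group law of an abelian Lie group is written additively.\<close>

definition abelian_lie_group ::
  "('g::{ab_group_add, t2_space, second_countable_topology}, 't::euclidean_space) chart set \<Rightarrow> bool"
  where
  "abelian_lie_group B \<longleftrightarrow> smooth_structure B \<and>
     smooth_map (product_atlas B B) B (\<lambda>(s, t). s + t) \<and> smooth_map B B uminus"

definition lie_algebra ::
  "('g::{ab_group_add, t2_space, second_countable_topology}, 't::euclidean_space) chart set \<Rightarrow>
   ('g, 't) tvec set" where
  "lie_algebra B = tangent_space B 0"

definition smooth_action ::
  "('g::{ab_group_add, t2_space, second_countable_topology}, 't::euclidean_space) chart set \<Rightarrow>
   ('a::topological_space, 'e::euclidean_space) chart set \<Rightarrow> ('g \<Rightarrow> 'a \<Rightarrow> 'a) \<Rightarrow> bool" where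
  "smooth_action B A \<rho> \<longleftrightarrow>
     (\<forall>x. \<rho> 0 x = x) \<and> (\<forall>s t x. \<rho> (s + t) x = \<rho> s (\<rho> t x)) \<and>
     smooth_map (product_atlas B A) A (\<lambda>(s, x). \<rho> s x)"

definition fixed_point :: "('g \<Rightarrow> 'a \<Rightarrow> 'a) \<Rightarrow> 'a \<Rightarrow> bool" where
  "fixed_point \<rho> x \<longleftrightarrow> (\<forall>s. \<rho> s x = x)"

definition nontrivial_action :: "('g \<Rightarrow> 'a \<Rightarrow> 'a) \<Rightarrow> bool" where
  "nontrivial_action \<rho> \<longleftrightarrow> (\<exists>x. \<not> fixed_point \<rho> x)"

text \<open>The value at \<open>x\<close> of the fundamental vector field of \<open>v\<close> is the image of
  \<open>v\<close> under the derivative of the orbit map of \<open>x\<close> at the neutral element, i.e. the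
  velocity of \<open>exp (t v) x\<close> at \<open>t = 0\<close>.\<close>

definition fundamental_field ::
  "('g::{ab_group_add, t2_space, second_countable_topology}, 't::euclidean_space) chart set \<Rightarrow>
   ('a::topological_space, 'e::euclidean_space) chart set \<Rightarrow> ('g \<Rightarrow> 'a \<Rightarrow> 'a) \<Rightarrow>
   ('g, 't) tvec \<Rightarrow> 'a \<Rightarrow> ('a, 'e) tvec" where
  "fundamental_field B A \<rho> v x = tangent_map B A (\<lambda>s. \<rho> s x) 0 v"


section \<open>Hyper-Kaehler moment maps and horizontal weak conformality\<close>

text \<open>
  For a finite-dimensional space \<open>V\<close>, the dual of the tensor product of \<open>V\<close> and
  \<open>real^3\<close>, whose elements are the bilinear forms on \<open>V\<close> and \<open>real^3\<close> by the universal
  property: \<open>\<beta> v q\<close> is the value at the elementary tensor of \<open>v\<close> and \<open>q\<close>. The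
  normalisation outside \<open>V\<close> makes the representing function unique.
\<close>

definition tensor_dual :: "'v::real_vector set \<Rightarrow> ('v \<Rightarrow> real^3 \<Rightarrow> real) set" where
  "tensor_dual V = {\<beta>. (\<forall>q. linear_map_on V (\<lambda>v. \<beta> v q)) \<and> (\<forall>v\<in>V. linear (\<beta> v)) \<and>
     (\<forall>v. v \<notin> V \<longrightarrow> \<beta> v = 0)}"

text \<open>The inner product on \<open>tensor_dual V\<close> induced by \<open>k\<close> on \<open>V\<close> and the standard
  one on \<open>real^3\<close>; it makes the dual basis of a tensor product of orthonormal bases
  orthonormal, and does not depend on the basis \<open>E\<close>.\<close>

definition tensor_dual_inner ::
  "'v::real_vector set \<Rightarrow> ('v \<Rightarrow> 'v \<Rightarrow> real) \<Rightarrow>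
   ('v \<Rightarrow> real^3 \<Rightarrow> real) \<Rightarrow> ('v \<Rightarrow> real^3 \<Rightarrow> real) \<Rightarrow> real" where
  "tensor_dual_inner V k \<beta> \<gamma> = (let E = (SOME E. orthonormal_basis V k E) in
     \<Sum>e\<in>E. \<Sum>j\<in>UNIV. \<beta> e (axis j 1) * \<gamma> e (axis j 1))"

definition hyperkaehler_moment_map ::
  "('g::{ab_group_add, t2_space, second_countable_topology}, 't::euclidean_space) chart set \<Rightarrow>
   ('a::topological_space, 'e::euclidean_space) chart set \<Rightarrow>
   ('a, 'e) tensor2 \<Rightarrow> (3 \<Rightarrow> ('a, 'e) endo) \<Rightarrow> ('g \<Rightarrow> 'a \<Rightarrow> 'a) \<Rightarrow>
   ('a \<Rightarrow> ('g, 't) tvec \<Rightarrow> real^3 \<Rightarrow> real) \<Rightarrow> bool" where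
  "hyperkaehler_moment_map B A g J \<rho> \<phi> \<longleftrightarrow>
     (\<forall>x. \<phi> x \<in> tensor_dual (lie_algebra B)) \<and>
     (\<forall>v\<in>lie_algebra B. \<forall>q. norm q = 1 \<longrightarrow>
        smooth_function A (\<lambda>x. \<phi> x v q) \<and>
        (\<forall>x. \<forall>w\<in>tangent_space A x.
           function_differential A (\<lambda>x. \<phi> x v q) x w =
           kaehler_form g (J_q J q) x (fundamental_field B A \<rho> v x) w))"

definition horizontal_space ::
  "'v::real_vector set \<Rightarrow> ('v \<Rightarrow> 'v \<Rightarrow> real) \<Rightarrow> ('v \<Rightarrow> 'w::real_vector) \<Rightarrow> 'v set" where
  "horizontal_space V g L = {u\<in>V. \<forall>w\<in>V. L w = 0 \<longrightarrow> g u w = 0}"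

definition conformal_linear_isomorphism ::
  "'v::real_vector set \<Rightarrow> ('v \<Rightarrow> 'v \<Rightarrow> real) \<Rightarrow> 'w::real_vector set \<Rightarrow> ('w \<Rightarrow> 'w \<Rightarrow> real) \<Rightarrow>
   ('v \<Rightarrow> 'w) \<Rightarrow> bool" where
  "conformal_linear_isomorphism V g W h L \<longleftrightarrow>
     linear_map_on V L \<and> bij_betw L V W \<and>
     (\<exists>c>0. \<forall>u\<in>V. \<forall>v\<in>V. h (L u) (L v) = c * g u v)"

text \<open>The differential of a map into \<open>tensor_dual V\<close>, whose tangent spaces are identified
  with the vector space itself.\<close>

definition tensor_dual_differential ::
  "('a::topological_space, 'e::euclidean_space) chart set \<Rightarrow> ('a \<Rightarrow> 'v \<Rightarrow> real^3 \<Rightarrow> real) \<Rightarrow>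
   'a \<Rightarrow> ('a, 'e) tvec \<Rightarrow> 'v \<Rightarrow> real^3 \<Rightarrow> real" where
  "tensor_dual_differential A \<phi> x w = (\<lambda>v q. function_differential A (\<lambda>y. \<phi> y v q) x w)"

definition horizontally_weakly_conformal ::
  "('a::topological_space, 'e::euclidean_space) chart set \<Rightarrow> ('a, 'e) tensor2 \<Rightarrow>
   'v::real_vector set \<Rightarrow> (('v \<Rightarrow> real^3 \<Rightarrow> real) \<Rightarrow> ('v \<Rightarrow> real^3 \<Rightarrow> real) \<Rightarrow> real) \<Rightarrow>
   ('a \<Rightarrow> 'v \<Rightarrow> real^3 \<Rightarrow> real) \<Rightarrow> bool" where
  "horizontally_weakly_conformal A g V h \<phi> \<longleftrightarrow>
     (\<forall>x. let T = tangent_space A x; L = tensor_dual_differential A \<phi> x in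
        (\<forall>w\<in>T. L w = 0) \<or>
        conformal_linear_isomorphism (horizontal_space T (g x) L) (g x) (tensor_dual V) h L)"

end

theory Submission
  imports Defs "HOL-Library.Landau_Symbols"
begin

text \<open>
  The gradients of the components of \<open>\<phi>\<close> along \<open>v\<close> are \<open>J\<^sub>j V\<close>, where \<open>V\<close> is the fundamental
  field of \<open>v\<close>. They are pairwise orthogonal and of the same length as \<open>V\<close>, which settles the case
  of a one-dimensional group.

  Conversely, horizontal weak conformality forces \<open>g(V, W) = r k(v, w)\<close> with a function \<open>r\<close> on the
  manifold. Expanding to second order at a fixed point, the linearisations \<open>S\<close>, \<open>T\<close> of the fields of
  two \<open>k\<close>-orthonormal vectors satisfy \<open>g(S X, T X) = 0\<close> and \<open>g(S X, S X) = g(T X, T X)\<close> for all \<open>X\<close>;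
  since they are skew and commute, \<open>T S = 0\<close>, so \<open>S S = 0\<close> and \<open>S = 0\<close>. So if the dimension is at
  least two, the isotropy representation is locally constant, hence trivial, and an isometry of a
  connected manifold which fixes a point and has trivial differential there is the identity.
\<close>

section \<open>Calculus of smooth maps on open sets\<close>

text \<open>The fundamental fields vanish at the fixed point, so \<open>g(V, W)\<close> has no terms
  of order zero or one there; its quadratic part along a line is the first place where the
  linearisations appear. Their skewness is the derivative of the invariance of the metric at the
  fixed point, their commutation the derivative of the commutation in the group. Polarising
  \<open>g(S X, T X) = 0\<close> and using both facts shows that \<open>T S\<close> pairs to zero
  with every vector. The analytic weight lies in the rigidity of isometries. No geodesics are used:
  the isometry equation is differentiated once and solved for the second derivatives, as for the
  Christoffel symbols. This bounds them by the distance of the 1-jet of the isometry from that of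
  the identity, and the mean value inequality makes this distance vanish near the fixed point. In
  the one-dimensional case every inner product on the Lie algebra will do, since all of them are
  proportional. Tangent vectors are families indexed by charts, so inner products live on subspaces
  of a function space; calculations are moved to the model space by one chart.\<close>

lemma has_frechet_derivative:
  "f differentiable at x \<Longrightarrow> (f has_derivative frechet_derivative f (at x)) (at x)"
  by (simp add: frechet_derivative_works)

lemma frechet_derivative_eqI:
  "(f has_derivative f') (at x) \<Longrightarrow> frechet_derivative f (at x) = f'"
  by (metis frechet_derivative_at)

lemma linear_frechet_derivative_at:
  "f differentiable at x \<Longrightarrow> linear (frechet_derivative f (at x))"
  using has_frechet_derivative has_derivative_linear by blast

lemma continuous_on_tendsto_nhds:
  fixes f :: "'a::t2_space \<Rightarrow> 'b::topological_space"
  assumes "open S" "continuous_on S f" "x \<in> S"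
  shows "(f \<longlongrightarrow> f x) (nhds x)"
  using assms continuous_on_eq_continuous_at[of S f] tendsto_at_iff_tendsto_nhds[of f x]
  by (simp add: isCont_def)

lemma smooth_on_imp_continuous_on: "smooth_on S f \<Longrightarrow> continuous_on S f"
  unfolding smooth_on_def by (metis times_continuously_differentiable_on.simps(1))

lemma smooth_on_imp_differentiable: "smooth_on S f \<Longrightarrow> x \<in> S \<Longrightarrow> f differentiable at x"
  unfolding smooth_on_def by (metis times_continuously_differentiable_on.simps(2))

lemma smooth_on_has_derivative:
  "smooth_on S f \<Longrightarrow> x \<in> S \<Longrightarrow> (f has_derivative frechet_derivative f (at x)) (at x)"
  using smooth_on_imp_differentiable has_frechet_derivative by blast

lemma smooth_on_frechet_derivative:
  "smooth_on S f \<Longrightarrow> smooth_on S (\<lambda>x. frechet_derivative f (at x) v)"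
  unfolding smooth_on_def by (metis times_continuously_differentiable_on.simps(2))

lemma smooth_on_subset:
  assumes "smooth_on S f" "T \<subseteq> S"
  shows "smooth_on T f"
proof -
  have "times_continuously_differentiable_on n S f \<Longrightarrow> times_continuously_differentiable_on n T f"
    for n
    using assms(2) by (induction n arbitrary: f) (auto intro: continuous_on_subset)
  then show ?thesis
    using assms(1) by (auto simp: smooth_on_def)
qed

text \<open>Since \<open>S\<close> is open, a derivative at a point of \<open>S\<close> depends only
  on values in \<open>S\<close>; so the derivatives agree on \<open>S\<close> too and the induction
  can go on with them.\<close>

lemma times_continuously_differentiable_on_cong:
  assumes "open S" "\<And>x. x \<in> S \<Longrightarrow> f x = g x" "times_continuously_differentiable_on n S f"
  shows "times_continuously_differentiable_on n S g"
  using assms(2,3)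
proof (induction n arbitrary: f g)
  case 0
  then show ?case
    by (simp cong: continuous_on_cong)
next
  case (Suc n)
  have *: "(g has_derivative frechet_derivative f (at x)) (at x)" if "x \<in> S" for x
    using has_derivative_transform_within_open[OF has_frechet_derivative assms(1) that] Suc.prems
      that by auto
  then have "frechet_derivative g (at x) = frechet_derivative f (at x)" if "x \<in> S" for x
    using frechet_derivative_eqI that by blast
  then have "times_continuously_differentiable_on n S (\<lambda>x. frechet_derivative g (at x) v)" for v
    using Suc.IH[of "\<lambda>x. frechet_derivative f (at x) v" "\<lambda>x. frechet_derivative g (at x) v"]
      Suc.prems by simp
  then show ?case
    using * by (auto simp: differentiable_def)
qed

lemma smooth_on_cong:
  assumes "open S" "\<And>x. x \<in> S \<Longrightarrow> f x = g x" "smooth_on S f"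
  shows "smooth_on S g"
  using assms times_continuously_differentiable_on_cong unfolding smooth_on_def by blast

lemma smooth_on_inner_left:
  assumes "open S" "smooth_on S f"
  shows "smooth_on S (\<lambda>x. f x \<bullet> b)"
proof -
  have "times_continuously_differentiable_on n S (\<lambda>x. f x \<bullet> b)" for n
    using assms(2)
  proof (induction n arbitrary: f)
    case 0
    then show ?case
      using smooth_on_imp_continuous_on[of S f] by (simp add: continuous_on_inner)
  next
    case (Suc n)
    have *: "((\<lambda>x. f x \<bullet> b) has_derivative (\<lambda>h. frechet_derivative f (at x) h \<bullet> b)) (at x)"
      if "x \<in> S" for x
      by (rule has_derivative_inner_left smooth_on_has_derivative Suc.prems that)+
    have "times_continuously_differentiable_on n S (\<lambda>x. frechet_derivative (\<lambda>x. f x \<bullet> b) (at x) v)" for v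
      by (rule times_continuously_differentiable_on_cong[OF assms(1) _
            Suc.IH[OF smooth_on_frechet_derivative[OF Suc.prems, of v]]])
        (simp add: frechet_derivative_eqI[OF *])
    then show ?case
      using * by (auto simp: differentiable_def)
  qed
  then show ?thesis
    by (simp add: smooth_on_def)
qed

section \<open>Symmetry of second derivatives\<close>

lemma has_real_derivative_along_line:
  assumes "f differentiable at (p + s *\<^sub>R u)"
  shows "((\<lambda>s. f (p + s *\<^sub>R u)) has_real_derivative frechet_derivative f (at (p + s *\<^sub>R u)) u) (at s)"
proof -
  let ?D = "frechet_derivative f (at (p + s *\<^sub>R u))"
  have "((\<lambda>s. p + s *\<^sub>R u) has_derivative (\<lambda>h. h *\<^sub>R u)) (at s)"
    by (auto intro!: derivative_eq_intros)
  then have "((\<lambda>s. f (p + s *\<^sub>R u)) has_derivative (\<lambda>h. ?D (h *\<^sub>R u))) (at s)"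
    using diff_chain_at[of _ _ s f ?D] has_frechet_derivative[OF assms] by (auto simp: o_def)
  moreover have "?D (h *\<^sub>R u) = ?D u * h" for h
    using linear_frechet_derivative_at[OF assms] by (simp add: linear_cmul)
  ultimately show ?thesis
    by (simp add: has_field_derivative_def)
qed

text \<open>The mean value theorem is applied twice, in direction \<open>u\<close> to a difference
  in direction \<open>v\<close>, and then in direction \<open>v\<close> to the derivative along
  \<open>u\<close>. The left-hand side is symmetric in \<open>u\<close> and \<open>v\<close>, the
  right-hand side is not visibly so; this is the source of the symmetry below.\<close>

lemma second_difference_mean_value:
  fixes f :: "'e::euclidean_space \<Rightarrow> real"
  assumes "smooth_on S f" "0 < h"
    and S: "\<And>s t. 0 \<le> s \<Longrightarrow> s \<le> h \<Longrightarrow> 0 \<le> t \<Longrightarrow> t \<le> h \<Longrightarrow> x + s *\<^sub>R u + t *\<^sub>R v \<in> S"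
  obtains s t where "0 \<le> s" "s \<le> h" "0 \<le> t" "t \<le> h"
    "f (x + h *\<^sub>R u + h *\<^sub>R v) - f (x + h *\<^sub>R u) - f (x + h *\<^sub>R v) + f x =
     h * h * frechet_derivative (\<lambda>y. frechet_derivative f (at y) u) (at (x + s *\<^sub>R u + t *\<^sub>R v)) v"
proof -
  let ?Du = "\<lambda>y. frechet_derivative f (at y) u"
  define k where "k s = f ((x + h *\<^sub>R v) + s *\<^sub>R u) - f (x + s *\<^sub>R u)" for s
  have diff: "f differentiable at (x + s *\<^sub>R u + t *\<^sub>R v)" "?Du differentiable at (x + s *\<^sub>R u + t *\<^sub>R v)"
    if "0 \<le> s" "s \<le> h" "0 \<le> t" "t \<le> h" for s t
    using smooth_on_imp_differentiable smooth_on_frechet_derivative assms(1) S that by blast+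
  have "(k has_real_derivative ?Du ((x + h *\<^sub>R v) + s *\<^sub>R u) - ?Du (x + s *\<^sub>R u)) (at s)"
    if "0 \<le> s" "s \<le> h" for s
  proof -
    have "f differentiable at ((x + h *\<^sub>R v) + s *\<^sub>R u)" "f differentiable at (x + s *\<^sub>R u)"
      using diff(1)[of s h] diff(1)[of s 0] that assms(2) by (simp_all add: add_ac)
    then show ?thesis
      using has_real_derivative_along_line[of f "x + h *\<^sub>R v" s u]
        has_real_derivative_along_line[of f x s u] unfolding k_def by (intro DERIV_diff) simp_all
  qed
  from MVT2[OF \<open>0 < h\<close> this] obtain s where s: "0 < s" "s < h"
    "k h - k 0 = (h - 0) * (?Du ((x + h *\<^sub>R v) + s *\<^sub>R u) - ?Du (x + s *\<^sub>R u))"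
    by metis
  define l where "l t = ?Du ((x + s *\<^sub>R u) + t *\<^sub>R v)" for t
  define l' where "l' t = frechet_derivative ?Du (at ((x + s *\<^sub>R u) + t *\<^sub>R v)) v" for t
  have "(l has_real_derivative l' t) (at t)" if "0 \<le> t" "t \<le> h" for t
    using has_real_derivative_along_line[of ?Du "x + s *\<^sub>R u" t v] diff(2)[of s t] s that
    unfolding l_def l'_def by simp
  from MVT2[OF \<open>0 < h\<close> this] obtain t where t: "0 < t" "t < h" "l h - l 0 = (h - 0) * l' t"
    by metis
  have swap: "x + h *\<^sub>R v + r *\<^sub>R u = x + r *\<^sub>R u + h *\<^sub>R v" for r
    by (simp add: add.assoc add.commute[of "h *\<^sub>R v"])
  have "f (x + h *\<^sub>R u + h *\<^sub>R v) - f (x + h *\<^sub>R u) - f (x + h *\<^sub>R v) + f x = k h - k 0"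
    by (simp add: k_def swap)
  also have "\<dots> = h * (l h - l 0)"
    unfolding s(3) l_def swap by simp
  also have "\<dots> = h * h * l' t"
    unfolding t(3) by simp
  finally show ?thesis
    using that[of s t] s(1,2) t(1,2) unfolding l'_def by (meson less_imp_le)
qed

text \<open>One and the same second difference is \<open>h * h\<close> times a value of
  \<open>a\<close> near \<open>x\<close> and \<open>h * h\<close> times a value of \<open>b\<close>
  near \<open>x\<close>. By continuity of both mixed derivatives, different values at
  \<open>x\<close> would be incompatible with that for small \<open>h\<close>.\<close>

lemma second_derivative_symmetric_real:
  fixes f :: "'e::euclidean_space \<Rightarrow> real"
  assumes "open S" "smooth_on S f" "x \<in> S"
  shows "frechet_derivative (\<lambda>y. frechet_derivative f (at y) u) (at x) v =
         frechet_derivative (\<lambda>y. frechet_derivative f (at y) v) (at x) u"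
proof (rule ccontr)
  define a where "a y = frechet_derivative (\<lambda>y. frechet_derivative f (at y) u) (at y) v" for y
  define b where "b y = frechet_derivative (\<lambda>y. frechet_derivative f (at y) v) (at y) u" for y
  assume "\<not> ?thesis"
  then have "a x \<noteq> b x"
    by (simp add: a_def b_def)
  \<comment> \<open>Half the distance, so that a number within \<open>e\<close> of
    \<open>a x\<close> cannot also be within \<open>e\<close> of \<open>b x\<close>.\<close>
  define e where "e = dist (a x) (b x) / 2"
  have "e > 0"
    using \<open>a x \<noteq> b x\<close> by (simp add: e_def)
  have "continuous_on S a" "continuous_on S b"
    unfolding a_def b_def
    using assms(2) smooth_on_frechet_derivative smooth_on_imp_continuous_on by blast+
  then have "eventually (\<lambda>y. dist (a y) (a x) < e) (nhds x)" "eventually (\<lambda>y. dist (b y) (b x) < e) (nhds x)"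
    using \<open>e > 0\<close> assms by (auto intro!: tendstoD continuous_on_tendsto_nhds)
  moreover have "eventually (\<lambda>y. y \<in> S) (nhds x)"
    using assms eventually_nhds by blast
  ultimately have "eventually (\<lambda>y. dist (a y) (a x) < e \<and> dist (b y) (b x) < e \<and> y \<in> S) (nhds x)"
    by eventually_elim auto
  then obtain d where d: "d > 0" "\<And>y. dist y x < d \<Longrightarrow> dist (a y) (a x) < e \<and> dist (b y) (b x) < e \<and> y \<in> S"
    unfolding eventually_nhds_metric by blast
  define n where "n = norm u + norm v + 1"
  have "n > 0"
    by (simp add: n_def add_nonneg_pos)
  \<comment> \<open>Keeps the whole parallelogram with sides \<open>h u\<close> and
    \<open>h v\<close> inside the ball of radius \<open>d\<close>; the summand 1 in \<open>n\<close>
    covers the case that \<open>u\<close> and \<open>v\<close> are both zero.\<close>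
  define h where "h = d / (2 * n)"
  have h: "h > 0"
    using d(1) \<open>n > 0\<close> by (simp add: h_def)
  have "h * (norm u + norm v) \<le> h * n"
    using h by (simp add: n_def)
  also have "\<dots> = d / 2"
    using \<open>n > 0\<close> by (simp add: h_def)
  finally have hd: "h * (norm u + norm v) < d"
    using d(1) by simp
  have near: "dist (x + s *\<^sub>R u + t *\<^sub>R v) x < d"
    if "0 \<le> s" "s \<le> h" "0 \<le> t" "t \<le> h" for s t
  proof -
    have "norm (s *\<^sub>R u + t *\<^sub>R v) \<le> s * norm u + t * norm v"
      using norm_triangle_ineq[of "s *\<^sub>R u" "t *\<^sub>R v"] that by simp
    also have "\<dots> \<le> h * norm u + h * norm v"
      using that by (intro add_mono mult_right_mono) auto
    finally show ?thesis
      using hd by (simp add: dist_norm algebra_simps)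
  qed
  obtain s t where 1: "0 \<le> s" "s \<le> h" "0 \<le> t" "t \<le> h"
    "f (x + h *\<^sub>R u + h *\<^sub>R v) - f (x + h *\<^sub>R u) - f (x + h *\<^sub>R v) + f x = h * h * a (x + s *\<^sub>R u + t *\<^sub>R v)"
    using second_difference_mean_value[OF assms(2) h, of x u v] near d(2)
    unfolding a_def by blast
  have near': "dist (x + s *\<^sub>R v + t *\<^sub>R u) x < d"
    if "0 \<le> s" "s \<le> h" "0 \<le> t" "t \<le> h" for s t
    using near[of t s] that by (simp add: algebra_simps)
  obtain s' t' where 2: "0 \<le> s'" "s' \<le> h" "0 \<le> t'" "t' \<le> h"
    "f (x + h *\<^sub>R v + h *\<^sub>R u) - f (x + h *\<^sub>R v) - f (x + h *\<^sub>R u) + f x = h * h * b (x + s' *\<^sub>R v + t' *\<^sub>R u)"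
    using second_difference_mean_value[OF assms(2) h, of x v u] near' d(2)
    unfolding b_def by blast
  have "h * h * a (x + s *\<^sub>R u + t *\<^sub>R v) = h * h * b (x + s' *\<^sub>R v + t' *\<^sub>R u)"
    using 1(5) 2(5) by (simp add: algebra_simps)
  then have "a (x + s *\<^sub>R u + t *\<^sub>R v) = b (x + s' *\<^sub>R v + t' *\<^sub>R u)"
    using h by simp
  moreover have "dist (a (x + s *\<^sub>R u + t *\<^sub>R v)) (a x) < e" "dist (b (x + s' *\<^sub>R v + t' *\<^sub>R u)) (b x) < e"
    using near near' d(2) 1 2 by blast+
  ultimately have "dist (a x) (b x) < 2 * e"
    using dist_triangle3[of "a x" "b x" "a (x + s *\<^sub>R u + t *\<^sub>R v)"] by simp
  then show False
    by (simp add: e_def)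
qed

lemma second_derivative_symmetric:
  assumes "open S" "smooth_on S f" "x \<in> S"
  shows "frechet_derivative (\<lambda>y. frechet_derivative f (at y) u) (at x) v =
         frechet_derivative (\<lambda>y. frechet_derivative f (at y) v) (at x) u"
proof (rule euclidean_eqI)
  fix b :: 'b
  assume "b \<in> Basis"
  have inner: "frechet_derivative (\<lambda>x. k x \<bullet> b) (at y) w = frechet_derivative k (at y) w \<bullet> b"
    if "smooth_on S k" "y \<in> S" for k :: "'a \<Rightarrow> 'b" and w y
    using frechet_derivative_eqI[OF has_derivative_inner_left[OF smooth_on_has_derivative[OF that]]]
    by simp
  have twice: "frechet_derivative (\<lambda>y. frechet_derivative (\<lambda>x. f x \<bullet> b) (at y) u) (at x) v =
        frechet_derivative (\<lambda>y. frechet_derivative f (at y) u) (at x) v \<bullet> b" for u v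
  proof -
    have "((\<lambda>y. frechet_derivative (\<lambda>x. f x \<bullet> b) (at y) u) has_derivative
        (\<lambda>v. frechet_derivative (\<lambda>y. frechet_derivative f (at y) u) (at x) v \<bullet> b)) (at x)"
      by (rule has_derivative_transform_within_open[OF has_derivative_inner_left
            [OF smooth_on_has_derivative[OF smooth_on_frechet_derivative[OF assms(2)] assms(3)]]
            assms(1,3)]) (simp add: inner assms)
    then show ?thesis
      by (simp add: frechet_derivative_eqI)
  qed
  show "frechet_derivative (\<lambda>y. frechet_derivative f (at y) u) (at x) v \<bullet> b =
        frechet_derivative (\<lambda>y. frechet_derivative f (at y) v) (at x) u \<bullet> b"
    unfolding twice[symmetric]
    by (rule second_derivative_symmetric_real[OF assms(1) smooth_on_inner_left[OF assms(1,2)] assms(3)])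
qed

section \<open>Estimates from the values on the standard basis\<close>

lemma norm_linear_le_sum_Basis:
  fixes f :: "'e::euclidean_space \<Rightarrow> 'f::real_normed_vector"
  assumes "linear f"
  shows "norm (f x) \<le> (\<Sum>i\<in>Basis. norm (f i)) * norm x"
proof -
  have "f x = f (\<Sum>i\<in>Basis. (x \<bullet> i) *\<^sub>R i)"
    by (simp add: euclidean_representation)
  also have "\<dots> = (\<Sum>i\<in>Basis. (x \<bullet> i) *\<^sub>R f i)"
    by (simp add: linear_sum[OF assms] linear_cmul[OF assms])
  also have "norm \<dots> \<le> (\<Sum>i\<in>Basis. norm (f i) * norm x)"
    by (rule sum_norm_le) (simp add: Basis_le_norm mult.commute[of _ "norm (f _)"] mult_left_mono)
  finally show ?thesis
    by (simp add: sum_distrib_right)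
qed

text \<open>Smoothness speaks of derivatives in one fixed direction at a time. The sum over the
  basis is therefore visibly continuous in the base point, and it bounds the operator norm that the
  mean value inequality asks for.\<close>

lemma onorm_linear_le_sum_Basis:
  fixes f :: "'e::euclidean_space \<Rightarrow> 'f::real_normed_vector"
  assumes "linear f"
  shows "onorm f \<le> (\<Sum>i\<in>Basis. norm (f i))"
  by (rule onorm_le) (rule norm_linear_le_sum_Basis[OF assms])

text \<open>By continuity the derivative is bounded on a small ball, and a ball is convex. The lemma
  serves to compare the derivatives of the metric at \<open>y\<close> and at \<open>f y\<close> in
  the rigidity argument.\<close>

lemma smooth_on_locally_Lipschitz:
  fixes f :: "'e::euclidean_space \<Rightarrow> 'f::euclidean_space"
  assumes "open S" "smooth_on S f" "x \<in> S"
  obtains r C where "r > 0" "\<And>y z. y \<in> ball x r \<Longrightarrow> z \<in> ball x r \<Longrightarrow> norm (f y - f z) \<le> C * norm (y - z)"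
proof -
  let ?N = "\<lambda>y. \<Sum>i\<in>Basis. norm (frechet_derivative f (at y) i)"
  have "continuous_on S ?N"
    using assms(2)
    by (intro continuous_intros smooth_on_imp_continuous_on smooth_on_frechet_derivative)
  then have "eventually (\<lambda>y. ?N y < ?N x + 1) (nhds x)"
    by (rule order_tendstoD[OF continuous_on_tendsto_nhds[OF assms(1) _ assms(3)]]) simp
  moreover have "eventually (\<lambda>y. y \<in> S) (nhds x)"
    using assms eventually_nhds by blast
  ultimately have "eventually (\<lambda>y. ?N y < ?N x + 1 \<and> y \<in> S) (nhds x)"
    by eventually_elim auto
  then obtain r where r: "r > 0" "\<And>y. dist y x < r \<Longrightarrow> ?N y < ?N x + 1 \<and> y \<in> S"
    unfolding eventually_nhds_metric by blast
  have "norm (f y - f z) \<le> (?N x + 1) * norm (y - z)" if "y \<in> ball x r" "z \<in> ball x r" for y z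
  proof (rule differentiable_bound[OF convex_ball _ _ that])
    fix w
    assume "w \<in> ball x r"
    then have w: "?N w < ?N x + 1" "w \<in> S"
      using r(2)[of w] by (auto simp: dist_commute)
    show "(f has_derivative frechet_derivative f (at w)) (at w within ball x r)"
      using smooth_on_has_derivative[OF assms(2) w(2)] has_derivative_at_withinI by blast
    show "onorm (frechet_derivative f (at w)) \<le> ?N x + 1"
      using onorm_linear_le_sum_Basis[OF linear_frechet_derivative_at
          [OF smooth_on_imp_differentiable[OF assms(2) w(2)]]] w(1) by linarith
  qed
  then show ?thesis
    using that r(1) by blast
qed

lemma bilinear_expand_Basis:
  fixes B :: "'e::euclidean_space \<Rightarrow> 'f::euclidean_space \<Rightarrow> real"
  assumes "bilinear B"
  shows "B u w = (\<Sum>i\<in>Basis. \<Sum>j\<in>Basis. (u \<bullet> i) * (w \<bullet> j) * B i j)"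
proof -
  have "B u w = B (\<Sum>i\<in>Basis. (u \<bullet> i) *\<^sub>R i) (\<Sum>j\<in>Basis. (w \<bullet> j) *\<^sub>R j)"
    by (simp add: euclidean_representation)
  also have "\<dots> = (\<Sum>(i, j)\<in>Basis \<times> Basis. B ((u \<bullet> i) *\<^sub>R i) ((w \<bullet> j) *\<^sub>R j))"
    by (rule bilinear_sum[OF assms])
  also have "\<dots> = (\<Sum>i\<in>Basis. \<Sum>j\<in>Basis. (u \<bullet> i) * (w \<bullet> j) * B i j)"
    by (simp add: sum.cartesian_product bilinear_lmul[OF assms] bilinear_rmul[OF assms] mult_ac)
  finally show ?thesis .
qed

section \<open>Rigidity of isometries in coordinates\<close>

text \<open>Bilinearity holds throughout the open set \<open>U\<close>, so the expansion in
  coefficient functions may be differentiated in the base point.\<close>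

lemma frechet_derivative_tensor_expand:
  fixes G :: "'e::euclidean_space \<Rightarrow> 'f::euclidean_space \<Rightarrow> 'f \<Rightarrow> real"
  assumes "open U" and bil: "\<And>y. y \<in> U \<Longrightarrow> bilinear (G y)"
    and dif: "\<And>u w y. y \<in> U \<Longrightarrow> (\<lambda>y. G y u w) differentiable at y"
    and "y \<in> U"
  shows "frechet_derivative (\<lambda>y. G y u w) (at y) z =
    (\<Sum>i\<in>Basis. \<Sum>j\<in>Basis. (u \<bullet> i) * (w \<bullet> j) * frechet_derivative (\<lambda>y. G y i j) (at y) z)"
proof -
  have "((\<lambda>y. \<Sum>i\<in>Basis. \<Sum>j\<in>Basis. (u \<bullet> i) * (w \<bullet> j) * G y i j) has_derivative
      (\<lambda>z. \<Sum>i\<in>Basis. \<Sum>j\<in>Basis. (u \<bullet> i) * (w \<bullet> j) * frechet_derivative (\<lambda>y. G y i j) (at y) z)) (at y)"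
    by (intro has_derivative_sum has_derivative_mult_right has_frechet_derivative dif assms)
  then have "((\<lambda>y. G y u w) has_derivative
      (\<lambda>z. \<Sum>i\<in>Basis. \<Sum>j\<in>Basis. (u \<bullet> i) * (w \<bullet> j) * frechet_derivative (\<lambda>y. G y i j) (at y) z)) (at y)"
    by (rule has_derivative_transform_within_open[OF _ assms(1) assms(4)])
      (rule bilinear_expand_Basis[OF bil, symmetric])
  then show ?thesis
    by (simp add: frechet_derivative_eqI)
qed

text \<open>The product rule for a metric whose base point and both arguments vary.
  Differentiability is assumed only for fixed arguments, so the proof goes through the finitely many
  coefficient functions.\<close>

lemma has_derivative_tensor:
  fixes G :: "'e::euclidean_space \<Rightarrow> 'f::euclidean_space \<Rightarrow> 'f \<Rightarrow> real"
    and a :: "'x::real_normed_vector \<Rightarrow> 'e"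
  assumes "open U" and bil: "\<And>y. y \<in> U \<Longrightarrow> bilinear (G y)"
    and dif: "\<And>u w y. y \<in> U \<Longrightarrow> (\<lambda>y. G y u w) differentiable at y"
    and a: "(a has_derivative a') (at x)" and b: "(b has_derivative b') (at x)"
    and c: "(c has_derivative c') (at x)" and "a x \<in> U"
  shows "((\<lambda>x. G (a x) (b x) (c x)) has_derivative
    (\<lambda>h. frechet_derivative (\<lambda>y. G y (b x) (c x)) (at (a x)) (a' h) +
         G (a x) (b' h) (c x) + G (a x) (b x) (c' h))) (at x)"
proof -
  let ?P = "\<lambda>i j. frechet_derivative (\<lambda>y. G y i j) (at (a x))"
  have G: "((\<lambda>x. G (a x) i j) has_derivative (\<lambda>h. ?P i j (a' h))) (at x)" for i j
    using diff_chain_at[OF a has_frechet_derivative[OF dif[OF assms(7), of i j]]] by (simp add: o_def)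
  have "((\<lambda>x. \<Sum>i\<in>Basis. \<Sum>j\<in>Basis. (b x \<bullet> i) * (c x \<bullet> j) * G (a x) i j) has_derivative
      (\<lambda>h. \<Sum>i\<in>Basis. \<Sum>j\<in>Basis. (b x \<bullet> i) * (c x \<bullet> j) * ?P i j (a' h) +
         ((b x \<bullet> i) * (c' h \<bullet> j) + (b' h \<bullet> i) * (c x \<bullet> j)) * G (a x) i j)) (at x)"
    by (intro has_derivative_sum has_derivative_mult has_derivative_inner_left G a b c)
  moreover have "(\<lambda>h. \<Sum>i\<in>Basis. \<Sum>j\<in>Basis. (b x \<bullet> i) * (c x \<bullet> j) * ?P i j (a' h) +
         ((b x \<bullet> i) * (c' h \<bullet> j) + (b' h \<bullet> i) * (c x \<bullet> j)) * G (a x) i j) =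
      (\<lambda>h. frechet_derivative (\<lambda>y. G y (b x) (c x)) (at (a x)) (a' h) +
         G (a x) (b' h) (c x) + G (a x) (b x) (c' h))"
    using assms(7)
    by (simp add: frechet_derivative_tensor_expand[OF assms(1) bil dif, where u = "b x"]
        bilinear_expand_Basis[OF bil, where u = "b' _"] bilinear_expand_Basis[OF bil, where w = "c' _"]
        sum.distrib distrib_right add_ac)
  ultimately have *: "((\<lambda>x. \<Sum>i\<in>Basis. \<Sum>j\<in>Basis. (b x \<bullet> i) * (c x \<bullet> j) * G (a x) i j) has_derivative
      (\<lambda>h. frechet_derivative (\<lambda>y. G y (b x) (c x)) (at (a x)) (a' h) +
         G (a x) (b' h) (c x) + G (a x) (b x) (c' h))) (at x)"
    by simp
  \<comment> \<open>The expansion in coefficients is valid only over \<open>U\<close>, so it has to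
    be known that \<open>a\<close> stays in \<open>U\<close> near \<open>x\<close>.\<close>
  have "(a \<longlongrightarrow> a x) (at x)"
    using has_derivative_continuous[OF a] by (simp add: continuous_within)
  then have "eventually (\<lambda>x. a x \<in> U) (at x)"
    using assms(1,7) by (rule topological_tendstoD)
  then have "eventually (\<lambda>x. (\<Sum>i\<in>Basis. \<Sum>j\<in>Basis. (b x \<bullet> i) * (c x \<bullet> j) * G (a x) i j) = G (a x) (b x) (c x)) (at x)"
    by eventually_elim (rule bilinear_expand_Basis[OF bil, symmetric])
  then show ?thesis
    using bilinear_expand_Basis[OF bil[OF assms(7)], symmetric]
    by (intro has_derivative_transform_eventually[OF *]) auto
qed

section \<open>The second derivatives of an isometry controlled by its 1-jet\<close>

text \<open>The difference of products is \<open>f (g - g') + g' (f - f')\<close>. Stated for two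
  factors so that repeated application treats longer products.\<close>

lemma bigo_mult_diff:
  fixes f g :: "'a \<Rightarrow> real"
  assumes "(\<lambda>x. f x - f' x) \<in> O[F](d)" "(\<lambda>x. g x - g' x) \<in> O[F](d)"
    "f \<in> O[F](\<lambda>_. 1)" "g' \<in> O[F](\<lambda>_. 1)"
  shows "(\<lambda>x. f x * g x - f' x * g' x) \<in> O[F](d)"
proof -
  have "(\<lambda>x. f x * (g x - g' x)) \<in> O[F](\<lambda>x. 1 * d x)" "(\<lambda>x. g' x * (f x - f' x)) \<in> O[F](\<lambda>x. 1 * d x)"
    by (intro landau_o.big.mult assms)+
  then have "(\<lambda>x. f x * (g x - g' x) + g' x * (f x - f' x)) \<in> O[F](d)"
    by (intro sum_in_bigo) simp_all
  then show ?thesis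
    by (simp add: algebra_simps)
qed

lemma tendsto_imp_bigo_1:
  fixes f :: "'a \<Rightarrow> real"
  assumes "(f \<longlongrightarrow> l) F"
  shows "f \<in> O[F](\<lambda>_. 1)"
proof -
  have "eventually (\<lambda>x. dist (f x) l < 1) F"
    using assms by (rule tendstoD) simp
  then have "eventually (\<lambda>x. norm (f x) \<le> (\<bar>l\<bar> + 1) * norm (1::real)) F"
    by eventually_elim (auto simp: dist_real_def)
  then show ?thesis
    by (rule bigoI)
qed

lemma bigo_norm_bound:
  fixes f :: "'a \<Rightarrow> 'f::euclidean_space"
  assumes "\<And>i. i \<in> Basis \<Longrightarrow> (\<lambda>x. f x \<bullet> i) \<in> O[F](d)"
  shows "(\<lambda>x. norm (f x)) \<in> O[F](d)"
proof -
  have "(\<lambda>x. norm (f x)) \<in> O[F](\<lambda>x. \<Sum>i\<in>Basis. \<bar>f x \<bullet> i\<bar>)"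
    by (rule bigoI[where c = 1]) (auto simp: norm_le_l1 intro!: always_eventually order_trans[OF norm_le_l1 abs_ge_self])
  also have "(\<lambda>x. \<Sum>i\<in>Basis. \<bar>f x \<bullet> i\<bar>) \<in> O[F](d)"
    by (intro big_sum_in_bigo) (use assms in simp)
  finally show ?thesis .
qed

text \<open>No differential equation is needed: on a small ball of radius \<open>p\<close> the mean value theorem bounds
  the supremum of \<open>d\<close> by \<open>p K\<close> times itself.\<close>

lemma identity_near_of_second_derivative_bound:
  fixes f :: "'e::euclidean_space \<Rightarrow> 'e"
  assumes "open S" "smooth_on S f" "y0 \<in> S" "f y0 = y0" "\<And>u. frechet_derivative f (at y0) u = u"
    and O: "(\<lambda>y. \<Sum>i\<in>Basis. \<Sum>j\<in>Basis. norm (frechet_derivative (\<lambda>y. frechet_derivative f (at y) i) (at y) j))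
      \<in> O[nhds y0](\<lambda>y. norm (f y - y) + (\<Sum>i\<in>Basis. norm (frechet_derivative f (at y) i - i)))"
  shows "eventually (\<lambda>y. f y = y) (nhds y0)"
proof -
  let ?D = "\<lambda>y. frechet_derivative f (at y)"
  let ?H = "\<lambda>y i. frechet_derivative (\<lambda>y. ?D y i) (at y)"
  \<comment> \<open>The distance of the 1-jet of \<open>f\<close> at \<open>y\<close> from that of
    the identity; the hypotheses at \<open>y0\<close> make it vanish there.\<close>
  define d where "d y = norm (f y - y) + (\<Sum>i\<in>Basis. norm (?D y i - i))" for y
  have d0: "d y \<ge> 0" for y
    by (simp add: d_def sum_nonneg)
  obtain C where "C > 0" and C: "eventually (\<lambda>y. norm (\<Sum>i\<in>Basis. \<Sum>j\<in>Basis. norm (?H y i j)) \<le> C * norm (d y)) (nhds y0)"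
    using O unfolding d_def[symmetric] by (elim landau_o.bigE)
  have "eventually (\<lambda>y. y \<in> S) (nhds y0)"
    using assms(1,3) eventually_nhds by blast
  with C have "eventually (\<lambda>y. (\<Sum>i\<in>Basis. \<Sum>j\<in>Basis. norm (?H y i j)) \<le> C * d y \<and> y \<in> S) (nhds y0)"
    by eventually_elim (use d0 in auto)
  then obtain r where "r > 0" and r: "\<And>y. dist y y0 < r \<Longrightarrow> (\<Sum>i\<in>Basis. \<Sum>j\<in>Basis. norm (?H y i j)) \<le> C * d y \<and> y \<in> S"
    unfolding eventually_nhds_metric by blast
  \<comment> \<open>Collects the constants to come: 1 from the estimate of the values, and
    \<open>C\<close> for each basis direction from the estimate of the first derivatives.\<close>
  define K where "K = 1 + real DIM('e) * C"
  have "K > 0"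
    using \<open>C > 0\<close> by (simp add: K_def add_pos_nonneg)
  \<comment> \<open>The first bound keeps the closed ball inside the ball of radius
    \<open>r\<close>, the second gives the contraction factor
    \<open>p * K \<le> 1 / 2\<close>.\<close>
  define p where "p = min (r / 2) (1 / (2 * K))"
  have p: "p > 0" "p < r" "p * K \<le> 1 / 2"
    using \<open>r > 0\<close> \<open>K > 0\<close> by (auto simp: p_def min_def field_simps)
  have inS: "y \<in> S" and bound: "(\<Sum>i\<in>Basis. \<Sum>j\<in>Basis. norm (?H y i j)) \<le> C * d y" if "y \<in> cball y0 p" for y
    using that r[of y] p by (auto simp: dist_commute)
  have "continuous_on (cball y0 p) d"
    unfolding d_def
    by (intro continuous_intros smooth_on_imp_continuous_on smooth_on_frechet_derivative
        smooth_on_subset[OF assms(2)] subsetI inS)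
  then obtain y1 where y1: "y1 \<in> cball y0 p" and max: "\<And>y. y \<in> cball y0 p \<Longrightarrow> d y \<le> d y1"
    using continuous_attains_sup[of "cball y0 p" d] p by fastforce
  have y0p: "y0 \<in> cball y0 p" and "norm (y1 - y0) \<le> p"
    using p y1 by (auto simp: dist_norm norm_minus_commute)
  have 1: "norm (?D y1 i - i) \<le> C * d y1 * p" if "i \<in> Basis" for i
  proof -
    have "norm (?D y1 i - ?D y0 i) \<le> C * d y1 * norm (y1 - y0)"
    proof (rule differentiable_bound[OF convex_cball _ _ y1 y0p])
      fix y
      assume y: "y \<in> cball y0 p"
      show "((\<lambda>y. ?D y i) has_derivative ?H y i) (at y within cball y0 p)"
        by (rule has_derivative_at_withinI[OF smooth_on_has_derivative[OF
                smooth_on_frechet_derivative[OF assms(2)] inS[OF y]]])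
      have "onorm (?H y i) \<le> (\<Sum>j\<in>Basis. norm (?H y i j))"
        by (rule onorm_linear_le_sum_Basis linear_frechet_derivative_at smooth_on_imp_differentiable
            smooth_on_frechet_derivative assms(2) inS y)+
      also have "\<dots> \<le> (\<Sum>i\<in>Basis. \<Sum>j\<in>Basis. norm (?H y i j))"
        using that by (intro member_le_sum) (auto intro: sum_nonneg)
      also have "\<dots> \<le> C * d y"
        by (rule bound[OF y])
      also have "\<dots> \<le> C * d y1"
        using max[OF y] \<open>C > 0\<close> by simp
      finally show "onorm (?H y i) \<le> C * d y1" .
    qed
    also have "\<dots> \<le> C * d y1 * p"
      using \<open>norm (y1 - y0) \<le> p\<close> \<open>C > 0\<close> d0 by (intro mult_left_mono) auto
    finally show ?thesis
      by (simp add: assms(5))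
  qed
  have 2: "norm (f y1 - y1) \<le> d y1 * p"
  proof -
    have "norm ((f y1 - y1) - (f y0 - y0)) \<le> d y1 * norm (y1 - y0)"
    proof (rule differentiable_bound[OF convex_cball _ _ y1 y0p])
      fix y
      assume y: "y \<in> cball y0 p"
      show "((\<lambda>y. f y - y) has_derivative (\<lambda>h. ?D y h - h)) (at y within cball y0 p)"
        by (rule has_derivative_diff[OF has_derivative_at_withinI[OF smooth_on_has_derivative[OF
                assms(2) inS[OF y]]] has_derivative_ident])
      have "linear (\<lambda>h. ?D y h - h)"
        by (intro linear_compose_sub linear_ident linear_frechet_derivative_at
            smooth_on_imp_differentiable[OF assms(2)] inS y)
      then have "onorm (\<lambda>h. ?D y h - h) \<le> (\<Sum>i\<in>Basis. norm (?D y i - i))"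
        by (rule onorm_linear_le_sum_Basis)
      also have "\<dots> \<le> d y"
        by (simp add: d_def)
      also have "\<dots> \<le> d y1"
        by (rule max[OF y])
      finally show "onorm (\<lambda>h. ?D y h - h) \<le> d y1" .
    qed
    also have "\<dots> \<le> d y1 * p"
      using \<open>norm (y1 - y0) \<le> p\<close> d0 by (intro mult_left_mono) auto
    finally show ?thesis
      by (simp add: assms(4))
  qed
  \<comment> \<open>At the maximum point \<open>y1\<close> both estimates are multiples of
    \<open>d y1\<close> itself. They add up to at most half of it, so the maximum is 0.\<close>
  have "d y1 \<le> d y1 * p + (\<Sum>i\<in>(Basis::'e set). C * d y1 * p)"
    unfolding d_def[of y1] by (intro add_mono sum_mono) (use 1 2 in \<open>auto simp: d_def\<close>)
  also have "\<dots> = d y1 * (p * K)"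
    by (simp add: K_def algebra_simps)
  also have "\<dots> \<le> d y1 * (1 / 2)"
    using p(3) d0 by (rule mult_left_mono)
  finally have "d y1 \<le> 0"
    by simp
  then have "d y = 0" if "y \<in> cball y0 p" for y
    using max[OF that] d0[of y] by linarith
  then have "f y = y" if "y \<in> cball y0 p" for y
  proof -
    have "norm (f y - y) \<le> d y"
      by (simp add: d_def sum_nonneg)
    then show ?thesis
      using \<open>y \<in> cball y0 p \<Longrightarrow> d y = 0\<close> that by simp
  qed
  then show ?thesis
    unfolding eventually_nhds_metric using p(1) by (auto simp: dist_commute intro!: exI[of _ p])
qed

text \<open>Differentiating the isometry equation expresses symmetrised pairings of second
  derivatives with first derivatives by the failure of the derivative of the metric to be preserved
  by \<open>f\<close>. That failure is small with the distance of the 1-jet from the identity.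
  Symmetry of second derivatives removes the symmetrisation, and nondegeneracy of the metric
  recovers the vector from its pairings.\<close>

lemma isometry_second_derivative_bound:
  fixes f :: "'e::euclidean_space \<Rightarrow> 'e" and G :: "'e \<Rightarrow> 'e \<Rightarrow> 'e \<Rightarrow> real"
  assumes "open S" "open U" "S \<subseteq> U" "f ` S \<subseteq> U" "smooth_on S f"
    and smG: "\<And>u w. smooth_on U (\<lambda>y. G y u w)"
    and bil: "\<And>y. y \<in> U \<Longrightarrow> bilinear (G y)"
    and sym: "\<And>y u w. y \<in> U \<Longrightarrow> G y u w = G y w u"
    and pos: "\<And>u. u \<noteq> 0 \<Longrightarrow> 0 < G y0 u u"
    and iso: "\<And>y u w. y \<in> S \<Longrightarrow>
      G (f y) (frechet_derivative f (at y) u) (frechet_derivative f (at y) w) = G y u w"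
    and y0: "y0 \<in> S" "f y0 = y0" "\<And>u. frechet_derivative f (at y0) u = u"
    and ij: "i \<in> Basis" "j \<in> Basis"
  shows "(\<lambda>y. norm (frechet_derivative (\<lambda>y. frechet_derivative f (at y) i) (at y) j))
      \<in> O[nhds y0](\<lambda>y. norm (f y - y) + (\<Sum>i\<in>Basis. norm (frechet_derivative f (at y) i - i)))"
proof -
  define D where "D y = frechet_derivative f (at y)" for y
  define H where "H y a b = frechet_derivative (\<lambda>y. D y a) (at y) b" for y a b
  define P where "P y z u w = frechet_derivative (\<lambda>y. G y u w) (at y) z" for y z u w
  define d where "d y = norm (f y - y) + (\<Sum>i\<in>Basis. norm (D y i - i))" for y
  \<comment> \<open>\<open>E\<close> is how far the derivative of the metric at \<open>y\<close> is
    from its transport by \<open>f\<close>; \<open>T\<close> pairs a second derivative of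
    \<open>f\<close> with a first one.\<close>
  define E where "E u w z y = P y z u w - P (f y) (D y z) (D y u) (D y w)" for u w z y
  define T where "T a b c y = G (f y) (H y a b) (D y c)" for a b c y
  have smD: "smooth_on S (\<lambda>y. D y a)" for a
    unfolding D_def by (rule smooth_on_frechet_derivative[OF assms(5)])
  have smH: "smooth_on S (\<lambda>y. H y a b)" for a b
    unfolding H_def by (rule smooth_on_frechet_derivative[OF smD])
  have smP: "smooth_on U (\<lambda>y. P y z u w)" for z u w
    unfolding P_def by (rule smooth_on_frechet_derivative[OF smG])
  have inU: "y \<in> U" "f y \<in> U" if "y \<in> S" for y
    using that assms(3,4) by auto
  have difG: "(\<lambda>y. G y u w) differentiable at y" if "y \<in> U" for y u w
    using smooth_on_imp_differentiable[OF smG that] .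
  have Hsym: "H y a b = H y b a" if "y \<in> S" for y a b
    unfolding H_def D_def by (rule second_derivative_symmetric[OF assms(1,5) that])
  have ET: "E u w z y = T u z w y + T w z u y" if "y \<in> S" for u w z y
  proof -
    have "((\<lambda>y. G (f y) (D y u) (D y w)) has_derivative
      (\<lambda>h. P (f y) (D y h) (D y u) (D y w) + G (f y) (H y u h) (D y w) + G (f y) (D y u) (H y w h))) (at y)"
      unfolding P_def
    proof (rule has_derivative_tensor[OF assms(2) bil difG])
      show "(f has_derivative D y) (at y)"
        unfolding D_def by (rule smooth_on_has_derivative[OF assms(5) that])
      show "((\<lambda>y. D y u) has_derivative H y u) (at y)" "((\<lambda>y. D y w) has_derivative H y w) (at y)"
        unfolding H_def by (rule smooth_on_has_derivative[OF smD that])+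
    qed (use inU that in auto)
    \<comment> \<open>The pulled back metric is the metric itself, so the product rule computes the
      derivative of \<open>G\<close> in a second way.\<close>
    then have "((\<lambda>y. G y u w) has_derivative
      (\<lambda>h. P (f y) (D y h) (D y u) (D y w) + G (f y) (H y u h) (D y w) + G (f y) (D y u) (H y w h))) (at y)"
      by (rule has_derivative_transform_within_open[OF _ assms(1) that]) (simp add: iso D_def)
    then have "P y z u w = P (f y) (D y z) (D y u) (D y w) + G (f y) (H y u z) (D y w) + G (f y) (D y u) (H y w z)"
      unfolding P_def[of y] by (simp add: frechet_derivative_eqI)
    then show ?thesis
      using sym[OF inU(2)[OF that], of "D y u"] by (simp add: E_def T_def)
  qed
  \<comment> \<open>As for the Christoffel symbols: \<open>T\<close> is symmetric in its first two arguments, so it is determined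
    by the symmetrisations \<open>E\<close>.\<close>
  have koszul: "T u w z y = (E u z w y + E w z u y - E u w z y) / 2" if "y \<in> S" for u w z y
    using that Hsym[OF that] by (simp add: ET) (simp add: T_def)
  have near: "eventually (\<lambda>y. y \<in> S) (nhds y0)"
    using assms(1) y0(1) eventually_nhds by blast
  have tend: "(h \<longlongrightarrow> h y0) (nhds y0)" if "smooth_on S h" for h :: "'e \<Rightarrow> 'x::euclidean_space"
    by (rule continuous_on_tendsto_nhds[OF assms(1) smooth_on_imp_continuous_on[OF that] y0(1)])
  have tendf: "(f \<longlongrightarrow> y0) (nhds y0)"
    using tend[OF assms(5)] y0(2) by simp
  have tendU: "((\<lambda>y. h (f y)) \<longlongrightarrow> h y0) (nhds y0)" if "smooth_on U h" for h :: "'e \<Rightarrow> real"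
    using filterlim_compose[OF continuous_on_tendsto_nhds[OF assms(2) smooth_on_imp_continuous_on[OF that] inU(1)[OF y0(1)]] tendf] .
  have d0: "d y \<ge> 0" for y
    by (simp add: d_def sum_nonneg)
  have Dd: "(\<lambda>y. a \<bullet> b - D y a \<bullet> b) \<in> O[nhds y0](d)" if "a \<in> Basis" "b \<in> Basis" for a b
  proof (rule bigoI[where c = 1], rule always_eventually, rule allI)
    fix y
    have "\<bar>(a - D y a) \<bullet> b\<bar> \<le> norm (a - D y a)"
      by (rule Basis_le_norm[OF that(2)])
    also have "\<dots> \<le> (\<Sum>i\<in>Basis. norm (D y i - i))"
      using that(1) by (subst norm_minus_commute, intro member_le_sum) auto
    also have "\<dots> \<le> d y"
      by (simp add: d_def)
    finally show "norm (a \<bullet> b - D y a \<bullet> b) \<le> 1 * norm (d y)"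
      using d0[of y] by (simp add: inner_diff_left)
  qed
  have D1: "(\<lambda>y. D y a \<bullet> b) \<in> O[nhds y0](\<lambda>_. 1)" for a b
    by (rule tendsto_imp_bigo_1, rule tendsto_inner, rule tend[OF smD], rule tendsto_const)
  have H1: "(\<lambda>y. H y a b \<bullet> c) \<in> O[nhds y0](\<lambda>_. 1)" for a b c
    by (rule tendsto_imp_bigo_1, rule tendsto_inner, rule tend[OF smH], rule tendsto_const)
  have G1: "(\<lambda>y. G (f y) a b) \<in> O[nhds y0](\<lambda>_. 1)" for a b
    by (rule tendsto_imp_bigo_1, rule tendU[OF smG])
  have P1: "(\<lambda>y. P (f y) c a b) \<in> O[nhds y0](\<lambda>_. 1)" for a b c
    by (rule tendsto_imp_bigo_1, rule tendU[OF smP])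
  have Pd: "(\<lambda>y. P y c a b - P (f y) c a b) \<in> O[nhds y0](d)" for a b c
  proof -
    obtain r C where "r > 0" and rC: "\<And>y z. y \<in> ball y0 r \<Longrightarrow> z \<in> ball y0 r \<Longrightarrow>
        norm (P y c a b - P z c a b) \<le> C * norm (y - z)"
      using smooth_on_locally_Lipschitz[OF assms(2) smP[of c a b] inU(1)[OF y0(1)]] by metis
    have "eventually (\<lambda>y. y \<in> ball y0 r) (nhds y0)"
      using \<open>r > 0\<close> by (intro eventually_nhds_in_open) auto
    moreover have "eventually (\<lambda>y. f y \<in> ball y0 r) (nhds y0)"
      using tendf \<open>r > 0\<close> by (intro topological_tendstoD) auto
    \<comment> \<open>The sign of the Lipschitz constant is unknown, hence the absolute value. The
      points compared are \<open>y\<close> and \<open>f y\<close>, whose distance is a summand of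
      \<open>d\<close>.\<close>
    ultimately have "eventually (\<lambda>y. norm (P y c a b - P (f y) c a b) \<le> \<bar>C\<bar> * norm (d y)) (nhds y0)"
    proof eventually_elim
      case (elim y)
      have "norm (P y c a b - P (f y) c a b) \<le> C * norm (y - f y)"
        by (rule rC) (use elim in auto)
      also have "\<dots> \<le> \<bar>C\<bar> * d y"
        by (intro mult_mono) (auto simp: d_def norm_minus_commute sum_nonneg)
      finally show ?case
        using d0[of y] by simp
    qed
    then show ?thesis
      by (rule bigoI)
  qed
  have PE: "P y z u w = (\<Sum>a\<in>Basis. \<Sum>b\<in>Basis. \<Sum>c\<in>Basis. (u \<bullet> a) * (w \<bullet> b) * (z \<bullet> c) * P y c a b)"
    if "y \<in> U" for y z u w
  proof -
    have lin: "linear (\<lambda>z. P y z a b)" for a b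
      unfolding P_def by (rule linear_frechet_derivative_at[OF difG[OF that]])
    have "P y z a b = P y (\<Sum>c\<in>Basis. (z \<bullet> c) *\<^sub>R c) a b" for a b
      by (simp add: euclidean_representation)
    also have "P y (\<Sum>c\<in>Basis. (z \<bullet> c) *\<^sub>R c) a b = (\<Sum>c\<in>Basis. (z \<bullet> c) * P y c a b)" for a b
      by (simp add: linear_sum[OF lin] linear_cmul[OF lin])
    finally have "P y z a b = (\<Sum>c\<in>Basis. (z \<bullet> c) * P y c a b)" for a b .
    moreover have "P y z u w = (\<Sum>a\<in>Basis. \<Sum>b\<in>Basis. (u \<bullet> a) * (w \<bullet> b) * P y z a b)"
      unfolding P_def by (rule frechet_derivative_tensor_expand[OF assms(2) bil difG that])
    ultimately show ?thesis
      by (simp add: sum_distrib_left mult.assoc)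
  qed
  \<comment> \<open>In components, \<open>E\<close> is a sum of differences of products: every
    factor is bounded near \<open>y0\<close>, and corresponding factors differ by
    \<open>O(d)\<close>.\<close>
  have EO: "E u w z \<in> O[nhds y0](d)" if "u \<in> Basis" "w \<in> Basis" "z \<in> Basis" for u w z
  proof -
    have "(\<lambda>y. \<Sum>a\<in>Basis. \<Sum>b\<in>Basis. \<Sum>c\<in>Basis. (u \<bullet> a) * (w \<bullet> b) * (z \<bullet> c) * P y c a b
        - (D y u \<bullet> a) * (D y w \<bullet> b) * (D y z \<bullet> c) * P (f y) c a b) \<in> O[nhds y0](d)"
      by (intro big_sum_in_bigo bigo_mult_diff Pd P1 D1 Dd that) simp_all
    moreover have "eventually (\<lambda>y. (\<Sum>a\<in>Basis. \<Sum>b\<in>Basis. \<Sum>c\<in>Basis. (u \<bullet> a) * (w \<bullet> b) * (z \<bullet> c) * P y c a b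
        - (D y u \<bullet> a) * (D y w \<bullet> b) * (D y z \<bullet> c) * P (f y) c a b) = E u w z y) (nhds y0)"
      using near
    proof eventually_elim
      case (elim y)
      show ?case
        unfolding E_def PE[OF inU(1)[OF elim], of z u] PE[OF inU(2)[OF elim], of "D y z"]
        by (simp add: sum_subtractf)
    qed
    ultimately show ?thesis
      by (subst (asm) landau_o.big.in_cong)
  qed
  have TO: "T u w z \<in> O[nhds y0](d)" if "u \<in> Basis" "w \<in> Basis" "z \<in> Basis" for u w z
  proof -
    have "(\<lambda>y. E u z w y + E w z u y - E u w z y) \<in> O[nhds y0](d)"
      by (intro sum_in_bigo EO that)
    then have "(\<lambda>y. (E u z w y + E w z u y - E u w z y) / 2) \<in> O[nhds y0](d)"
      by simp
    moreover have "eventually (\<lambda>y. (E u z w y + E w z u y - E u w z y) / 2 = T u w z y) (nhds y0)"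
      using near by eventually_elim (rule koszul[symmetric])
    ultimately show ?thesis
      by (subst (asm) landau_o.big.in_cong)
  qed
  \<comment> \<open>Replaces \<open>D y k\<close> by \<open>k\<close> in the second slot of
    \<open>T i j k\<close>: the error contains the factor \<open>k - D y k\<close>, which is
    \<open>O(d)\<close>, while the second derivative is bounded near \<open>y0\<close>.\<close>
  have GO: "(\<lambda>y. G (f y) (H y i j) k) \<in> O[nhds y0](d)" if "k \<in> Basis" for k
  proof -
    have "(\<lambda>y. (H y i j \<bullet> a) * (k \<bullet> b - D y k \<bullet> b) * G (f y) a b) \<in> O[nhds y0](d)" if "b \<in> Basis" for a b
      using landau_o.big.mult[OF landau_o.big.mult[OF H1 Dd[OF \<open>k \<in> Basis\<close> that]] G1] by simp
    then have "(\<lambda>y. T i j k y + (\<Sum>a\<in>Basis. \<Sum>b\<in>Basis. (H y i j \<bullet> a) * (k \<bullet> b - D y k \<bullet> b) * G (f y) a b)) \<in> O[nhds y0](d)"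
      by (intro sum_in_bigo(1) TO big_sum_in_bigo ij that) auto
    moreover have "eventually (\<lambda>y. T i j k y + (\<Sum>a\<in>Basis. \<Sum>b\<in>Basis. (H y i j \<bullet> a) * (k \<bullet> b - D y k \<bullet> b) * G (f y) a b)
        = G (f y) (H y i j) k) (nhds y0)"
      using near
    proof eventually_elim
      case (elim y)
      have "(\<Sum>a\<in>Basis. \<Sum>b\<in>Basis. (H y i j \<bullet> a) * (k \<bullet> b - D y k \<bullet> b) * G (f y) a b) = G (f y) (H y i j) (k - D y k)"
        using bilinear_expand_Basis[OF bil[OF inU(2)[OF elim]], of "H y i j" "k - D y k"]
        by (simp add: inner_diff_left)
      then show ?case
        using bilinear_rsub[OF bil[OF inU(2)[OF elim]]] by (simp add: T_def)
    qed
    ultimately show ?thesis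
      by (subst (asm) landau_o.big.in_cong)
  qed
  \<comment> \<open>The metric as a linear map, by its pairings with the basis. Injectivity at
    \<open>y0\<close> gives the lower bound \<open>m\<close>, to be transferred to nearby
    points.\<close>
  define \<Gamma> where "\<Gamma> y v = (\<Sum>k\<in>Basis. G y v k *\<^sub>R k)" for y v
  have linG: "linear (\<Gamma> y)" if "y \<in> U" for y
    unfolding \<Gamma>_def
    by (rule linearI) (simp_all add: bilinear_ladd[OF bil[OF that]] bilinear_lmul[OF bil[OF that]]
        scaleR_add_left sum.distrib scaleR_sum_right)
  have inner\<Gamma>: "\<Gamma> y v \<bullet> k = G y v k" if "k \<in> Basis" for y v k
    unfolding \<Gamma>_def using that by (simp add: inner_sum_left_Basis)
  have "y0 \<in> U"
    using inU y0 by blast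
  have "inj (\<Gamma> y0)"
    unfolding linear_injective_0[OF linG[OF \<open>y0 \<in> U\<close>]]
  proof (intro allI impI)
    fix v
    assume "\<Gamma> y0 v = 0"
    then have "G y0 v k = 0" if "k \<in> Basis" for k
      using inner\<Gamma>[OF that, of y0 v] by simp
    moreover have "linear (G y0 v)"
      using bil[OF \<open>y0 \<in> U\<close>] by (simp add: bilinear_def)
    then have "G y0 v (\<Sum>k\<in>Basis. (v \<bullet> k) *\<^sub>R k) = (\<Sum>k\<in>Basis. (v \<bullet> k) * G y0 v k)"
      by (simp add: linear_sum linear_cmul)
    ultimately have "G y0 v v = 0"
      by (simp add: euclidean_representation)
    then show "v = 0"
      using pos[of v] by auto
  qed
  then obtain m where "m > 0" and m: "\<And>v. m * norm v \<le> norm (\<Gamma> y0 v)"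
    using linear_inj_bounded_below_pos[OF linG[OF \<open>y0 \<in> U\<close>]] by blast
  \<comment> \<open>As \<open>f y\<close> tends to \<open>y0\<close>, the maps \<Gamma> at
    \<open>f y\<close> converge to the one at \<open>y0\<close>, so that half of the lower bound
    \<open>m\<close> survives near \<open>y0\<close>.\<close>
  have "((\<lambda>y. \<Sum>a\<in>Basis. norm (\<Gamma> y0 a - \<Gamma> (f y) a)) \<longlongrightarrow> (\<Sum>a\<in>Basis. norm (\<Gamma> y0 a - \<Gamma> y0 a))) (nhds y0)"
    unfolding \<Gamma>_def by (intro tendsto_intros tendU smG)
  then have "eventually (\<lambda>y. (\<Sum>a\<in>Basis. norm (\<Gamma> y0 a - \<Gamma> (f y) a)) < m / 2) (nhds y0)"
    using \<open>m > 0\<close> by (intro order_tendstoD(2)) auto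
  with near have "eventually (\<lambda>y. norm (norm (H y i j)) \<le> 2 / m * norm (norm (\<Gamma> (f y) (H y i j)))) (nhds y0)"
  proof eventually_elim
    case (elim y)
    let ?v = "H y i j"
    have "linear (\<lambda>v. \<Gamma> y0 v - \<Gamma> (f y) v)"
      by (intro linear_compose_sub linG \<open>y0 \<in> U\<close> inU elim)
    from norm_linear_le_sum_Basis[OF this, of ?v]
    have "norm (\<Gamma> y0 ?v - \<Gamma> (f y) ?v) \<le> m / 2 * norm ?v"
      using elim(2) by (meson less_imp_le mult_right_mono norm_ge_zero order_trans)
    then have "m * norm ?v \<le> norm (\<Gamma> (f y) ?v) + m / 2 * norm ?v"
      using m[of ?v] norm_triangle_sub[of "\<Gamma> y0 ?v" "\<Gamma> (f y) ?v"] by linarith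
    then show ?case
      using \<open>m > 0\<close> by (simp add: field_simps)
  qed
  then have "(\<lambda>y. norm (H y i j)) \<in> O[nhds y0](\<lambda>y. norm (\<Gamma> (f y) (H y i j)))"
    by (rule bigoI)
  also have "(\<lambda>y. norm (\<Gamma> (f y) (H y i j))) \<in> O[nhds y0](d)"
    by (rule bigo_norm_bound) (simp add: inner\<Gamma> GO)
  finally show ?thesis
    unfolding H_def D_def d_def .
qed

lemma isometry_rigidity:
  fixes f :: "'e::euclidean_space \<Rightarrow> 'e" and G :: "'e \<Rightarrow> 'e \<Rightarrow> 'e \<Rightarrow> real"
  assumes "open S" "open U" "S \<subseteq> U" "f ` S \<subseteq> U" "smooth_on S f"
    and "\<And>u w. smooth_on U (\<lambda>y. G y u w)"
    and "\<And>y. y \<in> U \<Longrightarrow> bilinear (G y)"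
    and "\<And>y u w. y \<in> U \<Longrightarrow> G y u w = G y w u"
    and "\<And>u. u \<noteq> 0 \<Longrightarrow> 0 < G y0 u u"
    and "\<And>y u w. y \<in> S \<Longrightarrow>
      G (f y) (frechet_derivative f (at y) u) (frechet_derivative f (at y) w) = G y u w"
    and "y0 \<in> S" "f y0 = y0" "\<And>u. frechet_derivative f (at y0) u = u"
  shows "eventually (\<lambda>y. f y = y) (nhds y0)"
  by (intro identity_near_of_second_derivative_bound[OF assms(1,5,11,12,13)] big_sum_in_bigo
      isometry_second_derivative_bound[OF assms])

section \<open>Inner products on subspaces\<close>

context
  fixes V :: "'v::real_vector set" and h :: "'v \<Rightarrow> 'v \<Rightarrow> real"
  assumes V: "subspace V" and h: "inner_product_on V h"
begin

lemma ip_commute: "u \<in> V \<Longrightarrow> v \<in> V \<Longrightarrow> h u v = h v u"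
  using h by (auto simp: inner_product_on_def)

lemma ip_add_right: "u \<in> V \<Longrightarrow> v \<in> V \<Longrightarrow> w \<in> V \<Longrightarrow> h u (v + w) = h u v + h u w"
  using h by (auto simp: inner_product_on_def linear_map_on_def)

lemma ip_scale_right: "u \<in> V \<Longrightarrow> v \<in> V \<Longrightarrow> h u (r *\<^sub>R v) = r * h u v"
  using h by (auto simp: inner_product_on_def linear_map_on_def)

lemma ip_add_left: "u \<in> V \<Longrightarrow> v \<in> V \<Longrightarrow> w \<in> V \<Longrightarrow> h (v + w) u = h v u + h w u"
  using ip_add_right[of u v w] by (simp add: ip_commute[of u] subspace_add[OF V])

lemma ip_scale_left: "u \<in> V \<Longrightarrow> v \<in> V \<Longrightarrow> h (r *\<^sub>R v) u = r * h v u"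
  using ip_scale_right[of u v r] by (simp add: ip_commute[of u] subspace_scale[OF V])

lemma ip_zero_right: "u \<in> V \<Longrightarrow> h u 0 = 0"
  using ip_scale_right[of u u 0] by simp

lemma ip_minus_right: "u \<in> V \<Longrightarrow> v \<in> V \<Longrightarrow> h u (- v) = - h u v"
  using ip_scale_right[of u v "- 1"] by simp

lemma ip_minus_left: "u \<in> V \<Longrightarrow> v \<in> V \<Longrightarrow> h (- v) u = - h v u"
  using ip_scale_left[of u v "- 1"] by simp

lemma ip_diff_right: "u \<in> V \<Longrightarrow> v \<in> V \<Longrightarrow> w \<in> V \<Longrightarrow> h u (v - w) = h u v - h u w"
  using ip_add_right[of u v "- w"] by (simp add: ip_minus_right subspace_neg[OF V])

lemma ip_sum_right:
  assumes "finite S" "u \<in> V" "\<And>i. i \<in> S \<Longrightarrow> f i \<in> V"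
  shows "h u (\<Sum>i\<in>S. f i) = (\<Sum>i\<in>S. h u (f i))"
  using assms(1,3)
proof (induction S rule: finite_induct)
  case empty
  show ?case
    using ip_zero_right[OF assms(2)] by simp
next
  case (insert i S)
  have "(\<Sum>i\<in>S. f i) \<in> V" "f i \<in> V"
    using insert.prems subspace_sum[OF V, of S f] by auto
  then have "h u (f i + (\<Sum>i\<in>S. f i)) = h u (f i) + h u (\<Sum>i\<in>S. f i)"
    using ip_add_right[OF assms(2)] by blast
  then show ?case
    using insert by simp
qed

lemma ip_pos: "u \<in> V \<Longrightarrow> u \<noteq> 0 \<Longrightarrow> 0 < h u u"
  using h by (auto simp: inner_product_on_def)

lemma ip_eq_0_iff: "u \<in> V \<Longrightarrow> h u u = 0 \<longleftrightarrow> u = 0"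
  using ip_pos[of u] ip_zero_right[of u] by (cases "u = 0") auto

text \<open>Gram-Schmidt for an inner product that is given on the subspace \<open>V\<close> only.
  The vectors of \<open>S\<close> may be dependent: one whose orthogonal component vanishes is
  dropped.\<close>

lemma Gram_Schmidt_span:
  assumes "finite S" "S \<subseteq> V"
  shows "\<exists>E. finite E \<and> E \<subseteq> V \<and> span E = span S \<and> (\<forall>e\<in>E. \<forall>f\<in>E. h e f = (if e = f then 1 else 0))"
  using assms
proof (induction S rule: finite_induct)
  case empty
  then show ?case
    by (intro exI[of _ "{}"]) simp
next
  case (insert a S)
  have "S \<subseteq> V"
    using insert.prems by simp
  then obtain E where E: "finite E" "E \<subseteq> V" "span E = span S"
    "\<forall>e\<in>E. \<forall>f\<in>E. h e f = (if e = f then 1 else 0)"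
    using insert.IH by blast
  define s where "s = (\<Sum>e\<in>E. h e a *\<^sub>R e)"
  \<comment> \<open>The component of \<open>a\<close> orthogonal to the vectors already found; it is
    zero exactly if \<open>a\<close> adds nothing to their span.\<close>
  define b where "b = a - s"
  have eV: "e \<in> V" if "e \<in> E" for e
    using E(2) that by auto
  have a: "a \<in> V"
    using insert.prems by simp
  have s: "s \<in> V" "s \<in> span E"
    unfolding s_def
    using subspace_sum[OF V, of E] subspace_scale[OF V] eV
    by (simp_all add: span_sum span_scale span_base)
  have b: "b \<in> V"
    unfolding b_def using a s(1) by (rule subspace_diff[OF V])
  have orth: "h f b = 0" if "f \<in> E" for f
  proof -
    have "h f s = (\<Sum>e\<in>E. h f (h e a *\<^sub>R e))"
      unfolding s_def using E(1) eV that by (intro ip_sum_right subspace_scale[OF V]) auto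
    also have "\<dots> = (\<Sum>e\<in>E. if e = f then h f a else 0)"
      using that by (intro sum.cong) (simp_all add: ip_scale_right eV E(4))
    also have "\<dots> = h f a"
      using that E(1) by simp
    finally show ?thesis
      using that a eV s(1) by (simp add: b_def ip_diff_right)
  qed
  show ?case
  proof (cases "b = 0")
    case True
    then have "a \<in> span S"
      using s(2) E(3) by (simp add: b_def)
    then have "span (insert a S) = span S"
      by (rule span_redundant)
    then show ?thesis
      using E by (intro exI[of _ E]) simp
  next
    case False
    define c where "c = (1 / sqrt (h b b)) *\<^sub>R b"
    have "h b b > 0"
      using ip_pos[OF b False] .
    have c: "c \<in> V"
      unfolding c_def using b by (rule subspace_scale[OF V])
    have cc: "h c c = 1"
    proof -
      have "h c c = (1 / sqrt (h b b)) * ((1 / sqrt (h b b)) * h b b)"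
        using ip_scale_right[OF c b, of "1 / sqrt (h b b)"] ip_scale_left[OF b b, of "1 / sqrt (h b b)"]
        unfolding c_def by simp
      also have "\<dots> = 1"
        using \<open>h b b > 0\<close> real_sqrt_mult_self[of "h b b"] by (simp add: field_simps)
      finally show ?thesis .
    qed
    have ce: "h e c = 0" "h c e = 0" if "e \<in> E" for e
    proof -
      show "h e c = 0"
        unfolding c_def using ip_scale_right[OF eV[OF that] b] orth[OF that] by simp
      then show "h c e = 0"
        using ip_commute[OF c eV[OF that]] by simp
    qed
    have "span (insert c E) = span (insert a S)"
    proof -
      have ins: "span (insert x E) = span (insert x S)" for x
        using E(3) by (simp add: span_insert)
      have mono: "s \<in> span (insert x E)" "x \<in> span (insert x E)" for x
        using s(2) span_mono[of E "insert x E"] by (auto intro: span_base)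
      have a_eq: "a = sqrt (h b b) *\<^sub>R c + s"
        using \<open>h b b > 0\<close> by (simp add: c_def b_def)
      have "a \<in> span (insert c E)"
        unfolding a_eq by (rule span_add[OF span_scale[OF mono(2)] mono(1)])
      moreover have "c \<in> span (insert a E)"
        unfolding c_def b_def by (rule span_scale[OF span_diff[OF mono(2) mono(1)]])
      ultimately have "span (insert c E) = span (insert a E)"
        unfolding span_eq using span_superset[of "insert c E"] span_superset[of "insert a E"] by simp
      then show ?thesis
        using ins by simp
    qed
    then show ?thesis
    proof (intro exI conjI ballI)
      show "finite (insert c E)" "insert c E \<subseteq> V"
        using E(1,2) c by auto
      show "h x y = (if x = y then 1 else 0)" if "x \<in> insert c E" "y \<in> insert c E" for x y
      proof (cases "x \<in> E"; cases "y \<in> E")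
        assume "x \<in> E" "y \<in> E"
        then show ?thesis
          using E(4) by blast
      next
        assume "x \<in> E" "y \<notin> E"
        then show ?thesis
          using that ce(1)[of x] by auto
      next
        assume "x \<notin> E" "y \<in> E"
        then show ?thesis
          using that ce(2)[of y] by auto
      next
        assume "x \<notin> E" "y \<notin> E"
        then show ?thesis
          using that cc by auto
      qed
    qed
  qed
qed

lemma orthonormal_basis_exists:
  assumes "finite S" "V = span S"
  shows "\<exists>E. orthonormal_basis V h E"
proof -
  have "S \<subseteq> V"
    unfolding assms(2) by (rule span_superset)
  from Gram_Schmidt_span[OF assms(1) this] show ?thesis
    unfolding orthonormal_basis_def assms(2)[symmetric] .
qed

lemma orthonormal_basis_expand:
  assumes "orthonormal_basis V h E" "v \<in> V"
  shows "v = (\<Sum>e\<in>E. h v e *\<^sub>R e)"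
proof -
  have E: "finite E" "E \<subseteq> V" "span E = V" "\<And>e f. e \<in> E \<Longrightarrow> f \<in> E \<Longrightarrow> h e f = (if e = f then 1 else 0)"
    using assms(1) by (auto simp: orthonormal_basis_def)
  obtain r where r: "v = (\<Sum>e\<in>E. r e *\<^sub>R e)"
    using assms(2) E(3) span_finite[OF E(1)] by auto
  have "h v f = r f" if "f \<in> E" for f
  proof -
    have "h v f = h f v"
      using assms(2) E(2) that by (intro ip_commute) auto
    also have "\<dots> = (\<Sum>e\<in>E. h f (r e *\<^sub>R e))"
      unfolding r using E that by (intro ip_sum_right subspace_scale[OF V]) auto
    also have "\<dots> = (\<Sum>e\<in>E. if e = f then r f else 0)"
      using E(2) that by (intro sum.cong) (auto simp: ip_scale_right subset_iff E(4))
    also have "\<dots> = r f"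
      using that E(1) by simp
    finally show ?thesis .
  qed
  then show ?thesis
    using r by simp
qed

lemma subspace_horizontal_space: "subspace (horizontal_space V h L)"
proof (rule subspaceI)
  have "h 0 w = 0" if "w \<in> V" for w
    using ip_scale_left[OF that that, of 0] by simp
  then show "0 \<in> horizontal_space V h L"
    by (simp add: horizontal_space_def subspace_0[OF V])
qed (simp_all add: horizontal_space_def subspace_add[OF V] subspace_scale[OF V] ip_add_left ip_scale_left)

end

section \<open>The dual of the tensor product with the imaginary quaternions\<close>

lemma tensor_dual_add:
  assumes "\<beta> \<in> tensor_dual V" "\<gamma> \<in> tensor_dual V"
  shows "\<beta> + \<gamma> \<in> tensor_dual V"
proof -
  have "linear ((\<beta> + \<gamma>) v)" if "v \<in> V" for v
    using linear_compose_add[of "\<beta> v" "\<gamma> v"] assms that by (simp add: tensor_dual_def plus_fun_def)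
  then show ?thesis
    using assms by (simp add: tensor_dual_def linear_map_on_def plus_fun_apply algebra_simps)
qed

lemma tensor_dual_scale:
  assumes "\<beta> \<in> tensor_dual V"
  shows "r *\<^sub>R \<beta> \<in> tensor_dual V"
proof -
  have "linear ((r *\<^sub>R \<beta>) v)" if "v \<in> V" for v
    using linear_compose_scale_right[of "\<beta> v" r] assms that by (simp add: tensor_dual_def scaleR_fun_def)
  moreover have "(r *\<^sub>R \<beta>) v = 0" if "v \<notin> V" for v
    using assms that by (simp add: tensor_dual_def scaleR_fun_def zero_fun_def)
  ultimately show ?thesis
    using assms by (simp add: tensor_dual_def linear_map_on_def scaleR_fun_def algebra_simps)
qed

lemma tensor_dual_sum:
  assumes "\<beta> \<in> tensor_dual V" "subspace V" "finite E" "E \<subseteq> V"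
  shows "\<beta> (\<Sum>e\<in>E. r e *\<^sub>R e) q = (\<Sum>e\<in>E. r e * \<beta> e q)"
  using assms(3,4)
proof (induction E rule: finite_induct)
  case empty
  have "\<beta> (0 *\<^sub>R 0) q = 0 *\<^sub>R \<beta> 0 q"
    using assms(1) subspace_0[OF assms(2)] unfolding tensor_dual_def linear_map_on_def by blast
  then show ?case
    by simp
next
  case (insert e E)
  have e: "e \<in> V" "r e *\<^sub>R e \<in> V" "(\<Sum>e\<in>E. r e *\<^sub>R e) \<in> V"
    using insert.prems by (auto intro!: subspace_sum subspace_scale assms(2))
  then have "\<beta> (r e *\<^sub>R e + (\<Sum>e\<in>E. r e *\<^sub>R e)) q = r e * \<beta> e q + \<beta> (\<Sum>e\<in>E. r e *\<^sub>R e) q"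
    using assms(1) unfolding tensor_dual_def linear_map_on_def by simp
  then show ?case
    using insert by simp
qed

lemma nth_axis_1: "axis j (1::real) $ i = (if i = j then 1 else 0)"
  by (simp add: axis_def)

lemma tensor_dual_axis_expand:
  assumes "\<beta> \<in> tensor_dual V" "v \<in> V"
  shows "\<beta> v q = (\<Sum>j\<in>UNIV. q $ j * \<beta> v (axis j 1))"
proof -
  have lin: "linear (\<beta> v)"
    using assms by (simp add: tensor_dual_def)
  have "\<beta> v q = \<beta> v (\<Sum>j\<in>UNIV. (q $ j) *\<^sub>R axis j 1)"
    using basis_expansion[of q] by (simp add: scalar_mult_eq_scaleR)
  also have "\<dots> = (\<Sum>j\<in>UNIV. q $ j * \<beta> v (axis j 1))"
    by (simp add: linear_sum[OF lin] linear_cmul[OF lin])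
  finally show ?thesis .
qed

text \<open>Linearity in the first argument reduces everything to \<open>e\<close>, linearity in the
  second to the three axes, and outside \<open>V\<close> both functions vanish by the
  normalisation.\<close>

lemma tensor_dual_eqI:
  assumes "\<beta> \<in> tensor_dual V" "\<gamma> \<in> tensor_dual V" "subspace V" "V = span {e}"
    "\<And>j. \<beta> e (axis j 1) = \<gamma> e (axis j 1)"
  shows "\<beta> = \<gamma>"
proof (intro ext)
  fix v q
  show "\<beta> v q = \<gamma> v q"
  proof (cases "v \<in> V")
    case True
    then obtain r where "v = r *\<^sub>R e"
      using assms(4) by (auto simp: span_singleton)
    moreover have "e \<in> V"
      using assms(4) by (simp add: span_base)
    ultimately show ?thesis
      using tensor_dual_sum[OF assms(1,3), of "{e}" "\<lambda>_. r" q] tensor_dual_sum[OF assms(2,3), of "{e}" "\<lambda>_. r" q]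
        tensor_dual_axis_expand[OF assms(1), of e q] tensor_dual_axis_expand[OF assms(2), of e q] assms(5)
      by simp
  next
    case False
    then show ?thesis
      using assms(1,2) by (simp add: tensor_dual_def)
  qed
qed

text \<open>The tensor that \<open>L\<close> has to hit is \<open>k v \<otimes> e\<^sub>1\<close>, dual to \<open>v \<otimes> e\<^sub>1\<close>;
  its horizontal preimage is a multiple of \<open>N v\<close>.\<close>

lemma conformal_imp_gradient_inner:
  fixes V :: "'v::real_vector set" and T :: "'w::real_vector set"
  assumes V: "subspace V" "inner_product_on V k" "finite S" "V = span S"
    and T: "subspace T" "inner_product_on T g"
    and conf: "conformal_linear_isomorphism (horizontal_space T g L) g (tensor_dual V) (tensor_dual_inner V k) L"
    and N: "\<And>v. v \<in> V \<Longrightarrow> N v \<in> T"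
    and L: "\<And>v w. v \<in> V \<Longrightarrow> w \<in> T \<Longrightarrow> L w v (axis 1 1) = g (N v) w"
  shows "\<exists>c. \<forall>v\<in>V. \<forall>w\<in>V. g (N v) (N w) = c * k v w"
proof -
  let ?H = "horizontal_space T g L"
  obtain c where "c > 0" and c: "\<And>u v. u \<in> ?H \<Longrightarrow> v \<in> ?H \<Longrightarrow> tensor_dual_inner V k (L u) (L v) = c * g u v"
    and bij: "bij_betw L ?H (tensor_dual V)"
    using conf by (auto simp: conformal_linear_isomorphism_def)
  define E where "E = (SOME E. orthonormal_basis V k E)"
  have E: "orthonormal_basis V k E"
    unfolding E_def using orthonormal_basis_exists[OF V] by (rule someI_ex)
  then have finE: "finite E" "E \<subseteq> V"
    by (auto simp: orthonormal_basis_def)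
  have HT: "u \<in> T" if "u \<in> ?H" for u
    using that by (simp add: horizontal_space_def)
  \<comment> \<open>Pairing with \<open>N v\<close> is a component of \<open>L\<close>, so it
    vanishes on the kernel of \<open>L\<close>.\<close>
  have NH: "N v \<in> ?H" if "v \<in> V" for v
    using N[OF that] L[OF that, symmetric] by (simp add: horizontal_space_def zero_fun_def)
  define \<beta> where "\<beta> v = (\<lambda>v' (q::real^3). if v' \<in> V then k v v' * (q $ 1) else 0)" for v
  have \<beta>: "\<beta> v \<in> tensor_dual V" if "v \<in> V" for v
    unfolding tensor_dual_def linear_map_on_def \<beta>_def
    using subspace_add[OF V(1)] subspace_scale[OF V(1)] that
    by (auto simp: ip_add_right[OF V(1,2)] ip_scale_right[OF V(1,2)] algebra_simps intro!: linearI)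
  \<comment> \<open>Pairing with \<open>\<beta> v\<close> is evaluation at \<open>v\<close> and the
    first axis: the other axes drop out, and the sum over \<open>E\<close> reassembles
    \<open>v\<close> from its orthonormal expansion.\<close>
  have inner: "tensor_dual_inner V k (L u) (\<beta> v) = L u v (axis 1 1)" if "u \<in> ?H" "v \<in> V" for u v
  proof -
    have Lu: "L u \<in> tensor_dual V"
      using bij that(1) by (auto simp: bij_betw_def)
    have "(\<Sum>j\<in>UNIV. L u e (axis j 1) * \<beta> v e (axis j 1)) = (\<Sum>j\<in>(UNIV::3 set). if j = 1 then k v e * L u e (axis 1 1) else 0)"
      if "e \<in> E" for e
      by (rule sum.cong[OF refl]) (use finE that in \<open>auto simp: \<beta>_def nth_axis_1\<close>)
    then have "tensor_dual_inner V k (L u) (\<beta> v) = (\<Sum>e\<in>E. \<Sum>j\<in>(UNIV::3 set). if j = 1 then k v e * L u e (axis 1 1) else 0)"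
      unfolding tensor_dual_inner_def Let_def E_def[symmetric] by (rule sum.cong[OF refl])
    also have "\<dots> = (\<Sum>e\<in>E. k v e * L u e (axis 1 1))"
      by simp
    also have "\<dots> = L u (\<Sum>e\<in>E. k v e *\<^sub>R e) (axis 1 1)"
      by (rule tensor_dual_sum[OF Lu V(1) finE, symmetric])
    also have "\<dots> = L u v (axis 1 1)"
      using orthonormal_basis_expand[OF V(1,2) E that(2)] by simp
    finally show ?thesis .
  qed
  have "g (N v) (N w) = c * k v w" if v: "v \<in> V" and w: "w \<in> V" for v w
  proof -
    have "\<beta> w \<in> L ` ?H"
      using bij \<beta>[OF w] by (simp add: bij_betw_def)
    \<comment> \<open>Surjectivity of \<open>L\<close> onto the whole dual enters here.\<close>
    then obtain u where u: "u \<in> ?H" "L u = \<beta> w"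
      by force
    \<comment> \<open>\<open>N w\<close> and \<open>c\<close> times \<open>u\<close> have the same
      pairings with horizontal vectors. This is then applied to \<open>N v\<close>, which is
      horizontal itself.\<close>
    have "g (N w) x = g (c *\<^sub>R u) x" if "x \<in> ?H" for x
    proof -
      have "g (N w) x = L x w (axis 1 1)"
        using L[OF w HT[OF that]] by simp
      also have "\<dots> = tensor_dual_inner V k (L x) (L u)"
        using inner[OF that w] u by simp
      also have "\<dots> = c * g x u"
        by (rule c[OF that u(1)])
      also have "\<dots> = g (c *\<^sub>R u) x"
        using HT[OF that] HT[OF u(1)] by (simp add: ip_scale_left[OF T] ip_commute[OF T])
      finally show ?thesis .
    qed
    note eq = this
    have "g (N v) (N w) = g (N w) (N v)"
      using N v w by (simp add: ip_commute[OF T])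
    also have "\<dots> = g (c *\<^sub>R u) (N v)"
      by (rule eq[OF NH[OF v]])
    also have "\<dots> = c * g (N v) u"
      using HT[OF u(1)] N[OF v] by (simp add: ip_scale_left[OF T] ip_commute[OF T])
    also have "\<dots> = c * \<beta> w v (axis 1 1)"
      using L[OF v HT[OF u(1)]] u(2) by simp
    also have "\<dots> = c * k v w"
      using v w by (simp add: \<beta>_def axis_def ip_commute[OF V(1,2)])
    finally show ?thesis .
  qed
  then show ?thesis
    by blast
qed

text \<open>\<open>tensor_dual_inner\<close> is computed with a basis picked by \<open>SOME\<close>;
  on a line whatever is picked has to be a singleton.\<close>

lemma orthonormal_basis_of_line:
  assumes V: "subspace V" "inner_product_on V k" and "V = span {v0}" "v0 \<noteq> 0"
    and E: "orthonormal_basis V k E"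
  obtains e where "E = {e}"
proof -
  have on: "\<And>e f. e \<in> E \<Longrightarrow> f \<in> E \<Longrightarrow> k e f = (if e = f then 1 else 0)" and sp: "span E = V" "E \<subseteq> V"
    using E by (auto simp: orthonormal_basis_def)
  have v0: "v0 \<in> V"
    using assms(3) by (simp add: span_base)
  then have "E \<noteq> {}"
    using sp assms(4) by auto
  moreover have "e = f" if "e \<in> E" "f \<in> E" for e f
  proof (rule ccontr)
    assume "e \<noteq> f"
    have "e \<in> range (\<lambda>a. a *\<^sub>R v0)" "f \<in> range (\<lambda>a. a *\<^sub>R v0)"
      using that sp(2) by (auto simp: assms(3) span_singleton)
    then obtain a b where ab: "e = a *\<^sub>R v0" "f = b *\<^sub>R v0"
      by blast
    \<comment> \<open>Orthogonality of \<open>e\<close> and \<open>f\<close> would make one of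
      \<open>a\<close>, \<open>b\<close>, \<open>k v0 v0\<close> zero, whereas the unit lengths make
      all of them nonzero.\<close>
    have "k e f = a * b * k v0 v0" "k e e = a * a * k v0 v0" "k f f = b * b * k v0 v0"
      unfolding ab using v0 by (simp_all add: ip_scale_left[OF V] ip_scale_right[OF V] subspace_scale[OF V(1)])
    then show False
      using on that \<open>e \<noteq> f\<close> by auto
  qed
  ultimately show ?thesis
    using that by blast
qed

text \<open>The three gradients \<open>N j\<close> are orthogonal with common squared length
  \<open>c\<close>, and they span the horizontal space. There \<open>L\<close> just lists the
  pairings with them, so it is bijective and multiplies inner products by \<open>c\<close>.\<close>

lemma orthogonal_gradients_imp_conformal:
  fixes V :: "'v::real_vector set" and T :: "'w::real_vector set" and N :: "3 \<Rightarrow> 'w"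
  assumes V: "subspace V" "inner_product_on V k" "V = span {e}" "(SOME E. orthonormal_basis V k E) = {e}"
    and T: "subspace T" "inner_product_on T g"
    and Ltd: "\<And>w. w \<in> T \<Longrightarrow> L w \<in> tensor_dual V"
    and NT: "\<And>j. N j \<in> T"
    and NN: "\<And>i j. g (N i) (N j) = (if i = j then c else 0)" "c > 0"
    and L: "\<And>w j. w \<in> T \<Longrightarrow> L w e (axis j 1) = g (N j) w"
  shows "conformal_linear_isomorphism (horizontal_space T g L) g (tensor_dual V) (tensor_dual_inner V k) L"
proof -
  let ?H = "horizontal_space T g L"
  have HT: "u \<in> T" if "u \<in> ?H" for u
    using that by (simp add: horizontal_space_def)
  have subH: "subspace ?H"
    by (rule subspace_horizontal_space[OF T])
  have NH: "N j \<in> ?H" for j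
    using NT L[of _ j, symmetric] by (simp add: horizontal_space_def zero_fun_def)
  have eqI: "L w = \<beta>" if "w \<in> T" "\<beta> \<in> tensor_dual V" "\<And>j. g (N j) w = \<beta> e (axis j 1)" for w \<beta>
    using tensor_dual_eqI[OF Ltd[OF that(1)] that(2) V(1,3)] L that by simp
  \<comment> \<open>The horizontal vector with prescribed pairings \<open>r j\<close> with the
    gradients; division by \<open>c\<close> compensates for their squared length.\<close>
  define U where "U r = (\<Sum>j\<in>UNIV. (r j / c) *\<^sub>R N j)" for r
  have UH: "U r \<in> ?H" for r
    unfolding U_def by (intro subspace_sum[OF subH] subspace_scale[OF subH] NH)
  have gU: "g (N j) (U r) = r j" for j r
  proof -
    have "g (N j) (U r) = (\<Sum>i\<in>UNIV. r i / c * g (N j) (N i))"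
      unfolding U_def by (subst ip_sum_right[OF T])
        (auto simp: NT ip_scale_right[OF T] subspace_scale[OF T(1)])
    also have "\<dots> = (\<Sum>i\<in>UNIV. if j = i then r i else 0)"
      using NN(2) by (intro sum.cong) (auto simp: NN(1))
    also have "\<dots> = r j"
      by simp
    finally show ?thesis .
  qed
  \<comment> \<open>The difference of the two sides is horizontal and lies in the kernel of
    \<open>L\<close>, hence is orthogonal to itself.\<close>
  have U: "u = U (\<lambda>j. g (N j) u)" if "u \<in> ?H" for u
  proof -
    let ?d = "u - U (\<lambda>j. g (N j) u)"
    have d: "?d \<in> ?H"
      using that UH by (rule subspace_diff[OF subH])
    have "L ?d = 0"
    proof (rule eqI)
      show "?d \<in> T"
        by (rule HT[OF d])
      show "0 \<in> tensor_dual V"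
        using tensor_dual_scale[OF Ltd[OF subspace_0[OF T(1)]], of 0] by simp
      show "g (N j) ?d = 0 e (axis j 1)" for j
        using gU[of j] by (simp add: ip_diff_right[OF T NT HT[OF that] HT[OF UH]])
    qed
    then have "g ?d ?d = 0"
      using d HT[OF d] by (simp add: horizontal_space_def)
    then show ?thesis
      using ip_eq_0_iff[OF T HT[OF d]] by simp
  qed
  have gg: "g u v = (\<Sum>j\<in>UNIV. g (N j) u * g (N j) v) / c" if "u \<in> ?H" "v \<in> ?H" for u v
  proof -
    have "g u v = g v u"
      using that HT by (simp add: ip_commute[OF T])
    also have "\<dots> = g v (\<Sum>j\<in>UNIV. (g (N j) u / c) *\<^sub>R N j)"
      using U[OF that(1)] unfolding U_def by simp
    also have "\<dots> = (\<Sum>j\<in>UNIV. g v ((g (N j) u / c) *\<^sub>R N j))"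
      using HT[OF that(2)] NT by (intro ip_sum_right[OF T] subspace_scale[OF T(1)]) auto
    also have "\<dots> = (\<Sum>j\<in>UNIV. g (N j) u * g (N j) v) / c"
      using HT[OF that(2)] NT
      by (simp add: ip_scale_right[OF T] ip_commute[OF T HT[OF that(2)] NT] sum_divide_distrib)
    finally show ?thesis .
  qed
  have conf: "tensor_dual_inner V k (L u) (L v) = c * g u v" if "u \<in> ?H" "v \<in> ?H" for u v
    unfolding tensor_dual_inner_def Let_def V(4) gg[OF that]
    using NN(2) L HT that by simp
  have "linear_map_on ?H L"
    unfolding linear_map_on_def
  proof (intro conjI ballI allI)
    fix u v r
    assume u: "u \<in> ?H" 
    show "L (r *\<^sub>R u) = r *\<^sub>R L u"
      using HT[OF u] by (intro eqI subspace_scale[OF T(1)] tensor_dual_scale Ltd)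
        (simp_all add: ip_scale_right[OF T] NT L scaleR_fun_def)
    assume v: "v \<in> ?H" 
    show "L (u + v) = L u + L v"
      using HT[OF u] HT[OF v] by (intro eqI subspace_add[OF T(1)] tensor_dual_add Ltd)
        (simp_all add: ip_add_right[OF T] NT L plus_fun_def)
  qed
  moreover have "bij_betw L ?H (tensor_dual V)"
    unfolding bij_betw_def
  proof
    show "inj_on L ?H"
    proof (rule inj_onI)
      fix u v
      assume "u \<in> ?H" "v \<in> ?H" "L u = L v"
      then have "g (N j) u = g (N j) v" for j
        using L HT by metis
      then show "u = v"
        using U[OF \<open>u \<in> ?H\<close>] U[OF \<open>v \<in> ?H\<close>] by simp
    qed
    have "\<beta> \<in> L ` ?H" if "\<beta> \<in> tensor_dual V" for \<beta>
      using eqI[OF HT[OF UH] that gU] UH by (metis imageI)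
    then show "L ` ?H = tensor_dual V"
      using Ltd HT by blast
  qed
  ultimately show ?thesis
    using conf NN(2) by (auto simp: conformal_linear_isomorphism_def)
qed

text \<open>Each \<open>I j\<close> is isometric with square minus the identity, so
  \<open>I j v\<close> is orthogonal to \<open>v\<close>. Applying or removing a common factor
  \<open>I 1\<close> or \<open>I 2\<close> reduces the mixed products to this case by the quaternion
  relations.\<close>

lemma quaternionic_orthogonal:
  fixes I :: "3 \<Rightarrow> 'w::real_vector \<Rightarrow> 'w"
  assumes T: "subspace T" "inner_product_on T g"
    and IT: "\<And>j v. v \<in> T \<Longrightarrow> I j v \<in> T"
    and sq: "\<And>j v. v \<in> T \<Longrightarrow> I j (I j v) = - v"
    and iso: "\<And>j v w. v \<in> T \<Longrightarrow> w \<in> T \<Longrightarrow> g (I j v) (I j w) = g v w"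
    and quat: "\<And>v. v \<in> T \<Longrightarrow> I 1 (I 2 v) = I 3 v" "\<And>v. v \<in> T \<Longrightarrow> I 2 (I 1 v) = - I 3 v"
    and v: "v \<in> T"
  shows "g (I i v) (I j v) = (if i = j then g v v else 0)"
proof -
  have skew: "g v (I j v) = 0" for j
  proof -
    have "g v (I j v) = g (I j v) (- v)"
      using iso[OF v IT[OF v, of j], of j] sq[OF v, of j] by simp
    also have "\<dots> = - g v (I j v)"
      using ip_minus_right[OF T IT[OF v, of j] v] ip_commute[OF T v IT[OF v, of j]] by simp
    finally show ?thesis
      by simp
  qed
  have "g (I 1 v) (I 2 v) = g (- v) (I 3 v)"
    using iso[OF IT[OF v, of 1] IT[OF v, of 2], of 1] sq[OF v, of 1] quat(1)[OF v] by simp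
  then have 12: "g (I 1 v) (I 2 v) = 0"
    using skew[of 3] ip_minus_left[OF T IT[OF v, of 3] v] by simp
  have 13: "g (I 1 v) (I 3 v) = 0"
    using iso[OF v IT[OF v, of 2], of 1] quat(1)[OF v] skew[of 2] by simp
  have "g (I 2 v) (- I 3 v) = 0"
    using iso[OF v IT[OF v, of 1], of 2] quat(2)[OF v] skew[of 1] by simp
  then have 23: "g (I 2 v) (I 3 v) = 0"
    using ip_minus_right[OF T IT[OF v, of 2] IT[OF v, of 3]] by simp
  have comm: "g (I i v) (I j v) = g (I j v) (I i v)" for i j
    by (rule ip_commute[OF T IT[OF v] IT[OF v]])
  have "g (I 2 v) (I 1 v) = 0" "g (I 3 v) (I 1 v) = 0" "g (I 3 v) (I 2 v) = 0"
    using 12 13 23 comm[of 1 2] comm[of 1 3] comm[of 2 3] by simp_all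
  moreover have "i = 1 \<or> i = 2 \<or> i = 3" "j = 1 \<or> j = 2 \<or> j = 3"
    by (rule exhaust_3)+
  ultimately show ?thesis
    using 12 13 23 iso[OF v v] by (elim disjE) simp_all
qed

section \<open>Charts and tangent vectors\<close>

lemma is_chart_inj_on: "is_chart c \<Longrightarrow> inj_on (snd c) (fst c)"
  unfolding is_chart_def homeomorphism_def by (metis inj_on_inverseI)

lemma chart_inv_chart: "is_chart c \<Longrightarrow> x \<in> fst c \<Longrightarrow> chart_inv c (snd c x) = x"
  by (simp add: is_chart_inj_on)

lemma chart_chart_inv: "y \<in> chart_image c \<Longrightarrow> snd c (chart_inv c y) = y"
  by (rule f_inv_into_f)

lemma chart_inv_mem: "y \<in> chart_image c \<Longrightarrow> chart_inv c y \<in> fst c"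
  by (rule inv_into_into)

lemma open_chart_image: "is_chart c \<Longrightarrow> open (chart_image c)"
  by (simp add: is_chart_def)

lemma chart_image_Int:
  "is_chart c \<Longrightarrow> snd c ` (fst c \<inter> U) = {y \<in> chart_image c. chart_inv c y \<in> U}"
proof -
  assume c: "is_chart c"
  show ?thesis
  proof (intro equalityI subsetI)
    fix y
    assume "y \<in> {y \<in> chart_image c. chart_inv c y \<in> U}"
    then have "y = snd c (chart_inv c y)" "chart_inv c y \<in> fst c \<inter> U"
      using chart_chart_inv[of y c] chart_inv_mem[of y c] by simp_all
    then show "y \<in> snd c ` (fst c \<inter> U)"
      by (rule image_eqI)
  qed (use chart_inv_chart[OF c] in auto)
qed

lemma open_chart_image_Int:
  assumes "is_chart c" "open U"
  shows "open (snd c ` (fst c \<inter> U))"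
proof -
  have "continuous_on (chart_image c) (chart_inv c)"
    using assms(1) by (simp add: is_chart_def homeomorphism_def)
  then have "open (chart_image c \<inter> chart_inv c -` U)"
    using open_chart_image[OF assms(1)] assms(2) continuous_open_preimage by blast
  moreover have "chart_image c \<inter> chart_inv c -` U = snd c ` (fst c \<inter> U)"
    unfolding chart_image_Int[OF assms(1)] by blast
  ultimately show ?thesis
    by simp
qed

lemma chart_at_mem: "smooth_atlas A \<Longrightarrow> chart_at A x \<in> A \<and> x \<in> fst (chart_at A x)"
proof -
  assume "smooth_atlas A"
  then have "x \<in> (\<Union>c\<in>A. fst c)"
    by (simp add: smooth_atlas_def)
  then have "\<exists>c. c \<in> A \<and> x \<in> fst c"
    by blast
  then show ?thesis
    unfolding chart_at_def by (rule someI_ex)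
qed

context
  fixes A :: "('a::topological_space, 'e::euclidean_space) chart set"
  assumes A: "smooth_atlas A"
begin

lemma atlas_chart: "c \<in> A \<Longrightarrow> is_chart c"
  using A by (auto simp: smooth_atlas_def)

lemma open_domain: "c \<in> A \<Longrightarrow> open (fst c)"
  using atlas_chart is_chart_def by blast

lemma transition_has_derivative:
  assumes "c \<in> A" "d \<in> A" "x \<in> fst c" "x \<in> fst d"
  shows "((snd d \<circ> chart_inv c) has_derivative frechet_derivative (snd d \<circ> chart_inv c) (at (snd c x)))
    (at (snd c x))"
proof (rule smooth_on_has_derivative)
  show "smooth_on (snd c ` (fst c \<inter> fst d)) (snd d \<circ> chart_inv c)"
    using A assms by (auto simp: smooth_atlas_def compatible_charts_def)
qed (use assms in auto)

text \<open>The chain rule with the transition map, whose composite agrees with the expression in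
  \<open>c\<close> over the overlap of the two domains. It underlies the independence of
  differentials from the chart picked by \<open>chart_at\<close>.\<close>

lemma has_derivative_change_chart:
  assumes c: "c \<in> A" "x \<in> fst c" and d: "d \<in> A" "x \<in> fst d"
    and f: "(f \<circ> chart_inv d) differentiable at (snd d x)"
  shows "((f \<circ> chart_inv c) has_derivative (\<lambda>u. frechet_derivative (f \<circ> chart_inv d) (at (snd d x))
    (frechet_derivative (snd d \<circ> chart_inv c) (at (snd c x)) u))) (at (snd c x))"
proof -
  have "(f \<circ> chart_inv d has_derivative frechet_derivative (f \<circ> chart_inv d) (at (snd d x)))
      (at ((snd d \<circ> chart_inv c) (snd c x)))"
    using has_frechet_derivative[OF f] by (simp add: chart_inv_chart atlas_chart c)
  from diff_chain_at[OF transition_has_derivative[OF c(1) d(1) c(2) d(2)] this]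
  have *: "((f \<circ> chart_inv d) \<circ> (snd d \<circ> chart_inv c) has_derivative
      (\<lambda>u. frechet_derivative (f \<circ> chart_inv d) (at (snd d x))
    (frechet_derivative (snd d \<circ> chart_inv c) (at (snd c x)) u))) (at (snd c x))"
    by (simp add: o_def)
  show ?thesis
  proof (rule has_derivative_transform_within_open[OF *])
    show "open (snd c ` (fst c \<inter> fst d))"
      using open_chart_image_Int atlas_chart c d open_domain by blast
    show "snd c x \<in> snd c ` (fst c \<inter> fst d)"
      using c d by blast
    show "((f \<circ> chart_inv d) \<circ> (snd d \<circ> chart_inv c)) y = (f \<circ> chart_inv c) y"
      if "y \<in> snd c ` (fst c \<inter> fst d)" for y
      using that c d by (auto simp: chart_inv_chart atlas_chart)
  qed
qed

lemma frechet_derivative_change_chart: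
  assumes "c \<in> A" "x \<in> fst c" "d \<in> A" "x \<in> fst d" "v \<in> tangent_space A x"
    and "(f \<circ> chart_inv d) differentiable at (snd d x)"
  shows "frechet_derivative (f \<circ> chart_inv c) (at (snd c x)) (v c) =
         frechet_derivative (f \<circ> chart_inv d) (at (snd d x)) (v d)"
proof -
  have "v d = frechet_derivative (snd d \<circ> chart_inv c) (at (snd c x)) (v c)"
    using assms unfolding tangent_space_def by blast
  then show ?thesis
    using frechet_derivative_eqI[OF has_derivative_change_chart[OF assms(1-4,6)]] by simp
qed

lemma tangent_map_apply:
  assumes "c \<in> A" "x \<in> fst c" "d \<in> B" "f x \<in> fst d" "v \<in> tangent_space A x"
    and "(snd d \<circ> f \<circ> chart_inv c) differentiable at (snd c x)"
  shows "tangent_map A B f x v d = frechet_derivative (snd d \<circ> f \<circ> chart_inv c) (at (snd c x)) (v c)"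
proof -
  have "frechet_derivative (snd d \<circ> f \<circ> chart_inv (chart_at A x)) (at (snd (chart_at A x) x)) (v (chart_at A x)) =
      frechet_derivative (snd d \<circ> f \<circ> chart_inv c) (at (snd c x)) (v c)"
    by (rule frechet_derivative_change_chart[OF conjunct1[OF chart_at_mem[OF A]]
          conjunct2[OF chart_at_mem[OF A]] assms(1,2,5,6)])
  then show ?thesis
    unfolding tangent_map_def Let_def using assms(3,4) by simp
qed

lemma tangent_vec_change_chart:
  "v \<in> tangent_space A x \<Longrightarrow> c \<in> A \<Longrightarrow> d \<in> A \<Longrightarrow> x \<in> fst c \<Longrightarrow> x \<in> fst d \<Longrightarrow>
    v d = frechet_derivative (snd d \<circ> chart_inv c) (at (snd c x)) (v c)"
  unfolding tangent_space_def by blast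

lemma tangent_spaceI:
  assumes "\<And>c d. c \<in> A \<Longrightarrow> d \<in> A \<Longrightarrow> x \<in> fst c \<Longrightarrow> x \<in> fst d \<Longrightarrow>
      v d = frechet_derivative (snd d \<circ> chart_inv c) (at (snd c x)) (v c)"
    and "\<And>c. c \<notin> A \<or> x \<notin> fst c \<Longrightarrow> v c = 0"
  shows "v \<in> tangent_space A x"
  unfolding tangent_space_def mem_Collect_eq using assms by blast

lemma tangent_vec_eq_0: "v \<in> tangent_space A x \<Longrightarrow> c \<notin> A \<or> x \<notin> fst c \<Longrightarrow> v c = 0"
  unfolding tangent_space_def by blast

lemma coord_vec_mem:
  assumes "c \<in> A" "x \<in> fst c"
  shows "coord_vec A c x u \<in> tangent_space A x"
proof -
  show ?thesis
  proof (rule tangent_spaceI)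
    fix d e
    assume de: "d \<in> A" "e \<in> A" "x \<in> fst d" "x \<in> fst e"
    show "coord_vec A c x u e = frechet_derivative (snd e \<circ> chart_inv d) (at (snd d x)) (coord_vec A c x u d)"
      using de by (simp add: coord_vec_def frechet_derivative_eqI[OF has_derivative_change_chart[OF assms de(1,3)
            differentiableI[OF transition_has_derivative[OF de]]]])
  qed (auto simp: coord_vec_def)
qed

lemma coord_vec_apply:
  assumes "c \<in> A" "x \<in> fst c"
  shows "coord_vec A c x u c = u"
proof -
  have "((snd c \<circ> chart_inv c) has_derivative (\<lambda>h. h)) (at (snd c x))"
    by (rule has_derivative_transform_within_open[OF has_derivative_ident open_chart_image[OF atlas_chart[OF assms(1)]]])
      (use assms in \<open>auto simp: chart_chart_inv\<close>)
  then show ?thesis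
    using assms by (simp add: coord_vec_def frechet_derivative_eqI)
qed

lemma tangent_vec_eqI:
  assumes "c \<in> A" "x \<in> fst c" "v \<in> tangent_space A x" "w \<in> tangent_space A x" "v c = w c"
  shows "v = w"
proof
  fix d
  show "v d = w d"
  proof (cases "d \<in> A \<and> x \<in> fst d")
    case True
    then show ?thesis
      using tangent_vec_change_chart[OF assms(3,1) _ assms(2), of d]
        tangent_vec_change_chart[OF assms(4,1) _ assms(2), of d] assms(5) by simp
  next
    case False
    then show ?thesis
      using tangent_vec_eq_0[OF assms(3)] tangent_vec_eq_0[OF assms(4)] by auto
  qed
qed

lemma coord_vec_chart:
  assumes "c \<in> A" "x \<in> fst c" "v \<in> tangent_space A x"
  shows "coord_vec A c x (v c) = v"
  by (rule tangent_vec_eqI[OF assms(1,2) coord_vec_mem[OF assms(1,2)] assms(3) coord_vec_apply[OF assms(1,2)]])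

lemma subspace_tangent_space: "subspace (tangent_space A x)"
proof -
  have lin: "linear (frechet_derivative (snd d \<circ> chart_inv c) (at (snd c x)))"
    if "c \<in> A" "d \<in> A" "x \<in> fst c" "x \<in> fst d" for c d
    by (rule has_derivative_linear[OF transition_has_derivative[OF that]])
  show ?thesis
  proof (rule subspaceI)
    show "0 \<in> tangent_space A x"
      by (rule tangent_spaceI) (simp_all add: zero_fun_def linear_0[OF lin])
    show "v + w \<in> tangent_space A x" if v: "v \<in> tangent_space A x" and w: "w \<in> tangent_space A x" for v w
    proof (rule tangent_spaceI)
      fix c d
      assume cd: "c \<in> A" "d \<in> A" "x \<in> fst c" "x \<in> fst d"
      show "(v + w) d = frechet_derivative (snd d \<circ> chart_inv c) (at (snd c x)) ((v + w) c)"
        using tangent_vec_change_chart[OF v cd] tangent_vec_change_chart[OF w cd]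
        by (simp add: plus_fun_def linear_add[OF lin[OF cd]])
    qed (simp add: plus_fun_def tangent_vec_eq_0[OF v] tangent_vec_eq_0[OF w])
    show "r *\<^sub>R v \<in> tangent_space A x" if v: "v \<in> tangent_space A x" for r v
    proof (rule tangent_spaceI)
      fix c d
      assume cd: "c \<in> A" "d \<in> A" "x \<in> fst c" "x \<in> fst d"
      show "(r *\<^sub>R v) d = frechet_derivative (snd d \<circ> chart_inv c) (at (snd c x)) ((r *\<^sub>R v) c)"
        using tangent_vec_change_chart[OF v cd]
        by (simp add: scaleR_fun_def linear_cmul[OF lin[OF cd]])
    qed (simp add: scaleR_fun_def tangent_vec_eq_0[OF v])
  qed
qed

lemma linear_coord_vec:
  assumes "c \<in> A" "x \<in> fst c"
  shows "linear (coord_vec A c x)"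
proof (rule linearI)
  show "coord_vec A c x (u + w) = coord_vec A c x u + coord_vec A c x w" for u w
    by (rule tangent_vec_eqI[OF assms coord_vec_mem[OF assms]
          subspace_add[OF subspace_tangent_space coord_vec_mem[OF assms] coord_vec_mem[OF assms]]])
      (simp add: plus_fun_def coord_vec_apply[OF assms])
  show "coord_vec A c x (r *\<^sub>R u) = r *\<^sub>R coord_vec A c x u" for r u
    by (rule tangent_vec_eqI[OF assms coord_vec_mem[OF assms]
          subspace_scale[OF subspace_tangent_space coord_vec_mem[OF assms]]])
      (simp add: scaleR_fun_def coord_vec_apply[OF assms])
qed

text \<open>Provides the finite spanning set that Gram-Schmidt starts from.\<close>

lemma tangent_space_eq_span:
  assumes "c \<in> A" "x \<in> fst c"
  shows "tangent_space A x = span (coord_vec A c x ` Basis)"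
proof -
  have "span (coord_vec A c x ` Basis) = range (coord_vec A c x)"
    using linear_span_image[OF linear_coord_vec[OF assms], of Basis] by simp
  also have "\<dots> = tangent_space A x"
    using coord_vec_mem[OF assms] coord_vec_chart[OF assms, symmetric] by blast
  finally show ?thesis ..
qed

lemma tensor2_in_chart_eq:
  assumes "c \<in> A" "x \<in> fst c" "v \<in> tangent_space A x" "w \<in> tangent_space A x"
  shows "tensor2_in_chart A h c (v c) (w c) (snd c x) = h x v w"
  using assms by (simp add: tensor2_in_chart_def chart_inv_chart atlas_chart coord_vec_chart)

text \<open>What the rigidity lemma and the expansion at a fixed point require of the metric, for
  its expression in one chart.\<close>

lemma metric_in_chart:
  assumes g: "riemannian_metric A g" and c: "c \<in> A"
  shows "smooth_on (chart_image c) (\<lambda>y. tensor2_in_chart A g c u w y)"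
    and "y \<in> chart_image c \<Longrightarrow> bilinear (\<lambda>u w. tensor2_in_chart A g c u w y)"
    and "y \<in> chart_image c \<Longrightarrow> tensor2_in_chart A g c u w y = tensor2_in_chart A g c w u y"
    and "y \<in> chart_image c \<Longrightarrow> u \<noteq> 0 \<Longrightarrow> 0 < tensor2_in_chart A g c u u y"
proof -
  show "smooth_on (chart_image c) (\<lambda>y. tensor2_in_chart A g c u w y)"
    using assms by (simp add: riemannian_metric_def)
  assume y: "y \<in> chart_image c"
  let ?x = "chart_inv c y"
  have x: "?x \<in> fst c"
    by (rule chart_inv_mem[OF y])
  have T: "subspace (tangent_space A ?x)" "inner_product_on (tangent_space A ?x) (g ?x)"
    using subspace_tangent_space g by (auto simp: riemannian_metric_def)
  note mem = coord_vec_mem[OF c x] and lin = linear_coord_vec[OF c x]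
  show "bilinear (\<lambda>u w. tensor2_in_chart A g c u w y)"
    unfolding bilinear_def tensor2_in_chart_def
    by (auto intro!: linearI simp: linear_add[OF lin] linear_cmul[OF lin] mem
        ip_add_left[OF T] ip_add_right[OF T] ip_scale_left[OF T] ip_scale_right[OF T])
  show "tensor2_in_chart A g c u w y = tensor2_in_chart A g c w u y"
    unfolding tensor2_in_chart_def by (rule ip_commute[OF T mem mem])
  assume "u \<noteq> 0"
  then have "coord_vec A c ?x u \<noteq> 0"
    using coord_vec_apply[OF c x, of u] by (auto simp: zero_fun_def)
  then show "0 < tensor2_in_chart A g c u u y"
    unfolding tensor2_in_chart_def by (rule ip_pos[OF T mem])
qed

end

text \<open>Differentiability is assumed at \<open>x\<close> alone instead of smoothness of
  \<open>f\<close>, so that the lemma applies to orbit maps at the unit as well as to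
  isometries.\<close>

lemma tangent_map_mem:
  fixes A :: "('a::topological_space, 'e::euclidean_space) chart set"
    and B :: "('b::topological_space, 'f::euclidean_space) chart set"
  assumes A: "smooth_atlas A" and B: "smooth_atlas B" and f: "continuous_on UNIV f"
    and dif: "\<And>c d. c \<in> A \<Longrightarrow> d \<in> B \<Longrightarrow> x \<in> fst c \<Longrightarrow> f x \<in> fst d \<Longrightarrow>
      (snd d \<circ> f \<circ> chart_inv c) differentiable at (snd c x)"
  shows "tangent_map A B f x v \<in> tangent_space B (f x)"
proof -
  define c where "c = chart_at A x"
  have c: "c \<in> A" "x \<in> fst c"
    using chart_at_mem[OF A] by (auto simp: c_def)
  have "frechet_derivative (snd e \<circ> f \<circ> chart_inv c) (at (snd c x)) u =
      frechet_derivative (snd e \<circ> chart_inv d) (at (snd d (f x)))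
        (frechet_derivative (snd d \<circ> f \<circ> chart_inv c) (at (snd c x)) u)"
    if de: "d \<in> B" "e \<in> B" "f x \<in> fst d" "f x \<in> fst e" for d e u
  proof -
    have "((snd e \<circ> chart_inv d) has_derivative frechet_derivative (snd e \<circ> chart_inv d) (at (snd d (f x))))
        (at ((snd d \<circ> f \<circ> chart_inv c) (snd c x)))"
      using transition_has_derivative[OF B de] by (simp add: chart_inv_chart atlas_chart[OF A] c)
    from diff_chain_at[OF has_frechet_derivative[OF dif[OF c(1) de(1) c(2) de(3)]] this]
    have *: "((snd e \<circ> chart_inv d) \<circ> (snd d \<circ> f \<circ> chart_inv c) has_derivative
      (\<lambda>u. frechet_derivative (snd e \<circ> chart_inv d) (at (snd d (f x)))
        (frechet_derivative (snd d \<circ> f \<circ> chart_inv c) (at (snd c x)) u))) (at (snd c x))"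
      by (simp add: o_def)
    have "(snd e \<circ> f \<circ> chart_inv c has_derivative
      (\<lambda>u. frechet_derivative (snd e \<circ> chart_inv d) (at (snd d (f x)))
        (frechet_derivative (snd d \<circ> f \<circ> chart_inv c) (at (snd c x)) u))) (at (snd c x))"
    proof (rule has_derivative_transform_within_open[OF *])
      show "open (snd c ` (fst c \<inter> f -` fst d))"
        using f open_domain[OF B de(1)]
        by (intro open_chart_image_Int[OF atlas_chart[OF A c(1)]] open_vimage)
      show "snd c x \<in> snd c ` (fst c \<inter> f -` fst d)"
        using c de by blast
      show "((snd e \<circ> chart_inv d) \<circ> (snd d \<circ> f \<circ> chart_inv c)) y = (snd e \<circ> f \<circ> chart_inv c) y"
        if "y \<in> snd c ` (fst c \<inter> f -` fst d)" for y
        using that c de by (auto simp: chart_inv_chart atlas_chart[OF A] atlas_chart[OF B])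
    qed
    then show ?thesis
      by (simp add: frechet_derivative_eqI)
  qed
  note chain = this
  show ?thesis
  proof (rule tangent_spaceI[OF B])
    fix d e
    assume de: "d \<in> B" "e \<in> B" "f x \<in> fst d" "f x \<in> fst e"
    show "tangent_map A B f x v e = frechet_derivative (snd e \<circ> chart_inv d) (at (snd d (f x))) (tangent_map A B f x v d)"
      using de unfolding tangent_map_def Let_def c_def[symmetric] by (simp add: chain[OF de])
  qed (auto simp: tangent_map_def Let_def)
qed

section \<open>Smooth maps in charts and on products\<close>

lemma smooth_map_differentiable:
  assumes "smooth_map A B f" "c \<in> A" "d \<in> B" "x \<in> fst c" "f x \<in> fst d"
  shows "(snd d \<circ> f \<circ> chart_inv c) differentiable at (snd c x)"
proof (rule smooth_on_imp_differentiable)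
  show "smooth_on (snd c ` (fst c \<inter> f -` fst d)) (snd d \<circ> f \<circ> chart_inv c)"
    using assms(1-3) unfolding smooth_map_def by blast
  show "snd c x \<in> snd c ` (fst c \<inter> f -` fst d)"
    using assms(4,5) by blast
qed

lemma chart_inv_product:
  assumes "is_chart b" "is_chart c" "\<sigma> \<in> chart_image b" "y \<in> chart_image c"
  shows "chart_inv (fst b \<times> fst c, map_prod (snd b) (snd c)) (\<sigma>, y) = (chart_inv b \<sigma>, chart_inv c y)"
proof -
  have "inj_on (map_prod (snd b) (snd c)) (fst b \<times> fst c)"
    by (rule map_prod_inj_on[OF is_chart_inj_on[OF assms(1)] is_chart_inj_on[OF assms(2)]])
  moreover have "(chart_inv b \<sigma>, chart_inv c y) \<in> fst b \<times> fst c"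
    using chart_inv_mem[OF assms(3)] chart_inv_mem[OF assms(4)] by simp
  moreover have "map_prod (snd b) (snd c) (chart_inv b \<sigma>, chart_inv c y) = (\<sigma>, y)"
    using chart_chart_inv[OF assms(3)] chart_chart_inv[OF assms(4)] by simp
  ultimately have "inv_into (fst b \<times> fst c) (map_prod (snd b) (snd c)) (\<sigma>, y) = (chart_inv b \<sigma>, chart_inv c y)"
    by (rule inv_into_f_eq)
  then show ?thesis
    by simp
qed

text \<open>The members of \<open>product_atlas\<close> are products of charts, so smoothness on the
  product is joint smoothness in the two coordinate vectors. The domain is spelled out because
  \<open>f\<close> must also land in \<open>d\<close>.\<close>

lemma smooth_map_product_charts:
  fixes B :: "('b::topological_space, 't::euclidean_space) chart set"
    and A :: "('a::topological_space, 'e::euclidean_space) chart set"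
    and C :: "('c::topological_space, 'f::euclidean_space) chart set"
  assumes B: "smooth_atlas B" and A: "smooth_atlas A" and C: "smooth_atlas C"
    and f: "smooth_map (product_atlas B A) C f" and bcd: "b \<in> B" "c \<in> A" "d \<in> C"
  defines "\<Omega> \<equiv> {(\<sigma>, y). \<sigma> \<in> chart_image b \<and> y \<in> chart_image c \<and> f (chart_inv b \<sigma>, chart_inv c y) \<in> fst d}"
  shows "open \<Omega>" and "smooth_on \<Omega> (\<lambda>p. snd d (f (chart_inv b (fst p), chart_inv c (snd p))))"
proof -
  let ?P = "(fst b \<times> fst c, map_prod (snd b) (snd c))"
  have P: "?P \<in> product_atlas B A"
    using bcd unfolding product_atlas_def by blast
  note b = atlas_chart[OF B bcd(1)] and c = atlas_chart[OF A bcd(2)]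
  have cont: "continuous_on (chart_image b \<times> chart_image c) (\<lambda>p. (chart_inv b (fst p), chart_inv c (snd p)))"
    using b c unfolding is_chart_def homeomorphism_def
    by (intro continuous_on_Pair continuous_on_compose2[of "chart_image b" "chart_inv b" _ fst]
        continuous_on_compose2[of "chart_image c" "chart_inv c" _ snd] continuous_on_fst continuous_on_snd
        continuous_on_id) auto
  have "open (f -` fst d)"
    using f open_domain[OF C bcd(3)] by (simp add: smooth_map_def continuous_on_open_vimage)
  then have "open ((chart_image b \<times> chart_image c) \<inter> (\<lambda>p. (chart_inv b (fst p), chart_inv c (snd p))) -` (f -` fst d))"
    using open_chart_image[OF b] open_chart_image[OF c]
    by (intro continuous_open_preimage[OF cont] open_Times) auto
  moreover have "(chart_image b \<times> chart_image c) \<inter> (\<lambda>p. (chart_inv b (fst p), chart_inv c (snd p))) -` (f -` fst d) = \<Omega>"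
    unfolding \<Omega>_def by auto
  ultimately show "open \<Omega>"
    by simp
  have "\<Omega> \<subseteq> snd ?P ` (fst ?P \<inter> f -` fst d)"
  proof
    fix p
    assume "p \<in> \<Omega>"
    then obtain \<sigma> y where p: "p = (\<sigma>, y)" "\<sigma> \<in> chart_image b" "y \<in> chart_image c" "f (chart_inv b \<sigma>, chart_inv c y) \<in> fst d"
      unfolding \<Omega>_def by blast
    have "p = snd ?P (chart_inv b \<sigma>, chart_inv c y)"
      using p chart_chart_inv[of \<sigma> b] chart_chart_inv[of y c] by simp
    moreover have "(chart_inv b \<sigma>, chart_inv c y) \<in> fst ?P \<inter> f -` fst d"
      using p chart_inv_mem[of \<sigma> b] chart_inv_mem[of y c] by simp
    ultimately show "p \<in> snd ?P ` (fst ?P \<inter> f -` fst d)"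
      by (rule image_eqI)
  qed
  moreover have "smooth_on (snd ?P ` (fst ?P \<inter> f -` fst d)) (snd d \<circ> f \<circ> chart_inv ?P)"
    using f P bcd(3) unfolding smooth_map_def by blast
  ultimately have "smooth_on \<Omega> (snd d \<circ> f \<circ> chart_inv ?P)"
    by (rule smooth_on_subset[rotated])
  then show "smooth_on \<Omega> (\<lambda>p. snd d (f (chart_inv b (fst p), chart_inv c (snd p))))"
  proof (rule smooth_on_cong[OF \<open>open \<Omega>\<close>, rotated])
    fix p
    assume "p \<in> \<Omega>"
    then have "chart_inv ?P p = (chart_inv b (fst p), chart_inv c (snd p))"
      unfolding \<Omega>_def using chart_inv_product[OF b c] by auto
    then show "(snd d \<circ> f \<circ> chart_inv ?P) p = snd d (f (chart_inv b (fst p), chart_inv c (snd p)))"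
      by simp
  qed
qed

section \<open>Isometries with a trivial differential at a fixed point\<close>

lemma open_chart_vimage:
  assumes "is_chart c" "open W"
  shows "open {z \<in> fst c. snd c z \<in> W}"
proof -
  have "continuous_on (fst c) (snd c)" "open (fst c)"
    using assms(1) by (simp_all add: is_chart_def homeomorphism_def)
  then have "open (fst c \<inter> snd c -` W)"
    using assms(2) by (rule continuous_open_preimage)
  then show ?thesis
    by (simp add: vimage_def Collect_conj_eq)
qed

lemma isometry_in_chart:
  fixes A :: "('a::topological_space, 'e::euclidean_space) chart set"
  assumes A: "smooth_atlas A" and g: "riemannian_metric A g" and f: "riemannian_isometry A g f"
    and c: "c \<in> A" and z: "z \<in> fst c" "f z \<in> fst c"
  shows "tensor2_in_chart A g c (frechet_derivative (snd c \<circ> f \<circ> chart_inv c) (at (snd c z)) u)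
      (frechet_derivative (snd c \<circ> f \<circ> chart_inv c) (at (snd c z)) w) (snd c (f z)) =
    tensor2_in_chart A g c u w (snd c z)"
proof -
  have sm: "smooth_map A A f"
    using f by (simp add: riemannian_isometry_def)
  note dif = smooth_map_differentiable[OF sm]
  have cont: "continuous_on UNIV f"
    using sm by (simp add: smooth_map_def)
  let ?v = "coord_vec A c z"
  have v: "?v u \<in> tangent_space A z" for u
    by (rule coord_vec_mem[OF A c z(1)])
  have tm: "tangent_map A A f z (?v u) \<in> tangent_space A (f z)" for u
    by (rule tangent_map_mem[OF A A cont dif])
  have tc: "tangent_map A A f z (?v u) c = frechet_derivative (snd c \<circ> f \<circ> chart_inv c) (at (snd c z)) u" for u
    using tangent_map_apply[OF A c z(1) c z(2) v dif[OF c c z]] coord_vec_apply[OF A c z(1)] by simp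
  have "tensor2_in_chart A g c u w (snd c z) = g z (?v u) (?v w)"
    by (simp add: tensor2_in_chart_def chart_inv_chart[OF atlas_chart[OF A c] z(1)])
  also have "\<dots> = g (f z) (tangent_map A A f z (?v u)) (tangent_map A A f z (?v w))"
    using f v unfolding riemannian_isometry_def by metis
  also have "\<dots> = tensor2_in_chart A g c (tangent_map A A f z (?v u) c) (tangent_map A A f z (?v w) c) (snd c (f z))"
    by (rule tensor2_in_chart_eq[OF A c z(2) tm tm, symmetric])
  finally show ?thesis
    by (simp add: tc)
qed

lemma isometry_identity_near:
  fixes A :: "('a::topological_space, 'e::euclidean_space) chart set"
  assumes A: "smooth_atlas A" and g: "riemannian_metric A g" and f: "riemannian_isometry A g f"
    and c: "c \<in> A" "x \<in> fst c" and fx: "f x = x"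
    and D: "\<And>u. frechet_derivative (snd c \<circ> f \<circ> chart_inv c) (at (snd c x)) u = u"
  shows "x \<in> interior {x. f x = x}"
proof -
  let ?S = "snd c ` (fst c \<inter> f -` fst c)"
  let ?f = "snd c \<circ> f \<circ> chart_inv c"
  note chart = atlas_chart[OF A c(1)]
  have inv: "chart_inv c (snd c z) = z" if "z \<in> fst c" for z
    by (rule chart_inv_chart[OF chart that])
  have sm: "smooth_map A A f"
    using f by (simp add: riemannian_isometry_def)
  have "eventually (\<lambda>y. ?f y = y) (nhds (snd c x))"
  proof (rule isometry_rigidity[where S = ?S and U = "chart_image c" and
        G = "\<lambda>y u w. tensor2_in_chart A g c u w y"])
    show openS: "open ?S"
      using sm open_domain[OF A c(1)] unfolding smooth_map_def
      by (intro open_chart_image_Int[OF chart] open_vimage) auto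
    show "open (chart_image c)"
      by (rule open_chart_image[OF chart])
    show "?S \<subseteq> chart_image c"
      by blast
    show "?f ` ?S \<subseteq> chart_image c"
      using inv by auto
    show "smooth_on ?S ?f"
      using sm c(1) unfolding smooth_map_def by blast
    show "smooth_on (chart_image c) (\<lambda>y. tensor2_in_chart A g c u w y)" for u w
      by (rule metric_in_chart(1)[OF A g c(1)])
    show "bilinear (\<lambda>u w. tensor2_in_chart A g c u w y)" if "y \<in> chart_image c" for y
      by (rule metric_in_chart(2)[OF A g c(1) that])
    show "tensor2_in_chart A g c u w y = tensor2_in_chart A g c w u y" if "y \<in> chart_image c" for y u w
      by (rule metric_in_chart(3)[OF A g c(1) that])
    show "0 < tensor2_in_chart A g c u u (snd c x)" if "u \<noteq> 0" for u
      by (rule metric_in_chart(4)[OF A g c(1) imageI[OF c(2)] that])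
    show "snd c x \<in> ?S"
      using c(2) fx by simp
    show "?f (snd c x) = snd c x"
      using inv[OF c(2)] fx by simp
    show "frechet_derivative ?f (at (snd c x)) u = u" for u
      by (rule D)
    show "tensor2_in_chart A g c (frechet_derivative ?f (at y) u) (frechet_derivative ?f (at y) w) (?f y) =
      tensor2_in_chart A g c u w y" if y: "y \<in> ?S" for y u w
    proof -
      obtain z where z: "y = snd c z" "z \<in> fst c" "f z \<in> fst c"
        using y by blast
      have "?f y = snd c (f z)"
        unfolding z(1) using inv[OF z(2)] by simp
      then show ?thesis
        unfolding z(1) using isometry_in_chart[OF A g f c(1) z(2,3)] by simp
    qed
  qed
  then obtain V where V: "open V" "snd c x \<in> V" "\<And>y. y \<in> V \<Longrightarrow> ?f y = y"
    unfolding eventually_nhds by blast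
  \<comment> \<open>Both \<open>z\<close> and \<open>f z\<close> have to lie in the domain of
    \<open>c\<close>: equal coordinates then give \<open>f z = z\<close> by injectivity of the
    chart.\<close>
  define N where "N = {z \<in> fst c. snd c z \<in> V} \<inter> f -` fst c"
  have "open N"
    unfolding N_def using sm open_domain[OF A c(1)] unfolding smooth_map_def
    by (intro open_Int open_chart_vimage[OF chart V(1)] open_vimage) auto
  moreover have "x \<in> N"
    using c(2) V(2) fx by (simp add: N_def)
  moreover have "f z = z" if "z \<in> N" for z
  proof -
    have z: "z \<in> fst c" "snd c z \<in> V" "f z \<in> fst c"
      using that by (auto simp: N_def)
    have "snd c (f z) = snd c z"
      using V(3)[OF z(2)] inv[OF z(1)] by simp
    then show ?thesis
      using is_chart_inj_on[OF chart] z(1,3) by (simp add: inj_on_eq_iff)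
  qed
  ultimately show ?thesis
    by (intro interiorI[of N]) auto
qed

lemma open_closed_UNIV:
  "connected (UNIV :: 'a::topological_space set) \<Longrightarrow> open S \<Longrightarrow> closed S \<Longrightarrow> x \<in> S \<Longrightarrow> (S :: 'a set) = UNIV"
  unfolding connected_clopen by (metis empty_iff open_openin closed_closedin subtopology_UNIV)

text \<open>The interior of the fixed set is open and contains \<open>x\<close> by local rigidity.
  It is also closed: a limit point is fixed, its differential is trivial by continuity, and local
  rigidity applies again. Working with the interior makes the derivative near its points that of the
  identity.\<close>

lemma isometry_eq_id:
  fixes A :: "('a::t2_space, 'e::euclidean_space) chart set"
  assumes A: "smooth_atlas A" and g: "riemannian_metric A g" and f: "riemannian_isometry A g f"
    and conn: "connected (UNIV :: 'a set)"
    and c: "c \<in> A" "x \<in> fst c" and fx: "f x = x"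
    and D: "\<And>u. frechet_derivative (snd c \<circ> f \<circ> chart_inv c) (at (snd c x)) u = u"
  shows "f y = y"
proof -
  let ?F = "{x. f x = x}"
  have sm: "smooth_map A A f"
    using f by (simp add: riemannian_isometry_def)
  have "closed ?F"
    using sm by (intro closed_Collect_eq) (auto simp: smooth_map_def intro: continuous_intros)
  have "closure (interior ?F) \<subseteq> interior ?F"
  proof
    fix x
    assume x: "x \<in> closure (interior ?F)"
    then have fx: "f x = x"
      using closure_minimal[OF interior_subset \<open>closed ?F\<close>] by blast
    obtain c where c: "c \<in> A" "x \<in> fst c"
      using chart_at_mem[OF A] by blast
    note chart = atlas_chart[OF A c(1)]
    let ?S = "snd c ` (fst c \<inter> f -` fst c)"
    let ?f = "snd c \<circ> f \<circ> chart_inv c"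
    have openS: "open ?S"
      using sm open_domain[OF A c(1)] unfolding smooth_map_def
      by (intro open_chart_image_Int[OF chart] open_vimage) auto
    have smf: "smooth_on ?S ?f"
      using sm c(1) unfolding smooth_map_def by blast
    show "x \<in> interior ?F"
    proof (rule isometry_identity_near[where c = c, OF A g f c fx], rule ccontr)
      fix u
      assume neq: "frechet_derivative ?f (at (snd c x)) u \<noteq> u"
      \<comment> \<open>A nontrivial derivative at the limit point would persist on a neighbourhood,
        which meets the interior of the fixed set, where the derivative is the identity.\<close>
      let ?W = "?S \<inter> (\<lambda>y. frechet_derivative ?f (at y) u) -` (- {u})"
      let ?N = "{z \<in> fst c. snd c z \<in> ?W}"
      have "open ?W"
        by (rule continuous_open_preimage[OF smooth_on_imp_continuous_on[OF smooth_on_frechet_derivative[OF smf]] openS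
              open_Compl[OF closed_singleton]])
      then have "open ?N"
        by (rule open_chart_vimage[OF chart])
      moreover have "x \<in> ?N"
        using c neq fx by simp
      ultimately have "?N \<inter> interior ?F \<noteq> {}"
        using open_Int_closure_eq_empty[of ?N "interior ?F"] x by blast
      then obtain z where z: "z \<in> interior ?F" "z \<in> fst c" "frechet_derivative ?f (at (snd c z)) u \<noteq> u"
        by blast
      have "(?f has_derivative (\<lambda>h. h)) (at (snd c z))"
      proof (rule has_derivative_transform_within_open[OF has_derivative_ident])
        show "open (snd c ` (fst c \<inter> interior ?F))"
          by (rule open_chart_image_Int[OF chart open_interior])
        show "snd c z \<in> snd c ` (fst c \<inter> interior ?F)"
          using z by blast
        show "y = ?f y" if y: "y \<in> snd c ` (fst c \<inter> interior ?F)" for y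
        proof -
          obtain z where z: "y = snd c z" "z \<in> fst c \<inter> interior ?F"
            using y by (rule imageE)
          have "f z = z"
            using z(2) interior_subset[of ?F] by blast
          then show ?thesis
            using z chart_inv_chart[OF chart] by simp
        qed
      qed
      then show False
        using z(3) by (simp add: frechet_derivative_eqI)
    qed
  qed
  then have "closed (interior ?F)"
    using closure_subset_eq by blast
  moreover have "x \<in> interior ?F"
    by (rule isometry_identity_near[OF A g f c fx D])
  ultimately have "interior ?F = UNIV"
    by (intro open_closed_UNIV[OF conn]) auto
  then show ?thesis
    using interior_subset[of ?F] by blast
qed

section \<open>The isotropy representation at a fixed point\<close>

lemma has_derivative_partial:
  assumes "F differentiable at (\<sigma>, y)"
  shows "((\<lambda>y. F (\<sigma>, y)) has_derivative (\<lambda>X. frechet_derivative F (at (\<sigma>, y)) (0, X))) (at y)"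
    and "((\<lambda>\<sigma>. F (\<sigma>, y)) has_derivative (\<lambda>\<tau>. frechet_derivative F (at (\<sigma>, y)) (\<tau>, 0))) (at \<sigma>)"
proof -
  have 1: "((\<lambda>y. (\<sigma>, y)) has_derivative (\<lambda>X. (0, X))) (at y)"
    by (intro has_derivative_Pair has_derivative_const has_derivative_ident)
  have 2: "((\<lambda>\<sigma>. (\<sigma>, y)) has_derivative (\<lambda>\<tau>. (\<tau>, 0))) (at \<sigma>)"
    by (intro has_derivative_Pair has_derivative_const has_derivative_ident)
  show "((\<lambda>y. F (\<sigma>, y)) has_derivative (\<lambda>X. frechet_derivative F (at (\<sigma>, y)) (0, X))) (at y)"
    using diff_chain_at[OF 1 has_frechet_derivative[OF assms]] by (simp add: o_def)
  show "((\<lambda>\<sigma>. F (\<sigma>, y)) has_derivative (\<lambda>\<tau>. frechet_derivative F (at (\<sigma>, y)) (\<tau>, 0))) (at \<sigma>)"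
    using diff_chain_at[OF 2 has_frechet_derivative[OF assms]] by (simp add: o_def)
qed

text \<open>Both fields vanish at \<open>y0\<close>, so each absorbs one factor \<epsilon> and tends
  to its linearisation. The metric contributes its value at \<open>y0\<close> only, and continuity
  of its coefficients is enough.\<close>

lemma tensor_second_order_limit:
  fixes G :: "'e::euclidean_space \<Rightarrow> 'f::euclidean_space \<Rightarrow> 'f \<Rightarrow> real"
  assumes U: "open U" "y0 \<in> U" and bil: "\<And>y. y \<in> U \<Longrightarrow> bilinear (G y)"
    and cont: "\<And>u w. continuous_on U (\<lambda>y. G y u w)"
    and V: "(V has_derivative V') (at y0)" "V y0 = 0"
    and W: "(W has_derivative W') (at y0)" "W y0 = 0"
  shows "((\<lambda>\<epsilon>. G (y0 + \<epsilon> *\<^sub>R X) (V (y0 + \<epsilon> *\<^sub>R X)) (W (y0 + \<epsilon> *\<^sub>R X)) / (\<epsilon> * \<epsilon>)) \<longlongrightarrow>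
    G y0 (V' X) (W' X)) (at 0)"
proof -
  have quot: "((\<lambda>\<epsilon>. (Z (y0 + \<epsilon> *\<^sub>R X) \<bullet> i) / \<epsilon>) \<longlongrightarrow> Z' X \<bullet> i) (at 0)"
    if "(Z has_derivative Z') (at y0)" "Z y0 = 0" for Z Z' and i :: 'f
  proof -
    note d = has_derivative_inner_left[OF that(1), of i]
    have "((\<lambda>\<epsilon>. Z (y0 + \<epsilon> *\<^sub>R X) \<bullet> i) has_real_derivative Z' X \<bullet> i) (at 0)"
      using has_real_derivative_along_line[of "\<lambda>y. Z y \<bullet> i" y0 0 X] differentiableI[OF d]
      by (simp add: frechet_derivative_eqI[OF d])
    from DERIV_D[OF this] show ?thesis
      by (simp add: that(2))
  qed
  have line: "((\<lambda>\<epsilon>. y0 + \<epsilon> *\<^sub>R X) \<longlongrightarrow> y0) (at 0)"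
    by (rule tendsto_eq_intros | simp)+
  have G: "((\<lambda>\<epsilon>. G (y0 + \<epsilon> *\<^sub>R X) i j) \<longlongrightarrow> G y0 i j) (at 0)" for i j
    using filterlim_compose[OF continuous_on_tendsto_nhds[OF U(1) cont U(2)] line] .
  have lim: "((\<lambda>\<epsilon>. \<Sum>i\<in>Basis. \<Sum>j\<in>Basis. ((V (y0 + \<epsilon> *\<^sub>R X) \<bullet> i) / \<epsilon>) * ((W (y0 + \<epsilon> *\<^sub>R X) \<bullet> j) / \<epsilon>) * G (y0 + \<epsilon> *\<^sub>R X) i j) \<longlongrightarrow>
      (\<Sum>i\<in>Basis. \<Sum>j\<in>Basis. (V' X \<bullet> i) * (W' X \<bullet> j) * G y0 i j)) (at 0)"
    by (intro tendsto_sum tendsto_mult quot V W G)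
  have exp: "(\<Sum>i\<in>Basis. \<Sum>j\<in>Basis. (V' X \<bullet> i) * (W' X \<bullet> j) * G y0 i j) = G y0 (V' X) (W' X)"
    by (rule bilinear_expand_Basis[OF bil[OF U(2)], symmetric])
  have "eventually (\<lambda>\<epsilon>. (\<Sum>i\<in>Basis. \<Sum>j\<in>Basis. ((V (y0 + \<epsilon> *\<^sub>R X) \<bullet> i) / \<epsilon>) * ((W (y0 + \<epsilon> *\<^sub>R X) \<bullet> j) / \<epsilon>) * G (y0 + \<epsilon> *\<^sub>R X) i j) =
      G (y0 + \<epsilon> *\<^sub>R X) (V (y0 + \<epsilon> *\<^sub>R X)) (W (y0 + \<epsilon> *\<^sub>R X)) / (\<epsilon> * \<epsilon>)) (at 0)"
    using topological_tendstoD[OF line U]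
  proof eventually_elim
    case (elim \<epsilon>)
    show ?case
      unfolding bilinear_expand_Basis[OF bil[OF elim], of "V _"]
      by (simp add: sum_divide_distrib)
  qed
  from Lim_transform_eventually[OF lim this] show ?thesis
    unfolding exp .
qed

text \<open>Polarising the orthogonality gives \<open>Q (S X) (T Y) + Q (S Y) (T X) = 0\<close>; by
  skewness and commutation both terms equal minus the pairing of \<open>T (S X)\<close> with
  \<open>Y\<close>. Equality of lengths at \<open>S X\<close> turns \<open>T (S X) = 0\<close> into
  \<open>S (S X) = 0\<close>, and skewness finishes.\<close>

lemma skew_commuting_conformal_eq_0:
  fixes Q :: "'e::real_vector \<Rightarrow> 'e \<Rightarrow> real" and S T :: "'e \<Rightarrow> 'e"
  assumes Q: "bilinear Q" "\<And>u w. Q u w = Q w u" "\<And>u. u \<noteq> 0 \<Longrightarrow> 0 < Q u u"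
    and lin: "linear S" "linear T"
    and skew: "\<And>X Y. Q (S X) Y + Q X (S Y) = 0" "\<And>X Y. Q (T X) Y + Q X (T Y) = 0"
    and comm: "\<And>X. S (T X) = T (S X)"
    and orth: "\<And>X. Q (S X) (T X) = 0" and len: "\<And>X. Q (S X) (S X) = Q (T X) (T X)"
  shows "S X = 0"
proof -
  have "Q Y (T (S X)) = 0" for X Y
  proof -
    have "Q (S (X + Y)) (T (X + Y)) = Q (S X) (T X) + Q (S X) (T Y) + Q (S Y) (T X) + Q (S Y) (T Y)"
      by (simp add: linear_add[OF lin(1)] linear_add[OF lin(2)] bilinear_ladd[OF Q(1)] bilinear_radd[OF Q(1)])
    then have "Q (S X) (T Y) + Q (S Y) (T X) = 0"
      using orth[of "X + Y"] orth[of X] orth[of Y] by linarith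
    moreover have "Q (S X) (T Y) = - Q (T (S X)) Y" "Q (S Y) (T X) = - Q Y (T (S X))"
      using skew(2)[of "S X" Y] skew(1)[of Y "T X"] comm[of X] by auto
    ultimately show ?thesis
      using Q(2)[of "T (S X)" Y] by linarith
  qed
  then have TS: "Q (T (S X)) (T (S X)) = 0" for X
    by blast
  have zero: "u = 0" if "Q u u = 0" for u
    using Q(3)[of u] that by force
  have "Q (S (S X)) (S (S X)) = 0"
    using len[of "S X"] TS[of X] by simp
  then have "S (S X) = 0"
    by (rule zero)
  then have "Q (S X) (S X) = 0"
    using skew(1)[of X "S X"] bilinear_rzero[OF Q(1)] by simp
  then show ?thesis
    by (rule zero)
qed

text \<open>Freezing the second argument; applied to the action it concerns orbit maps, applied to
  the group law it concerns translations.\<close>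

lemma smooth_map_slice_differentiable:
  fixes B :: "('b::topological_space, 't::euclidean_space) chart set"
    and A :: "('a::topological_space, 'e::euclidean_space) chart set"
    and C :: "('c::topological_space, 'f::euclidean_space) chart set"
  assumes B: "smooth_atlas B" and A: "smooth_atlas A" and C: "smooth_atlas C"
    and f: "smooth_map (product_atlas B A) C f"
    and b: "b \<in> B" "s \<in> fst b" and d: "d \<in> C" "f (s, x) \<in> fst d"
  shows "(snd d \<circ> (\<lambda>s. f (s, x)) \<circ> chart_inv b) differentiable at (snd b s)"
proof -
  obtain c where c: "c \<in> A" "x \<in> fst c"
    using chart_at_mem[OF A] by blast
  have x: "chart_inv c (snd c x) = x" and s: "chart_inv b (snd b s) = s"
    using chart_inv_chart[OF atlas_chart[OF A c(1)] c(2)] chart_inv_chart[OF atlas_chart[OF B b(1)] b(2)]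
    by auto
  let ?F = "\<lambda>p. snd d (f (chart_inv b (fst p), chart_inv c (snd p)))"
  have "?F differentiable at (snd b s, snd c x)"
    by (rule smooth_on_imp_differentiable[OF smooth_map_product_charts(2)[OF B A C f b(1) c(1) d(1)]])
      (use b c d x s in simp)
  from has_derivative_partial(2)[OF this] show ?thesis
    using x by (intro differentiableI) (simp add: o_def)
qed

lemma smooth_action_orbit_map:
  fixes B :: "('g::{ab_group_add, t2_space, second_countable_topology}, 't::euclidean_space) chart set"
    and A :: "('a::topological_space, 'e::euclidean_space) chart set"
  assumes B: "smooth_atlas B" and A: "smooth_atlas A" and act: "smooth_action B A \<rho>"
  shows "continuous_on UNIV (\<lambda>s. \<rho> s x)"
    and "b \<in> B \<Longrightarrow> d \<in> A \<Longrightarrow> s \<in> fst b \<Longrightarrow> \<rho> s x \<in> fst d \<Longrightarrow>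
      (snd d \<circ> (\<lambda>s. \<rho> s x) \<circ> chart_inv b) differentiable at (snd b s)"
    and "fundamental_field B A \<rho> v x \<in> tangent_space A x"
proof -
  have sm: "smooth_map (product_atlas B A) A (\<lambda>(s, x). \<rho> s x)" and "\<rho> 0 x = x"
    using act by (simp_all add: smooth_action_def)
  have "continuous_on UNIV (\<lambda>s. (\<lambda>(s, x). \<rho> s x) (s, x))"
    using sm unfolding smooth_map_def
    by (intro continuous_on_compose2[of UNIV "\<lambda>(s, x). \<rho> s x" UNIV "\<lambda>s. (s, x)"])
      (auto intro!: continuous_on_Pair continuous_on_id continuous_on_const)
  then show cont: "continuous_on UNIV (\<lambda>s. \<rho> s x)"
    by simp
  show dif: "(snd d \<circ> (\<lambda>s. \<rho> s x) \<circ> chart_inv b) differentiable at (snd b s)"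
    if "b \<in> B" "d \<in> A" "s \<in> fst b" "\<rho> s x \<in> fst d" for b d s
    using smooth_map_slice_differentiable[OF B A A sm that(1,3,2), of x] that(4) by simp
  have "tangent_map B A (\<lambda>s. \<rho> s x) 0 v \<in> tangent_space A (\<rho> 0 x)"
    by (rule tangent_map_mem[OF B A cont dif])
  then show "fundamental_field B A \<rho> v x \<in> tangent_space A x"
    using \<open>\<rho> 0 x = x\<close> by (simp add: fundamental_field_def)
qed

section \<open>The action in charts around the unit and a fixed point\<close>

locale fixed_point_action =
  fixes A :: "('a::t2_space, 'e::euclidean_space) chart set"
    and g :: "('a, 'e) tensor2"
    and B :: "('g::{ab_group_add, t2_space, second_countable_topology}, 't::euclidean_space) chart set"
    and \<rho> :: "'g \<Rightarrow> 'a \<Rightarrow> 'a"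
    and x0 :: 'a
  assumes A: "smooth_atlas A" and metric: "riemannian_metric A g" and lie: "abelian_lie_group B"
    and act: "smooth_action B A \<rho>" and iso: "\<And>s. riemannian_isometry A g (\<rho> s)"
    and fixed: "\<And>s. \<rho> s x0 = x0"
begin

abbreviation b where "b \<equiv> chart_at B 0"
abbreviation c where "c \<equiv> chart_at A x0"
abbreviation \<sigma>0 where "\<sigma>0 \<equiv> snd b 0"
abbreviation y0 where "y0 \<equiv> snd c x0"

lemma B: "smooth_atlas B"
  using lie by (simp add: abelian_lie_group_def smooth_structure_def)

lemma b: "b \<in> B" "0 \<in> fst b" and c: "c \<in> A" "x0 \<in> fst c"
  using chart_at_mem[OF A, of x0] chart_at_mem[OF B, of 0] by simp_all

lemmas chart_b = atlas_chart[OF B b(1)] and chart_c = atlas_chart[OF A c(1)]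

lemma inv_b: "s \<in> fst b \<Longrightarrow> chart_inv b (snd b s) = s"
  by (rule chart_inv_chart[OF chart_b])

lemma inv_c: "x \<in> fst c \<Longrightarrow> chart_inv c (snd c x) = x"
  by (rule chart_inv_chart[OF chart_c])

lemma \<rho>_smooth: "smooth_map A A (\<rho> s)"
  using iso by (simp add: riemannian_isometry_def)

lemma \<rho>_0: "\<rho> 0 x = x" and \<rho>_add: "\<rho> (s + t) x = \<rho> s (\<rho> t x)"
  using act by (simp_all add: smooth_action_def)

text \<open>The isotropy representation, read in the chart at the fixed point. Source and target
  chart coincide because the point is fixed, so the operators act on the model space and compose
  there.\<close>

definition R :: "'g \<Rightarrow> 'e \<Rightarrow> 'e" where
  "R s = frechet_derivative (snd c \<circ> \<rho> s \<circ> chart_inv c) (at y0)"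

text \<open>The action in coordinates as a function on one product space, so that the symmetry of
  second derivatives covers mixed derivatives in the group and the manifold.\<close>

definition F :: "'t \<times> 'e \<Rightarrow> 'e" where
  "F p = snd c (\<rho> (chart_inv b (fst p)) (chart_inv c (snd p)))"

definition \<Omega> :: "('t \<times> 'e) set" where
  "\<Omega> = {(\<sigma>, y). \<sigma> \<in> chart_image b \<and> y \<in> chart_image c \<and> \<rho> (chart_inv b \<sigma>) (chart_inv c y) \<in> fst c}"

text \<open>As second derivatives are symmetric, \<open>isotropy \<tau>\<close> is both the derivative at \<open>0\<close> of the isotropy
  representation \<open>R\<close> and the linearisation at the fixed point of a fundamental field.\<close>

definition isotropy :: "'t \<Rightarrow> 'e \<Rightarrow> 'e" where
  "isotropy \<tau> X = frechet_derivative (\<lambda>p. frechet_derivative F (at p) (0, X)) (at (\<sigma>0, y0)) (\<tau>, 0)"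

lemma open_\<Omega>: "open \<Omega>" and smooth_F: "smooth_on \<Omega> F"
proof -
  have sm: "smooth_map (product_atlas B A) A (\<lambda>(s, x). \<rho> s x)"
    using act by (simp add: smooth_action_def)
  show "open \<Omega>" "smooth_on \<Omega> F"
    using smooth_map_product_charts[OF B A A sm b(1) c(1) c(1)]
    unfolding \<Omega>_def F_def[abs_def] by simp_all
qed

lemma \<Omega>_fixed: "\<sigma> \<in> chart_image b \<Longrightarrow> (\<sigma>, y0) \<in> \<Omega>"
  using c(2) by (simp add: \<Omega>_def inv_c fixed)

lemma \<Omega>_unit: "y \<in> chart_image c \<Longrightarrow> (\<sigma>0, y) \<in> \<Omega>"
  using b(2) chart_inv_mem[of y c] by (simp add: \<Omega>_def inv_b \<rho>_0)

lemma base_\<Omega>: "(\<sigma>0, y0) \<in> \<Omega>"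
  using \<Omega>_unit c(2) by blast

lemma R_has_derivative: "((snd c \<circ> \<rho> s \<circ> chart_inv c) has_derivative R s) (at y0)"
  unfolding R_def
  by (rule has_frechet_derivative[OF smooth_map_differentiable[OF \<rho>_smooth c(1) c(1) c(2)]])
    (simp add: fixed c)

lemma R_linear: "linear (R s)"
  by (rule has_derivative_linear[OF R_has_derivative])

lemma R_0: "R 0 X = X"
proof -
  have "((snd c \<circ> \<rho> 0 \<circ> chart_inv c) has_derivative (\<lambda>h. h)) (at y0)"
    by (rule has_derivative_transform_within_open[OF has_derivative_ident open_chart_image[OF chart_c] imageI[OF c(2)]])
      (simp add: \<rho>_0 chart_chart_inv)
  then show ?thesis
    unfolding R_def by (simp add: frechet_derivative_eqI)
qed

lemma R_add: "R (s + t) X = R s (R t X)"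
proof -
  have y0: "y0 = (snd c \<circ> \<rho> t \<circ> chart_inv c) y0"
    by (simp add: inv_c c fixed)
  have "((snd c \<circ> \<rho> s \<circ> chart_inv c) has_derivative R s) (at ((snd c \<circ> \<rho> t \<circ> chart_inv c) y0))"
    unfolding y0[symmetric] by (rule R_has_derivative)
  from diff_chain_at[OF R_has_derivative this]
  have "((snd c \<circ> \<rho> s \<circ> chart_inv c) \<circ> (snd c \<circ> \<rho> t \<circ> chart_inv c) has_derivative R s \<circ> R t) (at y0)" .
  then have "((snd c \<circ> \<rho> (s + t) \<circ> chart_inv c) has_derivative R s \<circ> R t) (at y0)"
  proof (rule has_derivative_transform_within_open)
    show "open (snd c ` (fst c \<inter> \<rho> t -` fst c))"
      using \<rho>_smooth open_domain[OF A c(1)] unfolding smooth_map_def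
      by (intro open_chart_image_Int[OF chart_c] open_vimage) auto
    show "y0 \<in> snd c ` (fst c \<inter> \<rho> t -` fst c)"
      using c(2) fixed by simp
    show "((snd c \<circ> \<rho> s \<circ> chart_inv c) \<circ> (snd c \<circ> \<rho> t \<circ> chart_inv c)) y = (snd c \<circ> \<rho> (s + t) \<circ> chart_inv c) y"
      if "y \<in> snd c ` (fst c \<inter> \<rho> t -` fst c)" for y
      using that by (auto simp: inv_c \<rho>_add)
  qed
  then show ?thesis
    unfolding R_def[of "s + t"] by (simp add: frechet_derivative_eqI)
qed

text \<open>Identifies the representation with a partial derivative of the smooth function
  \<open>F\<close>; this is why it can be differentiated in the group variable.\<close>

lemma R_chart: "\<sigma> \<in> chart_image b \<Longrightarrow> R (chart_inv b \<sigma>) X = frechet_derivative F (at (\<sigma>, y0)) (0, X)"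
proof -
  assume "\<sigma> \<in> chart_image b"
  then have "F differentiable at (\<sigma>, y0)"
    using smooth_on_imp_differentiable[OF smooth_F \<Omega>_fixed] by blast
  from has_derivative_partial(1)[OF this]
  have "((snd c \<circ> \<rho> (chart_inv b \<sigma>) \<circ> chart_inv c) has_derivative
      (\<lambda>X. frechet_derivative F (at (\<sigma>, y0)) (0, X))) (at y0)"
    by (simp add: F_def o_def)
  then show ?thesis
    unfolding R_def by (simp add: frechet_derivative_eqI)
qed

lemma R_chart_has_derivative:
  "((\<lambda>\<sigma>. R (chart_inv b \<sigma>) X) has_derivative (\<lambda>\<tau>. isotropy \<tau> X)) (at \<sigma>0)"
proof -
  have "(\<lambda>p. frechet_derivative F (at p) (0, X)) differentiable at (\<sigma>0, y0)"
    by (rule smooth_on_imp_differentiable[OF smooth_on_frechet_derivative[OF smooth_F] base_\<Omega>])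
  from has_derivative_partial(2)[OF this] show ?thesis
    unfolding isotropy_def
    by (rule has_derivative_transform_within_open[OF _ open_chart_image[OF chart_b] imageI[OF b(2)]])
      (simp add: R_chart)
qed

lemma field_has_derivative:
  "((\<lambda>y. frechet_derivative F (at (\<sigma>0, y)) (\<tau>, 0)) has_derivative isotropy \<tau>) (at y0)"
proof -
  have "(\<lambda>p. frechet_derivative F (at p) (\<tau>, 0)) differentiable at (\<sigma>0, y0)"
    by (rule smooth_on_imp_differentiable[OF smooth_on_frechet_derivative[OF smooth_F] base_\<Omega>])
  from has_derivative_partial(1)[OF this] show ?thesis
    unfolding isotropy_def[abs_def] second_derivative_symmetric[OF open_\<Omega> smooth_F base_\<Omega>, of "(\<tau>, 0)"] .
qed

lemma field_base: "frechet_derivative F (at (\<sigma>0, y0)) (\<tau>, 0) = 0"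
proof -
  have "((\<lambda>\<sigma>. F (\<sigma>, y0)) has_derivative (\<lambda>\<tau>. frechet_derivative F (at (\<sigma>0, y0)) (\<tau>, 0))) (at \<sigma>0)"
    by (rule has_derivative_partial(2)[OF smooth_on_imp_differentiable[OF smooth_F base_\<Omega>]])
  moreover have "(\<lambda>\<sigma>. F (\<sigma>, y0)) = (\<lambda>\<sigma>. y0)"
    by (simp add: F_def inv_c c fixed)
  ultimately have "(\<lambda>\<tau>. frechet_derivative F (at (\<sigma>0, y0)) (\<tau>, 0)) = (\<lambda>\<tau>. 0)"
    using has_derivative_unique has_derivative_const by metis
  from fun_cong[OF this] show ?thesis
    by simp
qed

lemma isotropy_linear: "linear (isotropy \<tau>)" "linear (\<lambda>\<tau>. isotropy \<tau> X)"
  by (rule has_derivative_linear[OF field_has_derivative])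
    (rule has_derivative_linear[OF R_chart_has_derivative])

section \<open>Skewness and commutation of the isotropy operators\<close>

abbreviation Q where "Q u w \<equiv> tensor2_in_chart A g c u w y0"

lemma y0_mem: "y0 \<in> chart_image c"
  using c(2) by blast

lemmas Q_bilinear = metric_in_chart(2)[OF A metric c(1) y0_mem]
  and Q_commute = metric_in_chart(3)[OF A metric c(1) y0_mem]
  and Q_pos = metric_in_chart(4)[OF A metric c(1) y0_mem]

lemma R_isometry: "Q (R s X) (R s Y) = Q X Y"
  using isometry_in_chart[OF A metric iso c(1) c(2), of s X Y] c(2) by (simp add: fixed R_def)

text \<open>The derivative at the unit of the invariance of \<open>Q\<close> under the isotropy
  representation.\<close>

lemma isotropy_skew: "Q (isotropy \<tau> X) Y + Q X (isotropy \<tau> Y) = 0"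
proof -
  interpret Q: bounded_bilinear Q
    using Q_bilinear bilinear_conv_bounded_bilinear by blast
  have "((\<lambda>\<sigma>. Q (R (chart_inv b \<sigma>) X) (R (chart_inv b \<sigma>) Y)) has_derivative
      (\<lambda>\<tau>. Q (R (chart_inv b \<sigma>0) X) (isotropy \<tau> Y) + Q (isotropy \<tau> X) (R (chart_inv b \<sigma>0) Y))) (at \<sigma>0)"
    by (rule Q.FDERIV[OF R_chart_has_derivative R_chart_has_derivative])
  then have "((\<lambda>\<sigma>. Q X Y) has_derivative (\<lambda>\<tau>. Q X (isotropy \<tau> Y) + Q (isotropy \<tau> X) Y)) (at \<sigma>0)"
    by (simp add: R_isometry inv_b b R_0)
  from has_derivative_unique[OF this has_derivative_const]
  have "(\<lambda>\<tau>. Q X (isotropy \<tau> Y) + Q (isotropy \<tau> X) Y) = (\<lambda>\<tau>. 0)" .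
  from fun_cong[OF this, of \<tau>] have "Q X (isotropy \<tau> Y) + Q (isotropy \<tau> X) Y = 0"
    by simp
  then show ?thesis
    by simp
qed

text \<open>The group is abelian, so \<open>R s\<close> and \<open>R t\<close> commute; this is
  differentiated in \<open>s\<close> at the unit. The next lemma differentiates once more, in
  \<open>t\<close>.\<close>

lemma isotropy_R_commute: "isotropy \<tau> (R t X) = R t (isotropy \<tau> X)"
proof -
  have "((\<lambda>\<sigma>. R t (R (chart_inv b \<sigma>) X)) has_derivative (\<lambda>\<tau>. R t (isotropy \<tau> X))) (at \<sigma>0)"
    by (rule bounded_linear.has_derivative[OF linear_conv_bounded_linear[THEN iffD1, OF R_linear] R_chart_has_derivative])
  moreover have "R t (R s X) = R s (R t X)" for s
    by (metis R_add add.commute)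
  ultimately have "((\<lambda>\<sigma>. R (chart_inv b \<sigma>) (R t X)) has_derivative (\<lambda>\<tau>. R t (isotropy \<tau> X))) (at \<sigma>0)"
    by simp
  from fun_cong[OF has_derivative_unique[OF R_chart_has_derivative this]] show ?thesis
    by simp
qed

lemma isotropy_commute: "isotropy \<tau> (isotropy \<tau>' X) = isotropy \<tau>' (isotropy \<tau> X)"
proof -
  have "((\<lambda>\<sigma>. isotropy \<tau> (R (chart_inv b \<sigma>) X)) has_derivative (\<lambda>\<tau>'. isotropy \<tau> (isotropy \<tau>' X))) (at \<sigma>0)"
    by (rule bounded_linear.has_derivative[OF linear_conv_bounded_linear[THEN iffD1, OF isotropy_linear(1)] R_chart_has_derivative])
  then have "((\<lambda>\<sigma>. R (chart_inv b \<sigma>) (isotropy \<tau> X)) has_derivative (\<lambda>\<tau>'. isotropy \<tau> (isotropy \<tau>' X))) (at \<sigma>0)"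
    by (simp add: isotropy_R_commute)
  from fun_cong[OF has_derivative_unique[OF R_chart_has_derivative this]] show ?thesis
    by simp
qed

section \<open>Fundamental fields near the fixed point\<close>

lemma fundamental_field_chart:
  assumes "v \<in> lie_algebra B" "x \<in> fst c"
  shows "fundamental_field B A \<rho> v x c = frechet_derivative F (at (\<sigma>0, snd c x)) (v b, 0)"
proof -
  have \<rho>x: "\<rho> 0 x \<in> fst c"
    using assms(2) by (simp add: \<rho>_0)
  have "fundamental_field B A \<rho> v x c = frechet_derivative (snd c \<circ> (\<lambda>s. \<rho> s x) \<circ> chart_inv b) (at \<sigma>0) (v b)"
    unfolding fundamental_field_def
    by (rule tangent_map_apply[OF B b c(1) \<rho>x assms(1)[unfolded lie_algebra_def]
          smooth_action_orbit_map(2)[OF B A act b(1) c(1) b(2) \<rho>x]])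
  also have "((\<lambda>\<sigma>. F (\<sigma>, snd c x)) has_derivative (\<lambda>\<tau>. frechet_derivative F (at (\<sigma>0, snd c x)) (\<tau>, 0))) (at \<sigma>0)"
    by (rule has_derivative_partial(2)[OF smooth_on_imp_differentiable[OF smooth_F \<Omega>_unit[OF imageI[OF assms(2)]]]])
  then have "((snd c \<circ> (\<lambda>s. \<rho> s x) \<circ> chart_inv b) has_derivative (\<lambda>\<tau>. frechet_derivative F (at (\<sigma>0, snd c x)) (\<tau>, 0))) (at \<sigma>0)"
    by (simp add: F_def o_def inv_c assms(2))
  then have "frechet_derivative (snd c \<circ> (\<lambda>s. \<rho> s x) \<circ> chart_inv b) (at \<sigma>0) (v b) = frechet_derivative F (at (\<sigma>0, snd c x)) (v b, 0)"
    by (simp add: frechet_derivative_eqI)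
  finally show ?thesis .
qed

lemma fundamental_field_limit:
  assumes v: "v \<in> lie_algebra B" and w: "w \<in> lie_algebra B"
  defines "h \<equiv> \<lambda>x. g x (fundamental_field B A \<rho> v x) (fundamental_field B A \<rho> w x)"
  shows "((\<lambda>\<epsilon>. h (chart_inv c (y0 + \<epsilon> *\<^sub>R X)) / (\<epsilon> * \<epsilon>)) \<longlongrightarrow> Q (isotropy (v b) X) (isotropy (w b) X)) (at 0)"
proof -
  have h: "h (chart_inv c y) = tensor2_in_chart A g c (frechet_derivative F (at (\<sigma>0, y)) (v b, 0))
      (frechet_derivative F (at (\<sigma>0, y)) (w b, 0)) y" if "y \<in> chart_image c" for y
    using fundamental_field_chart[OF v chart_inv_mem[OF that]] fundamental_field_chart[OF w chart_inv_mem[OF that]]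
      tensor2_in_chart_eq[OF A c(1) chart_inv_mem[OF that] smooth_action_orbit_map(3)[OF B A act]
        smooth_action_orbit_map(3)[OF B A act], of g v w]
    by (simp add: h_def chart_chart_inv[OF that])
  have lim: "((\<lambda>\<epsilon>. tensor2_in_chart A g c (frechet_derivative F (at (\<sigma>0, y0 + \<epsilon> *\<^sub>R X)) (v b, 0))
      (frechet_derivative F (at (\<sigma>0, y0 + \<epsilon> *\<^sub>R X)) (w b, 0)) (y0 + \<epsilon> *\<^sub>R X) / (\<epsilon> * \<epsilon>)) \<longlongrightarrow>
      Q (isotropy (v b) X) (isotropy (w b) X)) (at 0)"
    by (rule tensor_second_order_limit[where G = "\<lambda>y u w. tensor2_in_chart A g c u w y",
          OF open_chart_image[OF chart_c] y0_mem metric_in_chart(2)[OF A metric c(1)]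
          smooth_on_imp_continuous_on[OF metric_in_chart(1)[OF A metric c(1)]]
          field_has_derivative field_base field_has_derivative field_base])
  have line: "((\<lambda>\<epsilon>. y0 + \<epsilon> *\<^sub>R X) \<longlongrightarrow> y0) (at 0)"
    by (rule tendsto_eq_intros | simp)+
  have "eventually (\<lambda>\<epsilon>. tensor2_in_chart A g c (frechet_derivative F (at (\<sigma>0, y0 + \<epsilon> *\<^sub>R X)) (v b, 0))
      (frechet_derivative F (at (\<sigma>0, y0 + \<epsilon> *\<^sub>R X)) (w b, 0)) (y0 + \<epsilon> *\<^sub>R X) / (\<epsilon> * \<epsilon>) =
      h (chart_inv c (y0 + \<epsilon> *\<^sub>R X)) / (\<epsilon> * \<epsilon>)) (at 0)"
    using topological_tendstoD[OF line open_chart_image[OF chart_c] y0_mem]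
    by eventually_elim (simp add: h)
  from Lim_transform_eventually[OF lim this] show ?thesis .
qed

text \<open>Pointwise identities between inner products of the two fields pass to the second-order
  limits, where they become the orthogonality and the equal lengths of the linearisations.\<close>

lemma isotropy_eq_0:
  assumes v: "v \<in> lie_algebra B" and w: "w \<in> lie_algebra B"
    and orth: "\<And>x. g x (fundamental_field B A \<rho> v x) (fundamental_field B A \<rho> w x) = 0"
    and len: "\<And>x. g x (fundamental_field B A \<rho> v x) (fundamental_field B A \<rho> v x) =
      g x (fundamental_field B A \<rho> w x) (fundamental_field B A \<rho> w x)"
  shows "isotropy (v b) X = 0"
proof (rule skew_commuting_conformal_eq_0[where Q = Q and S = "isotropy (v b)" and T = "isotropy (w b)"])
  show "Q (isotropy (v b) X) (isotropy (w b) X) = 0" for X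
    using fundamental_field_limit[OF v w, of X] unfolding orth by (simp add: tendsto_const_iff)
  show "Q (isotropy (v b) X) (isotropy (v b) X) = Q (isotropy (w b) X) (isotropy (w b) X)" for X
    using fundamental_field_limit[OF v v, of X] fundamental_field_limit[OF w w, of X] unfolding len
    by (rule tendsto_unique[OF at_neq_bot])
qed (fact Q_bilinear Q_commute Q_pos isotropy_linear isotropy_skew isotropy_commute)+

text \<open>Near \<open>s\<close>, \<open>R t\<close> equals \<open>R s\<close> composed with
  \<open>R (t - s)\<close>, and \<open>t - s\<close> is close to the unit, where the derivative is
  \<open>isotropy\<close>. Thus vanishing at the unit spreads to every point of the group.\<close>

lemma R_has_derivative_0:
  assumes zero: "\<And>\<tau> X. isotropy \<tau> X = 0" and d: "d \<in> B" "s \<in> fst d"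
  shows "((\<lambda>\<sigma>. R (chart_inv d \<sigma>) X) has_derivative (\<lambda>_. 0)) (at (snd d s))"
proof -
  have chart_d: "is_chart d"
    by (rule atlas_chart[OF B d(1)])
  have s: "chart_inv d (snd d s) = s"
    by (rule chart_inv_chart[OF chart_d d(2)])
  have plus: "smooth_map (product_atlas B B) B (\<lambda>(s, t). s + t)"
    using lie by (simp add: abelian_lie_group_def)
  have dif: "(snd b \<circ> (\<lambda>t. t + - s) \<circ> chart_inv d) differentiable at (snd d s)"
    using smooth_map_slice_differentiable[OF B B B plus d b(1), of "- s"] b(2) by simp
  have "((\<lambda>\<sigma>. R (chart_inv b \<sigma>) X) has_derivative (\<lambda>_. 0)) (at ((snd b \<circ> (\<lambda>t. t + - s) \<circ> chart_inv d) (snd d s)))"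
    using R_chart_has_derivative[of X] by (simp add: zero s)
  from diff_chain_at[OF has_frechet_derivative[OF dif] this]
  have "((\<lambda>\<sigma>. R (chart_inv b (snd b (chart_inv d \<sigma> - s))) X) has_derivative (\<lambda>_. 0)) (at (snd d s))"
    by (simp add: o_def)
  from bounded_linear.has_derivative[OF linear_conv_bounded_linear[THEN iffD1, OF R_linear] this, of s]
  have *: "((\<lambda>\<sigma>. R s (R (chart_inv b (snd b (chart_inv d \<sigma> - s))) X)) has_derivative (\<lambda>_. 0)) (at (snd d s))"
    by (simp add: linear_0[OF R_linear])
  have cont: "continuous_on UNIV (\<lambda>t. t + - s)"
  proof -
    have "continuous_on UNIV (\<lambda>t. (\<lambda>(s, t). s + t) (t, - s))"
      using plus unfolding smooth_map_def
      by (intro continuous_on_compose2[of UNIV "\<lambda>(s, t). s + t" UNIV "\<lambda>t. (t, - s)"])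
        (auto intro!: continuous_on_Pair continuous_on_id continuous_on_const)
    then show ?thesis
      by simp
  qed
  show ?thesis
  proof (rule has_derivative_transform_within_open[OF *])
    show "open (snd d ` (fst d \<inter> (\<lambda>t. t + - s) -` fst b))"
      by (intro open_chart_image_Int[OF chart_d] open_vimage open_domain[OF B b(1)] cont)
    show "snd d s \<in> snd d ` (fst d \<inter> (\<lambda>t. t + - s) -` fst b)"
      using d(2) b(2) by simp
    show "R s (R (chart_inv b (snd b (chart_inv d \<sigma> - s))) X) = R (chart_inv d \<sigma>) X"
      if \<sigma>: "\<sigma> \<in> snd d ` (fst d \<inter> (\<lambda>t. t + - s) -` fst b)" for \<sigma>
    proof -
      obtain t where t: "\<sigma> = snd d t" "t \<in> fst d" "t + - s \<in> fst b"
        using \<sigma> by blast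
      have "chart_inv d \<sigma> = t"
        unfolding t(1) by (rule chart_inv_chart[OF chart_d t(2)])
      then show ?thesis
        using t(3) by (simp add: inv_b flip: R_add)
    qed
  qed
qed

lemma R_locally_constant:
  assumes zero: "\<And>\<tau> X. isotropy \<tau> X = 0"
  shows "\<exists>N. open N \<and> s \<in> N \<and> (\<forall>t\<in>N. R t X = R s X)"
proof -
  obtain d where d: "d \<in> B" "s \<in> fst d"
    using chart_at_mem[OF B] by blast
  note chart_d = atlas_chart[OF B d(1)]
  obtain r where r: "r > 0" "ball (snd d s) r \<subseteq> chart_image d"
    using openE[OF open_chart_image[OF chart_d] imageI[OF d(2)]] .
  let ?N = "{t \<in> fst d. snd d t \<in> ball (snd d s) r}"
  have "R t X = R s X" if t: "t \<in> ?N" for t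
  proof -
    have "((\<lambda>\<sigma>. R (chart_inv d \<sigma>) X) has_derivative (\<lambda>_. 0)) (at \<sigma> within ball (snd d s) r)"
      if "\<sigma> \<in> ball (snd d s) r" for \<sigma>
    proof -
      have \<sigma>: "\<sigma> \<in> chart_image d"
        using that r(2) by blast
      from R_has_derivative_0[OF zero d(1) chart_inv_mem[OF \<sigma>], of X]
      show ?thesis
        unfolding chart_chart_inv[OF \<sigma>] by (rule has_derivative_at_withinI)
    qed
    from has_derivative_zero_constant[OF convex_ball this]
    obtain k where k: "\<And>\<sigma>. \<sigma> \<in> ball (snd d s) r \<Longrightarrow> R (chart_inv d \<sigma>) X = k"
      by blast
    have "R (chart_inv d (snd d t)) X = R (chart_inv d (snd d s)) X"
      using k[of "snd d t"] k[of "snd d s"] t r(1) by simp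
    then show ?thesis
      using t d(2) by (simp add: chart_inv_chart[OF chart_d])
  qed
  moreover have "open ?N"
    by (rule open_chart_vimage[OF chart_d open_ball])
  moreover have "s \<in> ?N"
    using d(2) r(1) by simp
  ultimately have "open ?N \<and> s \<in> ?N \<and> (\<forall>t\<in>?N. R t X = R s X)"
    by (intro conjI ballI)
  then show ?thesis
    by (rule exI)
qed

text \<open>For each \<open>X\<close> the group elements fixing \<open>X\<close> form an open set
  with open complement, because the representation is locally constant. Connectedness of the group
  makes all differentials at the fixed point trivial, and rigidity on the connected manifold does
  the rest.\<close>

lemma isotropy_trivial_imp_action_trivial:
  assumes zero: "\<And>\<tau> X. isotropy \<tau> X = 0"
    and G: "connected (UNIV :: 'g set)" and M: "connected (UNIV :: 'a set)"
  shows "\<rho> s x = x"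
proof (rule isometry_eq_id[OF A metric iso M c fixed])
  fix X
  let ?S = "{s. R s X = X}"
  have "open ?S"
    unfolding open_subopen[of ?S]
  proof
    fix s
    assume s: "s \<in> ?S"
    obtain N where N: "open N" "s \<in> N" "\<forall>t\<in>N. R t X = R s X"
      using R_locally_constant[OF zero, of s X] by blast
    have "t \<in> ?S" if "t \<in> N" for t
      using bspec[OF N(3) that] s by simp
    then show "\<exists>N. open N \<and> s \<in> N \<and> N \<subseteq> ?S"
      using N(1,2) by blast
  qed
  moreover have "open (- ?S)"
    unfolding open_subopen[of "- ?S"]
  proof
    fix s
    assume s: "s \<in> - ?S"
    obtain N where N: "open N" "s \<in> N" "\<forall>t\<in>N. R t X = R s X"
      using R_locally_constant[OF zero, of s X] by blast
    have "t \<in> - ?S" if "t \<in> N" for t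
      using bspec[OF N(3) that] s by simp
    then show "\<exists>N. open N \<and> s \<in> N \<and> N \<subseteq> - ?S"
      using N(1,2) by blast
  qed
  moreover have "0 \<in> ?S"
    by (simp add: R_0)
  ultimately have "?S = UNIV"
    unfolding closed_def[symmetric] by (rule open_closed_UNIV[OF G])
  then show "frechet_derivative (snd c \<circ> \<rho> s \<circ> chart_inv c) (at y0) X = X"
    unfolding R_def[symmetric] by blast
qed

end

section \<open>The differential of the moment map\<close>

text \<open>One rule for three uses: expansion along the axes, combinations of two terms indexed by
  the booleans, and, with the empty sum, the zero function.\<close>

lemma function_differential_sum:
  fixes A :: "('a::topological_space, 'e::euclidean_space) chart set"
  assumes A: "smooth_atlas A" and f: "\<And>i. i \<in> I \<Longrightarrow> smooth_function A (f i)"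
  shows "function_differential A (\<lambda>y. \<Sum>i\<in>I. r i * f i y) x w = (\<Sum>i\<in>I. r i * function_differential A (f i) x w)"
proof -
  define c where "c = chart_at A x"
  have c: "c \<in> A" "x \<in> fst c"
    using chart_at_mem[OF A] by (simp_all add: c_def)
  have "(f i \<circ> chart_inv c has_derivative frechet_derivative (f i \<circ> chart_inv c) (at (snd c x))) (at (snd c x))"
    if "i \<in> I" for i
  proof (rule smooth_on_has_derivative)
    show "smooth_on (chart_image c) (f i \<circ> chart_inv c)"
      using f[OF that] c(1) unfolding smooth_function_def by blast
  qed (use c in simp)
  then have "((\<lambda>y. \<Sum>i\<in>I. r i * (f i \<circ> chart_inv c) y) has_derivative
      (\<lambda>h. \<Sum>i\<in>I. r i * frechet_derivative (f i \<circ> chart_inv c) (at (snd c x)) h)) (at (snd c x))"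
    by (intro has_derivative_sum has_derivative_mult_right)
  then have "(((\<lambda>y. \<Sum>i\<in>I. r i * f i y) \<circ> chart_inv c) has_derivative
      (\<lambda>h. \<Sum>i\<in>I. r i * frechet_derivative (f i \<circ> chart_inv c) (at (snd c x)) h)) (at (snd c x))"
    by (simp add: o_def)
  then show ?thesis
    unfolding function_differential_def Let_def c_def[symmetric] by (simp add: frechet_derivative_eqI)
qed

lemma J_q_axis: "J_q J (axis j 1) x v = J j x v"
proof -
  have "J_q J (axis j 1) x v = (\<Sum>i\<in>UNIV. if i = j then J i x v else 0)"
    unfolding J_q_def nth_axis_1 by (intro sum.cong) auto
  then show ?thesis
    by simp
qed

lemma moment_map_differential:
  assumes M: "hyperkaehler_moment_map B A g J \<rho> \<phi>" and v: "v \<in> lie_algebra B" and w: "w \<in> tangent_space A x"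
  shows "tensor_dual_differential A \<phi> x w v (axis j 1) = g x (J j x (fundamental_field B A \<rho> v x)) w"
proof -
  have "norm (axis j 1 :: real^3) = 1"
    by simp
  then have "function_differential A (\<lambda>x. \<phi> x v (axis j 1)) x w =
      kaehler_form g (J_q J (axis j 1)) x (fundamental_field B A \<rho> v x) w"
    using M v w unfolding hyperkaehler_moment_map_def by blast
  then show ?thesis
    by (simp add: tensor_dual_differential_def kaehler_form_def J_q_axis)
qed

text \<open>The moment map condition gives smooth components for unit quaternions. Other quaternions
  are therefore expanded along the axes first, and linearity in both arguments is inherited from
  that of \<open>\<phi> y\<close>.\<close>

lemma moment_map_differential_mem:
  fixes A :: "('a::{t2_space, second_countable_topology}, 'e::euclidean_space) chart set"
    and B :: "('g::{ab_group_add, t2_space, second_countable_topology}, 't::euclidean_space) chart set"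
  assumes A: "smooth_atlas A" and B: "smooth_atlas B" and M: "hyperkaehler_moment_map B A g J \<rho> \<phi>"
  shows "tensor_dual_differential A \<phi> x w \<in> tensor_dual (lie_algebra B)"
proof -
  let ?V = "lie_algebra B"
  let ?L = "tensor_dual_differential A \<phi> x w"
  have V: "subspace ?V"
    unfolding lie_algebra_def by (rule subspace_tangent_space[OF B])
  have \<phi>: "\<phi> y \<in> tensor_dual ?V" for y
    using M by (simp add: hyperkaehler_moment_map_def)
  have sm: "smooth_function A (\<lambda>y. \<phi> y v (axis j 1))" if "v \<in> ?V" for v j
  proof -
    have "norm (axis j 1 :: real^3) = 1"
      by simp
    then show ?thesis
      using M that unfolding hyperkaehler_moment_map_def by blast
  qed
  have axes: "?L v q = (\<Sum>j\<in>UNIV. q $ j * ?L v (axis j 1))" if "v \<in> ?V" for v q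
    unfolding tensor_dual_differential_def
    using function_differential_sum[OF A, of UNIV "\<lambda>j y. \<phi> y v (axis j 1)" "($) q" x w] sm[OF that]
    unfolding tensor_dual_axis_expand[OF \<phi> that, of _ q] by simp
  have comb: "?L (r *\<^sub>R u + s *\<^sub>R v) q = r * ?L u q + s * ?L v q" if uv: "u \<in> ?V" "v \<in> ?V" for u v r s q
  proof -
    have uv': "r *\<^sub>R u + s *\<^sub>R v \<in> ?V" "r *\<^sub>R u \<in> ?V" "s *\<^sub>R v \<in> ?V"
      using uv by (auto intro!: subspace_add[OF V] subspace_scale[OF V])
    have "?L (r *\<^sub>R u + s *\<^sub>R v) (axis j 1) = r * ?L u (axis j 1) + s * ?L v (axis j 1)" for j
    proof -
      \<comment> \<open>Indexes the two terms of the combination by the booleans, to make it a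
        finite sum.\<close>
      define h where "h i y = \<phi> y (if i then u else v) (axis j 1)" for i y
      have "\<phi> y (r *\<^sub>R u + s *\<^sub>R v) (axis j 1) = (\<Sum>i\<in>UNIV. (if i then r else s) * h i y)" for y
        using \<phi>[of y] uv uv' unfolding tensor_dual_def linear_map_on_def by (simp add: UNIV_bool h_def)
      moreover have "smooth_function A (h i)" for i
        using sm uv unfolding h_def by (cases i) simp_all
      ultimately have "?L (r *\<^sub>R u + s *\<^sub>R v) (axis j 1) = (\<Sum>i\<in>UNIV. (if i then r else s) * function_differential A (h i) x w)"
        unfolding tensor_dual_differential_def by (simp only: function_differential_sum[OF A])
      then show ?thesis
        by (simp add: UNIV_bool h_def[abs_def] tensor_dual_differential_def)
    qed
    then show ?thesis
      unfolding axes[OF uv'(1), of q] axes[OF uv(1), of q] axes[OF uv(2), of q]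
      by (simp add: sum_distrib_left sum.distrib algebra_simps)
  qed
  have "linear_map_on ?V (\<lambda>v. ?L v q)" for q
    unfolding linear_map_on_def
    using comb[of _ _ 1 1 q] comb[of _ _ _ 0 q] by simp
  moreover have "linear (?L v)" if "v \<in> ?V" for v
  proof (rule linearI)
    show "?L v (q + q') = ?L v q + ?L v q'" for q q'
      unfolding axes[OF that, of q] axes[OF that, of q'] axes[OF that, of "q + q'"]
      by (simp add: sum.distrib algebra_simps)
    show "?L v (r *\<^sub>R q) = r *\<^sub>R ?L v q" for r q
      unfolding axes[OF that, of q] axes[OF that, of "r *\<^sub>R q"]
      by (simp add: sum_distrib_left algebra_simps)
  qed
  moreover have "?L v = 0" if "v \<notin> ?V" for v
  proof
    fix q
    have "\<phi> y v q = 0" for y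
      using \<phi>[of y] that by (simp add: tensor_dual_def)
    then show "?L v q = 0 q"
      using function_differential_sum[OF A, of "{}" "\<lambda>_ _. 0" "\<lambda>_. 0" x w] by (simp add: tensor_dual_differential_def)
  qed
  ultimately show ?thesis
    by (simp add: tensor_dual_def)
qed

lemma hyperkaehler_at:
  assumes "hyperkaehler_structure A g J"
  shows "smooth_atlas A" "riemannian_metric A g"
    and "v \<in> tangent_space A x \<Longrightarrow> J j x v \<in> tangent_space A x"
    and "v \<in> tangent_space A x \<Longrightarrow> J j x (J j x v) = - v"
    and "v \<in> tangent_space A x \<Longrightarrow> w \<in> tangent_space A x \<Longrightarrow> g x (J j x v) (J j x w) = g x v w"
    and "v \<in> tangent_space A x \<Longrightarrow> J 1 x (J 2 x v) = J 3 x v"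
    and "v \<in> tangent_space A x \<Longrightarrow> J 2 x (J 1 x v) = - J 3 x v"
    and "J j x 0 = 0"
proof -
  have K: "kaehler_structure A g (J j)" for j
    using assms by (simp add: hyperkaehler_structure_def)
  show A: "smooth_atlas A"
    using assms by (simp add: hyperkaehler_structure_def smooth_structure_def)
  show "riemannian_metric A g"
    using K by (simp add: kaehler_structure_def)
  have acs: "almost_complex_structure A (J j)"
    using K by (simp add: kaehler_structure_def complex_structure_def)
  then have "linear_map_on (tangent_space A x) (J j x)"
    unfolding almost_complex_structure_def by blast
  then have "J j x (0 *\<^sub>R 0) = 0 *\<^sub>R J j x 0"
    unfolding linear_map_on_def using subspace_0[OF subspace_tangent_space[OF A, of x]] by blast
  then show "J j x 0 = 0"
    by simp
  show "J j x v \<in> tangent_space A x" "J j x (J j x v) = - v" if "v \<in> tangent_space A x"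
    using acs that unfolding almost_complex_structure_def by blast+
  show "g x (J j x v) (J j x w) = g x v w" if "v \<in> tangent_space A x" "w \<in> tangent_space A x"
    using K[of j] that unfolding kaehler_structure_def by blast
  show "J 1 x (J 2 x v) = J 3 x v" "J 2 x (J 1 x v) = - J 3 x v" if "v \<in> tangent_space A x"
    using assms that unfolding hyperkaehler_structure_def by blast+
qed

text \<open>The Euclidean inner product of the model space, pulled back by a chart at the unit. It
  is definite because one coordinate vector determines the tangent vector. This is the witness for
  the existence claim.\<close>

lemma lie_algebra_inner_product:
  fixes B :: "('g::{ab_group_add, t2_space, second_countable_topology}, 't::euclidean_space) chart set"
  assumes B: "smooth_atlas B" and b: "b \<in> B" "0 \<in> fst b"
  shows "inner_product_on (lie_algebra B) (\<lambda>u w. u b \<bullet> w b)"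
proof -
  have "u b \<noteq> 0" if u: "u \<in> lie_algebra B" "u \<noteq> 0" for u
  proof
    assume "u b = 0"
    then have "u = 0"
      using u(1) subspace_0[OF subspace_tangent_space[OF B]] unfolding lie_algebra_def
      by (intro tangent_vec_eqI[OF B b]) (simp_all add: zero_fun_def)
    then show False
      using u(2) by contradiction
  qed
  then show ?thesis
    unfolding inner_product_on_def linear_map_on_def
    by (simp add: plus_fun_def scaleR_fun_def inner_right_distrib inner_commute)
qed

section \<open>The two implications\<close>

lemma horizontally_weakly_conformal_of_DIM_1:
  fixes A :: "('a::{t2_space, second_countable_topology}, 'e::euclidean_space) chart set"
    and B :: "('g::{ab_group_add, t2_space, second_countable_topology}, 't::euclidean_space) chart set"
  assumes B: "smooth_atlas B" and HK: "hyperkaehler_structure A g J" and act: "smooth_action B A \<rho>"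
    and M: "hyperkaehler_moment_map B A g J \<rho> \<phi>" and dim: "DIM('t) = 1"
    and k: "inner_product_on (lie_algebra B) k"
  shows "horizontally_weakly_conformal A g (lie_algebra B) (tensor_dual_inner (lie_algebra B) k) \<phi>"
proof -
  let ?V = "lie_algebra B"
  note A = hyperkaehler_at(1)[OF HK] and metric = hyperkaehler_at(2)[OF HK]
  obtain b where b: "b \<in> B" "0 \<in> fst b"
    using chart_at_mem[OF B] by blast
  obtain u :: 't where u: "Basis = {u}"
    using card_1_singletonE[OF dim] .
  define v0 where "v0 = coord_vec B b 0 u"
  have V: "subspace ?V"
    unfolding lie_algebra_def by (rule subspace_tangent_space[OF B])
  have span: "?V = span {v0}"
    unfolding lie_algebra_def tangent_space_eq_span[OF B b] u v0_def by simp
  have "u \<noteq> 0"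
    using u nonzero_Basis by blast
  then have "v0 \<noteq> 0"
    using coord_vec_apply[OF B b, of u] unfolding v0_def[symmetric] by (metis zero_fun_apply)
  have ex: "\<exists>E. orthonormal_basis ?V k E"
    by (rule orthonormal_basis_exists[OF V k _ span]) simp
  then have E: "orthonormal_basis ?V k (SOME E. orthonormal_basis ?V k E)"
    by (rule someI_ex)
  then obtain e where e: "(SOME E. orthonormal_basis ?V k E) = {e}"
    by (rule orthonormal_basis_of_line[OF V k span \<open>v0 \<noteq> 0\<close>])
  have "orthonormal_basis ?V k {e}"
    using E unfolding e .
  then have "span {e} = ?V" and eV: "e \<in> ?V"
    unfolding orthonormal_basis_def by blast+
  note spane = this(1)[symmetric]
  show ?thesis
    unfolding horizontally_weakly_conformal_def Let_def
  proof
    fix x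
    let ?T = "tangent_space A x"
    let ?L = "tensor_dual_differential A \<phi> x"
    define X where "X = fundamental_field B A \<rho> e x"
    have T: "subspace ?T" "inner_product_on ?T (g x)"
      using subspace_tangent_space[OF A] metric by (simp_all add: riemannian_metric_def)
    have X: "X \<in> ?T"
      unfolding X_def by (rule smooth_action_orbit_map(3)[OF B A act])
    have Ltd: "?L w \<in> tensor_dual ?V" for w
      by (rule moment_map_differential_mem[OF A B M])
    have Le: "?L w e (axis j 1) = g x (J j x X) w" if "w \<in> ?T" for w j
      unfolding X_def by (rule moment_map_differential[OF M eV that])
    show "(\<forall>w\<in>?T. ?L w = 0) \<or> conformal_linear_isomorphism (horizontal_space ?T (g x) ?L) (g x)
        (tensor_dual ?V) (tensor_dual_inner ?V k) ?L"
    \<comment> \<open>Where the field vanishes, so do all three gradients, and with them the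
      differential. Elsewhere the gradients are orthogonal with common squared length
      \<open>g x X X\<close>, which is the conformality factor.\<close>
    proof (cases "X = 0")
      case True
      have "?L w = 0" if w: "w \<in> ?T" for w
      proof (rule tensor_dual_eqI[OF Ltd _ V spane])
        show "0 \<in> tensor_dual ?V"
          using tensor_dual_scale[OF Ltd[of w], of 0] by simp
        have "g x 0 w = 0"
          using ip_scale_left[OF T w w, of 0] by simp
        then show "?L w e (axis j 1) = 0 e (axis j 1)" for j
          using Le[OF w] by (simp add: True hyperkaehler_at(8)[OF HK])
      qed
      then show ?thesis
        by blast
    next
      case False
      have orth: "g x (J i x X) (J j x X) = (if i = j then g x X X else 0)" for i j
        by (rule quaternionic_orthogonal[where I = "\<lambda>j. J j x", OF T hyperkaehler_at(3)[OF HK]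
              hyperkaehler_at(4)[OF HK] hyperkaehler_at(5)[OF HK] hyperkaehler_at(6)[OF HK]
              hyperkaehler_at(7)[OF HK] X])
      have "conformal_linear_isomorphism (horizontal_space ?T (g x) ?L) (g x)
          (tensor_dual ?V) (tensor_dual_inner ?V k) ?L"
      proof (rule orthogonal_gradients_imp_conformal[where N = "\<lambda>j. J j x X" and c = "g x X X", OF V k spane e T])
        show "?L w \<in> tensor_dual ?V" for w
          by (rule Ltd)
        show "J j x X \<in> ?T" for j
          by (rule hyperkaehler_at(3)[OF HK X])
        show "g x (J i x X) (J j x X) = (if i = j then g x X X else 0)" for i j
          by (rule orth)
        show "0 < g x X X"
          by (rule ip_pos[OF T X False])
        show "?L w e (axis j 1) = g x (J j x X) w" if "w \<in> ?T" for w j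
          by (rule Le[OF that])
      qed
      then show ?thesis
        by blast
    qed
  qed
qed

text \<open>The components along the first axis suffice: \<open>J 1\<close> is isometric, so their
  gradients have the same inner products as the fields. The factor depends on \<open>x\<close>, and
  it is 0 where the differential vanishes.\<close>

lemma horizontally_weakly_conformal_imp_field_inner:
  fixes A :: "('a::{t2_space, second_countable_topology}, 'e::euclidean_space) chart set"
    and B :: "('g::{ab_group_add, t2_space, second_countable_topology}, 't::euclidean_space) chart set"
  assumes B: "smooth_atlas B" and HK: "hyperkaehler_structure A g J" and act: "smooth_action B A \<rho>"
    and M: "hyperkaehler_moment_map B A g J \<rho> \<phi>" and k: "inner_product_on (lie_algebra B) k"
    and conf: "horizontally_weakly_conformal A g (lie_algebra B) (tensor_dual_inner (lie_algebra B) k) \<phi>"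
  shows "\<exists>r. \<forall>v\<in>lie_algebra B. \<forall>w\<in>lie_algebra B.
    g x (fundamental_field B A \<rho> v x) (fundamental_field B A \<rho> w x) = r * k v w"
proof -
  let ?V = "lie_algebra B"
  let ?T = "tangent_space A x"
  let ?L = "tensor_dual_differential A \<phi> x"
  define N where "N v = J 1 x (fundamental_field B A \<rho> v x)" for v
  note A = hyperkaehler_at(1)[OF HK] and metric = hyperkaehler_at(2)[OF HK]
  have T: "subspace ?T" "inner_product_on ?T (g x)"
    using subspace_tangent_space[OF A] metric by (simp_all add: riemannian_metric_def)
  obtain b where b: "b \<in> B" "0 \<in> fst b"
    using chart_at_mem[OF B] by blast
  have V: "subspace ?V" "?V = span (coord_vec B b 0 ` Basis)"
    unfolding lie_algebra_def by (rule subspace_tangent_space[OF B] tangent_space_eq_span[OF B b])+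
  have field: "fundamental_field B A \<rho> v x \<in> ?T" for v
    by (rule smooth_action_orbit_map(3)[OF B A act])
  have NT: "N v \<in> ?T" for v
    unfolding N_def by (rule hyperkaehler_at(3)[OF HK field])
  have L: "?L w v (axis 1 1) = g x (N v) w" if "v \<in> ?V" "w \<in> ?T" for v w
    unfolding N_def by (rule moment_map_differential[OF M that])
  have "\<exists>r. \<forall>v\<in>?V. \<forall>w\<in>?V. g x (N v) (N w) = r * k v w"
  proof (cases "\<forall>w\<in>?T. ?L w = 0")
    case True
    have "g x (N v) (N w) = 0 * k v w" if "v \<in> ?V" "w \<in> ?V" for v w
      using L[OF that(1) NT[of w]] bspec[OF True NT[of w]] by (simp add: zero_fun_def)
    then show ?thesis
      by blast
  next
    case False
    then have "conformal_linear_isomorphism (horizontal_space ?T (g x) ?L) (g x)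
        (tensor_dual ?V) (tensor_dual_inner ?V k) ?L"
      using conf unfolding horizontally_weakly_conformal_def Let_def by blast
    then show ?thesis
      by (rule conformal_imp_gradient_inner[OF V(1) k finite_imageI[OF finite_Basis] V(2) T])
        (rule NT, rule L)
  qed
  moreover have "g x (N v) (N w) = g x (fundamental_field B A \<rho> v x) (fundamental_field B A \<rho> w x)" for v w
    unfolding N_def by (rule hyperkaehler_at(5)[OF HK field field])
  ultimately show ?thesis
    by simp
qed

lemma DIM_1_of_conformal:
  fixes A :: "('a::{t2_space, second_countable_topology}, 'e::euclidean_space) chart set"
    and B :: "('g::{ab_group_add, t2_space, second_countable_topology}, 't::euclidean_space) chart set"
  assumes lie: "abelian_lie_group B" and G: "connected (UNIV :: 'g set)"
    and HK: "hyperkaehler_structure A g J" and conn: "connected (UNIV :: 'a set)"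
    and act: "smooth_action B A \<rho>" and nontriv: "nontrivial_action \<rho>"
    and iso: "\<And>s. riemannian_isometry A g (\<rho> s)"
    and M: "hyperkaehler_moment_map B A g J \<rho> \<phi>" and fixed: "fixed_point \<rho> x0"
    and k: "inner_product_on (lie_algebra B) k"
    and conf: "horizontally_weakly_conformal A g (lie_algebra B) (tensor_dual_inner (lie_algebra B) k) \<phi>"
  shows "DIM('t) = 1"
proof (rule ccontr)
  assume dim: "DIM('t) \<noteq> 1"
  let ?V = "lie_algebra B"
  note A = hyperkaehler_at(1)[OF HK] and metric = hyperkaehler_at(2)[OF HK]
  interpret fixed_point_action A g B \<rho> x0
    using A metric lie act iso fixed by unfold_locales (simp_all add: fixed_point_def)
  have V: "subspace ?V" "?V = span (coord_vec B b 0 ` Basis)"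
    unfolding lie_algebra_def by (rule subspace_tangent_space[OF B] tangent_space_eq_span[OF B b])+
  obtain E where "orthonormal_basis ?V k E"
    using orthonormal_basis_exists[OF V(1) k finite_imageI[OF finite_Basis] V(2)] by blast
  then have E: "E \<subseteq> ?V" "span E = ?V" "\<forall>e\<in>E. \<forall>f\<in>E. k e f = (if e = f then 1 else 0)"
    by (simp_all add: orthonormal_basis_def)
  have ev: "linear (\<lambda>v::('g, 't) tvec. v b)"
    by (rule linearI) (simp_all add: plus_fun_def scaleR_fun_def)
  have coord: "coord_vec B b 0 \<tau> \<in> span E" "coord_vec B b 0 \<tau> b = \<tau>" for \<tau>
    using coord_vec_mem[OF B b] coord_vec_apply[OF B b] E(2) unfolding lie_algebra_def by simp_all
  \<comment> \<open>With a one-element basis every coordinate vector would be a multiple of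
    \<open>e b\<close>, so the model space would have dimension at most 1.\<close>
  have "\<exists>f\<in>E. f \<noteq> e" if "e \<in> E" for e
  proof (rule ccontr)
    assume "\<not> (\<exists>f\<in>E. f \<noteq> e)"
    then have "E = {e}"
      using that by blast
    then have "\<tau> \<in> span {e b}" for \<tau>
      using coord[of \<tau>] imageI[of "coord_vec B b 0 \<tau>" "span E" "\<lambda>v. v b"] linear_span_image[OF ev, of "{e}"] by simp
    then have "dim (UNIV :: 't set) \<le> card {e b}"
      by (intro dim_le_card) auto
    then show False
      using dim DIM_positive[where 'a = 't] by simp
  qed
  then have "isotropy (e b) X = 0" if e: "e \<in> E" for e X
  proof -
    obtain f where f: "f \<in> E" "f \<noteq> e"
      using \<open>e \<in> E \<Longrightarrow> \<exists>f\<in>E. f \<noteq> e\<close> e by blast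
    have ef: "e \<in> ?V" "f \<in> ?V" "k e f = 0" "k e e = 1" "k f f = 1"
      using E(1,3) e f by auto
    have inner: "\<exists>r. g x (fundamental_field B A \<rho> e x) (fundamental_field B A \<rho> f x) = r * k e f \<and>
        g x (fundamental_field B A \<rho> e x) (fundamental_field B A \<rho> e x) = r * k e e \<and>
        g x (fundamental_field B A \<rho> f x) (fundamental_field B A \<rho> f x) = r * k f f" for x
      using horizontally_weakly_conformal_imp_field_inner[OF B HK act M k conf, of x] ef(1,2) by blast
    show ?thesis
    proof (rule isotropy_eq_0[OF ef(1,2)])
      fix x
      show "g x (fundamental_field B A \<rho> e x) (fundamental_field B A \<rho> f x) = 0"
        "g x (fundamental_field B A \<rho> e x) (fundamental_field B A \<rho> e x) =
          g x (fundamental_field B A \<rho> f x) (fundamental_field B A \<rho> f x)"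
        using inner[of x] unfolding ef(3-5) by auto
    qed
  qed
  \<comment> \<open>\<open>isotropy\<close> is linear in its first argument and vanishes on the
    coordinates of \<open>E\<close>; every \<tau> is the coordinate vector of an element of the span
    of \<open>E\<close>.\<close>
  then have "isotropy \<tau> X = 0" for \<tau> X
    using linear_eq_0_on_span[OF linear_compose[OF ev isotropy_linear(2)[of X]] _ coord(1)[of \<tau>]] coord(2)[of \<tau>]
    by (simp add: o_def)
  then have "\<rho> s x = x" for s x
    by (rule isotropy_trivial_imp_action_trivial[OF _ G conn])
  then show False
    using nontriv by (simp add: nontrivial_action_def fixed_point_def)
qed

theorem corollary3p6:
  fixes A :: "('a::{t2_space, second_countable_topology}, 'e::euclidean_space) chart set"
    and g :: "('a, 'e) tensor2"
    and J :: "3 \<Rightarrow> ('a, 'e) endo"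
    and B :: "('g::{ab_group_add, t2_space, second_countable_topology}, 't::euclidean_space) chart set"
    and \<rho> :: "'g \<Rightarrow> 'a \<Rightarrow> 'a"
    and \<phi> :: "'a \<Rightarrow> ('g, 't) tvec \<Rightarrow> real^3 \<Rightarrow> real"
  assumes "abelian_lie_group B"
    and "connected (UNIV :: 'g set)"
    and "hyperkaehler_structure A g J"
    and "connected (UNIV :: 'a set)"
    and "betti_number 1 (euclidean :: 'a topology) = 0"
    and "smooth_action B A \<rho>"
    and "nontrivial_action \<rho>"
    and "\<And>s. riemannian_isometry A g (\<rho> s)"
    and "\<And>s j. holomorphic_map A (J j) (\<rho> s)"
    and "hyperkaehler_moment_map B A g J \<rho> \<phi>"
    and "\<exists>x. fixed_point \<rho> x"
  shows "(\<exists>k. inner_product_on (lie_algebra B) k \<and>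
            horizontally_weakly_conformal A g (lie_algebra B)
              (tensor_dual_inner (lie_algebra B) k) \<phi>)
         \<longleftrightarrow> DIM('t) = 1"
proof
  assume "\<exists>k. inner_product_on (lie_algebra B) k \<and>
    horizontally_weakly_conformal A g (lie_algebra B) (tensor_dual_inner (lie_algebra B) k) \<phi>"
  then show "DIM('t) = 1"
    using assms(11) DIM_1_of_conformal[OF assms(1-4,6-8,10)] by blast
next
  assume dim: "DIM('t) = 1"
  have B: "smooth_atlas B"
    using assms(1) by (simp add: abelian_lie_group_def smooth_structure_def)
  obtain b where "b \<in> B" "0 \<in> fst b"
    using chart_at_mem[OF B] by blast
  from lie_algebra_inner_product[OF B this]
  show "\<exists>k. inner_product_on (lie_algebra B) k \<and>
    horizontally_weakly_conformal A g (lie_algebra B) (tensor_dual_inner (lie_algebra B) k) \<phi>"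
    using horizontally_weakly_conformal_of_DIM_1[OF B assms(3,6,10) dim] by blast
qed

end
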